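(* Let $k\ge 3$. (1) Let $\mathcal{G}$ be a $k$-uniform unicyclic hypergraph of order $n$. Then $$\frac{k-1+\sqrt{(k-1)^{2}+8(k-1)}}{2(k-1)}\le \rho(\mathcal{G}),$$ with equality if and only if $\mathcal{G}\cong\mathscr{C}(n,k)$. (2) Let $\mathcal{G}$ be a $k$-uniform unicyclic hypergraph of order $n$ with $\mathcal{G}\not\cong\mathscr{C}(n,k)$. Then $\rho(Lop_{g,k,1;2})\le\rho(\mathcal{G})$, where $g=\frac{n-k+1}{k-1}$, with equality if and only if $\mathcal{G}\cong Lop_{g,k,1;2}$.
   Context: A hypergraph $\mathcal{G}=(V,E)$ consists of a finite nonempty vertex set $V$ and a set $E$ of edges, each edge being a subset of $V$ with at least two elements (edges are pairwise distinct, undirected). Its order is $|V|$. It is $k$-uniform if every edge has exactly $k$ elements. Isomorphism $\cong$ means a bijection of vertex sets that induces a bijection of edge sets. Adjacency matrix: $\mathcal{A}_{\mathcal{G}}$ is the real symmetric matrix indexed by $V$ with $(\mathcal{A}_{\mathcal{G}})_{ij}=\sum_{e\in E,\ i,j\in e}\frac{1}{|e|-1}$ for $i\ne j$, and zero diagonal. The spectral radius $\rho(\mathcal{G})$ is the maximum modulus of the eigenvalues of $\mathcal{A}_{\mathcal{G}}$. A hyperpath of length $q$ is an alternating sequence $v_1e_1v_2e_2\cdots v_qe_qv_{q+1}$ of distinct vertices and distinct edges with $v_i,v_{i+1}\in e_i$, $e_i\cap e_{i+1}=\{v_{i+1}\}$, and $e_i\cap e_j=\emptyset$ if $|i-j|\ge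 2$. A hypergraph is connected if any two vertices are joined by a hyperpath. A connected $k$-uniform hypergraph with $n$ vertices and $m$ edges is unicyclic if $n-1=(k-1)m-1$, i.e. $n=(k-1)m$. For $g\ge 2$, $\mathcal{C}_g$ denotes the $k$-uniform $g$-hypercycle $v_1e_1v_2e_2\cdots v_ge_gv_1$ with $e_i=\{v_i,v_{a(i,1)},\dots,v_{a(i,k-2)},v_{i+1}\}$ for $1\le i\le g$ (where $v_{g+1}:=v_1$), all the vertices $v_i$ and $v_{a(i,j)}$ ($1\le i\le g$, $1\le j\le k-2$) being distinct; for $g=2$ the two edges share exactly the two vertices $v_1,v_2$. $\mathscr{C}(n,k)$ is the $k$-uniform hypercycle of order $n$, i.e. $\mathcal{C}_m$ with $m=\frac{n}{k-1}$. $Lop_{g,k,s;2}$ (second type lollipop hypergraph) is the $k$-uniform hypergraph obtained by attaching a pendant hyperpath of length $s$ (with all edges of size $k$) at the vertex $v_{a(1,1)}$ of $\mathcal{C}_g$, i.e. $v_{a(1,1)}$ is identified with the initial vertex of a $k$-uniform hyperpath of length $s$ that is otherwise disjoint from $\mathcal{C}_g$. (So $Lop_{g,k,1;2}$ is $\mathcal{C}_g$ with a single edge attached at the degree-one vertex $v_{a(1,1)}$.) *)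

theory Defs
  imports "HOL-Analysis.Analysis" "Jordan_Normal_Form.Spectral_Radius"
begin

section \<open>Hypergraphs\<close>

record 'a hypergraph =
  verts :: "'a set"
  edges :: "'a set set"

definition hypergraph :: "'a hypergraph \<Rightarrow> bool" where
  "hypergraph G \<longleftrightarrow>
     finite (verts G) \<and> verts G \<noteq> {} \<and> (\<forall>e\<in>edges G. e \<subseteq> verts G \<and> 2 \<le> card e)"

definition uniform :: "nat \<Rightarrow> 'a hypergraph \<Rightarrow> bool" where
  "uniform k G \<longleftrightarrow> (\<forall>e\<in>edges G. card e = k)"

definition hypergraph_iso :: "'a hypergraph \<Rightarrow> 'b hypergraph \<Rightarrow> bool" where
  "hypergraph_iso G H \<longleftrightarrow>
     (\<exists>f. bij_betw f (verts G) (verts H) \<and> bij_betw ((`) f) (edges G) (edges H))"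


section \<open>Adjacency matrix and spectral radius\<close>

definition adj_entry :: "'a hypergraph \<Rightarrow> 'a \<Rightarrow> 'a \<Rightarrow> real" where
  "adj_entry G i j =
     (if i = j then 0 else (\<Sum>e\<in>{e \<in> edges G. i \<in> e \<and> j \<in> e}. 1 / (real (card e) - 1)))"

text \<open>Matrices of the library are indexed by initial segments of the natural numbers, so the
  vertices are enumerated. The enumeration is an arbitrary one: changing it conjugates the
  adjacency matrix by a permutation matrix, which does not affect the eigenvalues.\<close>

definition vertex_list :: "'a hypergraph \<Rightarrow> 'a list" where
  "vertex_list G = (SOME vs. distinct vs \<and> set vs = verts G)"

definition adjacency_matrix :: "'a hypergraph \<Rightarrow> real mat" where
  "adjacency_matrix G =
     mat (card (verts G)) (card (verts G))
       (\<lambda>(i, j). adj_entry G (vertex_list G ! i) (vertex_list G ! j))"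

definition rho :: "'a hypergraph \<Rightarrow> real" where
  "rho G = spectral_radius (map_mat complex_of_real (adjacency_matrix G))"


section \<open>Connected and unicyclic hypergraphs\<close>

text \<open>\<open>vs\<close> lists the vertices \<open>v\<^sub>1, \<dots>, v\<^sub>q\<^sub>+\<^sub>1\<close> and \<open>es\<close> the edges \<open>e\<^sub>1, \<dots>, e\<^sub>q\<close>, both counted
  from 0; \<open>q = 0\<close> is allowed.\<close>

definition berge_path :: "'a hypergraph \<Rightarrow> 'a list \<Rightarrow> 'a set list \<Rightarrow> bool" where
  "berge_path G vs es \<longleftrightarrow>
     length vs = length es + 1 \<and> distinct vs \<and> distinct es \<and>
     set vs \<subseteq> verts G \<and> set es \<subseteq> edges G \<and>
     (\<forall>i<length es. vs ! i \<in> es ! i \<and> vs ! (i + 1) \<in> es ! i)"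

definition hyperpath :: "'a hypergraph \<Rightarrow> 'a list \<Rightarrow> 'a set list \<Rightarrow> bool" where
  "hyperpath G vs es \<longleftrightarrow>
     berge_path G vs es \<and>
     (\<forall>i. i + 1 < length es \<longrightarrow> es ! i \<inter> es ! (i + 1) = {vs ! (i + 1)}) \<and>
     (\<forall>i j. i + 2 \<le> j \<and> j < length es \<longrightarrow> es ! i \<inter> es ! j = {})"

text \<open>Connectedness only asks for alternating sequences of distinct vertices and distinct
  edges, without the conditions on intersections of edges in \<open>hyperpath\<close>. With those
  conditions a 2-hypercycle, whose two edges share two vertices, would not be connected
  (\<open>not_hyperpath_connected_hypercycle_2\<close> below), although it is meant to be
  unicyclic. The hypergraphs in which any two vertices are joined by a \<open>hyperpath\<close> are connected
  in the sense used here (\<open>hyperpath_connected_imp_connected\<close>), so results about all connected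
  hypergraphs cover them.\<close>

definition connected_hypergraph :: "'a hypergraph \<Rightarrow> bool" where
  "connected_hypergraph G \<longleftrightarrow>
     (\<forall>u\<in>verts G. \<forall>v\<in>verts G. \<exists>vs es. berge_path G vs es \<and> hd vs = u \<and> last vs = v)"

definition hyperpath_connected :: "'a hypergraph \<Rightarrow> bool" where
  "hyperpath_connected G \<longleftrightarrow>
     (\<forall>u\<in>verts G. \<forall>v\<in>verts G. \<exists>vs es. hyperpath G vs es \<and> hd vs = u \<and> last vs = v)"

lemma hyperpath_connected_imp_connected:
  "hyperpath_connected G \<Longrightarrow> connected_hypergraph G"
  unfolding hyperpath_connected_def connected_hypergraph_def hyperpath_def by blast

definition unicyclic :: "nat \<Rightarrow> 'a hypergraph \<Rightarrow> bool" where
  "unicyclic k G \<longleftrightarrow>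
     hypergraph G \<and> uniform k G \<and> connected_hypergraph G \<and>
     card (verts G) = (k - 1) * card (edges G)"


section \<open>Hypercycles and lollipop hypergraphs\<close>

text \<open>\<open>CycV i\<close> is \<open>v\<^sub>i\<close> and \<open>CycA i j\<close> is \<open>v\<^sub>a\<^sub>(\<^sub>i\<^sub>,\<^sub>j\<^sub>)\<close>. On the pendant hyperpath \<open>PathV i\<close> is the
  \<open>i\<close>-th vertex of the alternating sequence, for \<open>i \<ge> 2\<close>, and \<open>PathA i j\<close>, for \<open>1 \<le> j \<le> k - 2\<close>,
  are the remaining vertices of the \<open>i\<close>-th edge.\<close>

datatype hvert = CycV nat | CycA nat nat | PathV nat | PathA nat nat

definition cycle_edge :: "nat \<Rightarrow> nat \<Rightarrow> nat \<Rightarrow> hvert set" where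
  "cycle_edge g k i = {CycV i, CycV (if i = g then 1 else i + 1)} \<union> CycA i ` {1..k - 2}"

definition hypercycle :: "nat \<Rightarrow> nat \<Rightarrow> hvert hypergraph" where
  "hypercycle g k =
     \<lparr> verts = CycV ` {1..g} \<union> {CycA i j |i j. i \<in> {1..g} \<and> j \<in> {1..k - 2}},
       edges = cycle_edge g k ` {1..g} \<rparr>"

definition hypercycle_of_order :: "nat \<Rightarrow> nat \<Rightarrow> hvert hypergraph" where
  "hypercycle_of_order n k = hypercycle (n div (k - 1)) k"

definition pendant_vertex :: "nat \<Rightarrow> hvert" where
  "pendant_vertex i = (if i = 1 then CycA 1 1 else PathV i)"

definition pendant_edge :: "nat \<Rightarrow> nat \<Rightarrow> hvert set" where
  "pendant_edge k i = {pendant_vertex i, pendant_vertex (i + 1)} \<union> PathA i ` {1..k - 2}"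

definition lollipop2 :: "nat \<Rightarrow> nat \<Rightarrow> nat \<Rightarrow> hvert hypergraph" where
  "lollipop2 g k s =
     \<lparr> verts = verts (hypercycle g k) \<union> pendant_vertex ` {1..s + 1} \<union>
         {PathA i j |i j. i \<in> {1..s} \<and> j \<in> {1..k - 2}},
       edges = edges (hypercycle g k) \<union> pendant_edge k ` {1..s} \<rparr>"

lemma not_hyperpath_connected_hypercycle_2:
  assumes "3 \<le> k"
  shows "\<not> hyperpath_connected (hypercycle 2 k)"
proof
  assume hc: "hyperpath_connected (hypercycle 2 k)"
  have "CycA 1 1 \<in> verts (hypercycle 2 k)" "CycA 2 1 \<in> verts (hypercycle 2 k)"
    using assms by (auto simp: hypercycle_def)
  with hc obtain vs es where p: "hyperpath (hypercycle 2 k) vs es"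
    and h: "hd vs = CycA 1 1" and l: "last vs = CycA 2 1"
    unfolding hyperpath_connected_def by blast
  let ?e = "cycle_edge 2 k"
  have E: "edges (hypercycle 2 k) = {?e 1, ?e 2}"
    by (auto simp: hypercycle_def numeral_2_eq_2 atLeastAtMostSuc_conv)
  have len: "length vs = length es + 1" and d: "distinct es" and sub: "set es \<subseteq> {?e 1, ?e 2}"
    and inc: "\<And>i. i < length es \<Longrightarrow> vs ! i \<in> es ! i \<and> vs ! (i + 1) \<in> es ! i"
    and one: "\<And>i. i + 1 < length es \<Longrightarrow> es ! i \<inter> es ! (i + 1) = {vs ! (i + 1)}"
    using p unfolding hyperpath_def berge_path_def E by auto
  have ne: "vs \<noteq> []" using len by auto
  have h0: "vs ! 0 = CycA 1 1" using h ne by (simp add: hd_conv_nth)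
  have ll: "vs ! length es = CycA 2 1" using l ne len by (simp add: last_conv_nth)
  have pos: "0 < length es" using h0 ll by (cases es) auto
  have in1: "CycA 1 1 \<notin> ?e 2" and in2: "CycA 2 1 \<notin> ?e 1" by (auto simp: cycle_edge_def)
  have first: "es ! 0 = ?e 1"
    using inc[OF pos] h0 in1 sub nth_mem[OF pos] by auto
  have lt: "length es - 1 < length es" using pos by simp
  have final: "es ! (length es - 1) = ?e 2"
  proof -
    have "CycA 2 1 \<in> es ! (length es - 1)" using inc[OF lt] ll pos by simp
    moreover have "es ! (length es - 1) \<in> {?e 1, ?e 2}" using sub nth_mem[OF lt] by blast
    ultimately show ?thesis using in2 by auto
  qed
  have "?e 1 \<noteq> ?e 2" using in2 assms by (auto simp: cycle_edge_def)
  then have "length es \<noteq> 1" using first final by auto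
  moreover have "length es \<le> 2"
    using card_mono[OF _ sub] distinct_card[OF d] card_insert_le_m1[of 2 "{?e 2}" "?e 1"] by auto
  ultimately have two: "length es = 2" using pos by linarith
  have "es ! 0 \<inter> es ! 1 = {vs ! 1}" using one[of 0] two by simp
  then have "?e 1 \<inter> ?e 2 = {vs ! 1}" using first final two by simp
  moreover have "CycV 1 \<in> ?e 1 \<inter> ?e 2" "CycV 2 \<in> ?e 1 \<inter> ?e 2"
    by (auto simp: cycle_edge_def)
  ultimately have "CycV 1 = CycV 2" by (metis singletonD)
  then show False by simp
qed

end

theory Submission
  imports Defs
begin

text \<open>For a vector \<open>x\<close> on the vertices of a \<open>k\<close>-uniform hypergraph let \<open>S\<^sub>e\<close> be the sum of the entries of \<open>x\<close>
over the edge \<open>e\<close>, let \<open>d\<^sub>v\<close> be the degree of \<open>v\<close>, and let \<open>\<Lambda> = (k - 1) \<rho>\<close>. Sorting the adjacency matrix by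
edges shows that \<open>x\<close> is an eigenvector for the spectral radius iff the edge sums at every vertex \<open>v\<close> add up
to \<open>(\<Lambda> + d\<^sub>v) x\<^sub>v\<close>, and that every \<open>x\<close> satisfies
\<open>\<Sum>\<^sub>e (S\<^sub>e)^2 \<le> \<Sum>\<^sub>v (\<Lambda> + d\<^sub>v) (x\<^sub>v)^2\<close>, with equality only for eigenvectors
(\<open>rayleigh_bound\<close>, \<open>rayleigh_equality\<close>). All comparisons of spectral radii below insert a suitable test
vector into this inequality.

\<^bold>\<open>The lower bound.\<close> Let \<open>L\<close> be the value of \<open>\<Lambda>\<close> for hypercycles. It is characterised by
\<open>4 / (L + 2) + (k - 2) / (L + 1) = 1\<close>. The test vector \<open>x\<^sub>v = d\<^sub>v / (L + d\<^sub>v)\<close> has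
\<open>\<Sum>\<^sub>v (L + d\<^sub>v) (x\<^sub>v)^2 = \<Sum>\<^sub>e S\<^sub>e = \<Sum>\<^sub>v h(d\<^sub>v)\<close> for the convex function
\<open>h(d) = d^2 / (L + d)\<close>, and \<open>h\<close> lies above its chord through \<open>1\<close> and \<open>2\<close> at all natural numbers. A unicyclic
hypergraph with \<open>m\<close> edges has \<open>(k - 1) m\<close> vertices and degree sum \<open>k m\<close>, so the chord gives
\<open>\<Sum>\<^sub>e S\<^sub>e \<ge> m\<close>, and then \<open>\<Sum>\<^sub>e (S\<^sub>e)^2 \<ge> \<Sum>\<^sub>e S\<^sub>e\<close> because
\<open>\<Sum>\<^sub>e (S\<^sub>e - 1)^2 \<ge> 0\<close>. Hence \<open>\<Lambda> \<ge> L\<close>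
(\<open>scaled_rho_lower_bound\<close>). Equality forces all degrees to be \<open>1\<close> or \<open>2\<close> and every edge to have exactly two
vertices of degree \<open>2\<close>. A connected hypergraph of this kind is a hypercycle: a maximal trail through vertices of
degree \<open>2\<close> has to close up and to exhaust all edges (\<open>cycle_like_is_hypercycle\<close>).

\<^bold>\<open>The second smallest value.\<close> Counting degrees shows that a unicyclic hypergraph other than a hypercycle has a
leaf edge, that is, an edge with only one vertex of degree at least \<open>2\<close>. Removing it with its vertices of
degree \<open>1\<close> gives a unicyclic hypergraph \<open>C\<close>, and the proof is by induction on the number \<open>m\<close> of edges. If \<open>C\<close>
is a hypercycle, then the leaf edge hangs at a vertex of degree \<open>1\<close> of \<open>C\<close>, which gives the lollipop, or at a
joint \<open>w\<close> of two edges of \<open>C\<close>. In that case move the leaf edge from \<open>w\<close> to a vertex \<open>u\<close> of degree \<open>1\<close> in an edge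
at \<open>w\<close>. The result is a lollipop whose Perron vector is at least as large at \<open>w\<close> as at \<open>u\<close>, so moving
the leaf edge back increases the spectral radius (\<open>pendant_at_joint_scaled_rho_gt\<close>). If \<open>C\<close> is not a
hypercycle, then the spectral radius of the hypergraph exceeds that of \<open>C\<close>, which by induction is at least that of
the lollipop with \<open>m - 1\<close> edges, and this exceeds that of the lollipop with \<open>m\<close> edges
(\<open>lollipop2_scaled_rho_decreasing\<close>). For the last comparison contract the cycle edge with the smallest sum of the
Perron vector. Its two neighbours now meet each other in place of an edge with a smaller sum, so the edge sums
still witness the old value of \<open>\<Lambda>\<close> as a lower bound.\<close>

section \<open>The spectral radius as a maximal Rayleigh quotient\<close>

definition qform :: "'a set \<Rightarrow> ('a \<Rightarrow> 'a \<Rightarrow> real) \<Rightarrow> ('a \<Rightarrow> real) \<Rightarrow> real" where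
  "qform V a x = (\<Sum>u\<in>V. \<Sum>v\<in>V. a u v * x u * x v)"

text \<open>The unit sphere of nonnegative vectors supported on \<open>V\<close> is compact in the product topology by Tychonoff's
theorem. A maximum there is a maximum over all vectors, because the entries of \<open>a\<close> are nonnegative and so
passing to absolute values does not decrease the form.\<close>

lemma qform_maximizer_exists:
  fixes a :: "'a \<Rightarrow> 'a \<Rightarrow> real"
  assumes fin: "finite V" and ne: "V \<noteq> {}" and nonneg: "\<And>u v. 0 \<le> a u v"
  obtains x \<mu> where "\<And>v. 0 \<le> x v" "(\<Sum>v\<in>V. (x v)\<^sup>2) = 1" "qform V a x = \<mu>"
    "\<And>y. qform V a y \<le> \<mu> * (\<Sum>v\<in>V. (y v)\<^sup>2)"
proof -
  define B :: "'a \<Rightarrow> real set" where "B v = (if v \<in> V then {0..1} else {0})" for v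
  have "compact (PiE UNIV B)"
  proof -
    have "compactin (product_topology (\<lambda>_. euclidean) UNIV) (PiE UNIV B)"
      by (subst compactin_PiE) (auto simp: B_def)
    then show ?thesis by (simp add: euclidean_product_topology)
  qed
  moreover have cont: "continuous_on UNIV (\<lambda>x :: 'a \<Rightarrow> real. x v)" for v
    by (rule continuous_on_product_coordinates)
  have "closed {x :: 'a \<Rightarrow> real. (\<Sum>v\<in>V. (x v)\<^sup>2) = 1}"
    by (intro closed_Collect_eq continuous_on_sum continuous_on_power continuous_on_const cont)
  ultimately have comp: "compact (PiE UNIV B \<inter> {x. (\<Sum>v\<in>V. (x v)\<^sup>2) = 1})" (is "compact ?K")
    by (rule compact_Int_closed)
  have K: "x \<in> ?K \<longleftrightarrow> (\<forall>v. x v \<in> B v) \<and> (\<Sum>v\<in>V. (x v)\<^sup>2) = 1" for x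
    by (auto simp: PiE_def)
  obtain w where w: "w \<in> V" using ne by blast
  have "(\<lambda>v. if v = w then 1 else 0) \<in> ?K"
    unfolding K using w fin by (auto simp: B_def if_distrib[of "\<lambda>x. x\<^sup>2"] cong: if_cong)
  then have "?K \<noteq> {}" by blast
  moreover have "continuous_on UNIV (qform V a)"
    unfolding qform_def by (intro continuous_on_sum continuous_on_mult continuous_on_const cont)
  then have "continuous_on ?K (qform V a)" by (rule continuous_on_subset) simp
  ultimately obtain x where x: "x \<in> ?K" and max: "\<And>y. y \<in> ?K \<Longrightarrow> qform V a y \<le> qform V a x"
    using continuous_attains_sup[OF comp] by metis
  show thesis
  proof
    show "0 \<le> x v" for v
    proof -
      have "x v \<in> B v" using x K by blast
      then show ?thesis by (auto simp: B_def split: if_splits)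
    qed
    show "(\<Sum>v\<in>V. (x v)\<^sup>2) = 1" using x by auto
    show "qform V a x = qform V a x" ..
    fix y :: "'a \<Rightarrow> real"
    define s where "s = (\<Sum>v\<in>V. (y v)\<^sup>2)"
    show "qform V a y \<le> qform V a x * (\<Sum>v\<in>V. (y v)\<^sup>2)"
    proof (cases "s = 0")
      case True
      then have "\<forall>v\<in>V. y v = 0"
        unfolding s_def using fin by (auto simp: sum_nonneg_eq_0_iff)
      then show ?thesis by (simp add: qform_def)
    next
      case False
      have "s \<ge> 0" unfolding s_def by (simp add: sum_nonneg)
      with False have s: "s > 0" by simp
      define z where "z v = (if v \<in> V then \<bar>y v\<bar> / sqrt s else 0)" for v
      have le: "(y v)\<^sup>2 \<le> s" if "v \<in> V" for v
        unfolding s_def using that fin member_le_sum[of v V "\<lambda>v. (y v)\<^sup>2"] by simp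
      have "\<bar>y v\<bar> \<le> sqrt s" if "v \<in> V" for v
        using real_sqrt_le_mono[OF le[OF that]] by simp
      then have zB: "z v \<in> B v" for v
        using s by (auto simp: B_def z_def divide_simps)
      have zsq: "(\<Sum>v\<in>V. (z v)\<^sup>2) = 1"
      proof -
        have "(\<Sum>v\<in>V. (z v)\<^sup>2) = (\<Sum>v\<in>V. (y v)\<^sup>2 / s)"
          using s by (intro sum.cong) (auto simp: z_def power_divide)
        also have "\<dots> = 1" using s by (simp add: s_def sum_divide_distrib[symmetric])
        finally show ?thesis .
      qed
      have "qform V a y \<le> qform V a (\<lambda>v. \<bar>y v\<bar>)"
        unfolding qform_def
      proof (intro sum_mono)
        fix u v
        have "y u * y v \<le> \<bar>y u\<bar> * \<bar>y v\<bar>" by (metis abs_ge_self abs_mult)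
        then show "a u v * y u * y v \<le> a u v * \<bar>y u\<bar> * \<bar>y v\<bar>"
          using mult_left_mono[OF _ nonneg[of u v]] by (simp add: mult.assoc)
      qed
      also have "\<dots> = s * qform V a z"
      proof -
        have "a u v * \<bar>y u\<bar> * \<bar>y v\<bar> = s * (a u v * z u * z v)" if "u \<in> V" "v \<in> V" for u v
        proof -
          have "s * (a u v * z u * z v) = (sqrt s * sqrt s) * (a u v * z u * z v)" using s by simp
          also have "\<dots> = a u v * (sqrt s * z u) * (sqrt s * z v)" by (simp only: mult_ac)
          also have "\<dots> = a u v * \<bar>y u\<bar> * \<bar>y v\<bar>" using that s by (simp add: z_def)
          finally show ?thesis ..
        qed
        then have "(\<Sum>u\<in>V. \<Sum>v\<in>V. a u v * \<bar>y u\<bar> * \<bar>y v\<bar>)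
            = (\<Sum>u\<in>V. \<Sum>v\<in>V. s * (a u v * z u * z v))"
          by (intro sum.cong refl)
        then show ?thesis unfolding qform_def sum_distrib_left .
      qed
      also have "\<dots> \<le> s * qform V a x"
      proof (rule mult_left_mono)
        have "z \<in> ?K" unfolding K using zB zsq by blast
        then show "qform V a z \<le> qform V a x" by (rule max)
        show "0 \<le> s" by fact
      qed
      finally show ?thesis by (simp add: s_def mult.commute)
    qed
  qed
qed

text \<open>The defect \<open>F y = \<mu> |y|^2 - q(y)\<close> is a nonnegative quadratic form that vanishes at \<open>x\<close>. Moving from \<open>x\<close> in the
direction \<open>d = \<mu> x - a x\<close> changes it to first order by \<open>2 |d|^2\<close>, and this would make it negative for a
small negative step unless \<open>d = 0\<close>.\<close>

lemma qform_maximizer_is_eigenvector: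
  fixes a :: "'a \<Rightarrow> 'a \<Rightarrow> real"
  assumes fin: "finite V" and sym: "\<And>u v. a u v = a v u"
    and max: "\<And>y. qform V a y \<le> \<mu> * (\<Sum>v\<in>V. (y v)\<^sup>2)"
    and eq: "qform V a x = \<mu> * (\<Sum>v\<in>V. (x v)\<^sup>2)"
    and u: "u \<in> V"
  shows "(\<Sum>v\<in>V. a u v * x v) = \<mu> * x u"
proof -
  define d where "d v = \<mu> * x v - (\<Sum>w\<in>V. a v w * x w)" for v
  define F where "F y = \<mu> * (\<Sum>v\<in>V. (y v)\<^sup>2) - qform V a y" for y
  define D where "D = (\<Sum>v\<in>V. (d v)\<^sup>2)"
  have F0: "F y \<ge> 0" for y using max[of y] by (simp add: F_def)
  have expand: "F (\<lambda>v. x v + t * d v) = F x + 2 * t * D + t\<^sup>2 * F d" for t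
  proof -
    have "(x v + t * d v)\<^sup>2 = (x v)\<^sup>2 + 2 * t * (d v * x v) + t\<^sup>2 * (d v)\<^sup>2" for v
      by (simp add: power2_eq_square algebra_simps)
    then have 1: "(\<Sum>v\<in>V. (x v + t * d v)\<^sup>2)
        = (\<Sum>v\<in>V. (x v)\<^sup>2) + 2 * t * (\<Sum>v\<in>V. d v * x v) + t\<^sup>2 * (\<Sum>v\<in>V. (d v)\<^sup>2)"
      by (simp add: sum_distrib_left sum.distrib)
    have sw: "(\<Sum>u\<in>V. \<Sum>v\<in>V. a u v * x u * d v) = (\<Sum>u\<in>V. \<Sum>v\<in>V. a u v * d u * x v)"
    proof -
      have "(\<Sum>u\<in>V. \<Sum>v\<in>V. a u v * x u * d v) = (\<Sum>u\<in>V. \<Sum>v\<in>V. a v u * d v * x u)"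
        by (intro sum.cong refl) (metis sym mult.assoc mult.commute)
      also have "\<dots> = (\<Sum>u\<in>V. \<Sum>v\<in>V. a u v * d u * x v)" by (rule sum.swap)
      finally show ?thesis .
    qed
    have "a u v * (x u + t * d u) * (x v + t * d v)
        = a u v * x u * x v + t * (a u v * x u * d v) + t * (a u v * d u * x v)
          + t\<^sup>2 * (a u v * d u * d v)" for u v
      by (simp add: power2_eq_square algebra_simps)
    then have "qform V a (\<lambda>v. x v + t * d v) = qform V a x + t * (\<Sum>u\<in>V. \<Sum>v\<in>V. a u v * x u * d v)
        + t * (\<Sum>u\<in>V. \<Sum>v\<in>V. a u v * d u * x v) + t\<^sup>2 * qform V a d"
      by (simp add: qform_def sum_distrib_left sum.distrib)
    then have 2: "qform V a (\<lambda>v. x v + t * d v)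
        = qform V a x + 2 * t * (\<Sum>u\<in>V. \<Sum>v\<in>V. a u v * d u * x v) + t\<^sup>2 * qform V a d"
      using sw by simp
    have 3: "D = \<mu> * (\<Sum>v\<in>V. d v * x v) - (\<Sum>u\<in>V. \<Sum>v\<in>V. a u v * d u * x v)"
    proof -
      have "(d v)\<^sup>2 = \<mu> * (d v * x v) - (\<Sum>w\<in>V. a v w * d v * x w)" for v
      proof -
        have "(d v)\<^sup>2 = d v * (\<mu> * x v - (\<Sum>w\<in>V. a v w * x w))"
          unfolding power2_eq_square by (simp add: d_def)
        also have "\<dots> = \<mu> * (d v * x v) - (\<Sum>w\<in>V. d v * (a v w * x w))"
          by (simp add: right_diff_distrib sum_distrib_left)
        finally show ?thesis by (simp add: mult_ac)
      qed
      then show ?thesis by (simp add: D_def sum_subtractf sum_distrib_left)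
    qed
    show ?thesis unfolding F_def 1 2 3 by (simp add: algebra_simps)
  qed
  have Fx: "F x = 0" using eq by (simp add: F_def)
  \<comment> \<open>Minus the step length. The summand \<open>1\<close> keeps the denominator positive when \<open>F d = 0\<close>.\<close>
  define q where "q = D / (F d + 1)"
  have pos: "F d + 1 > 0" using F0[of d] by linarith
  then have D: "D = q * (F d + 1)" by (simp add: q_def)
  have "0 \<le> 2 * (- q) * D + (- q)\<^sup>2 * F d"
    using F0[of "\<lambda>v. x v + (- q) * d v"] expand[of "- q"] Fx by linarith
  also have "\<dots> = - (q\<^sup>2 * (F d + 2))"
    by (simp add: D power2_eq_square algebra_simps)
  finally have "q\<^sup>2 * (F d + 2) \<le> 0" by simp
  then have "q = 0" using F0[of d] by (simp add: mult_le_0_iff)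
  then have "D = 0" using D by simp
  then have "d u = 0" using fin u unfolding D_def by (simp add: sum_nonneg_eq_0_iff)
  then show ?thesis by (simp add: d_def)
qed

lemma vertex_list:
  assumes "hypergraph G"
  shows "distinct (vertex_list G)" "set (vertex_list G) = verts G"
    "length (vertex_list G) = card (verts G)"
proof -
  have "\<exists>vs. distinct vs \<and> set vs = verts G"
    using assms finite_distinct_list[of "verts G"] unfolding hypergraph_def by blast
  from someI_ex[OF this]
  show 1: "distinct (vertex_list G)" and 2: "set (vertex_list G) = verts G"
    unfolding vertex_list_def by auto
  show "length (vertex_list G) = card (verts G)" using distinct_card[OF 1] 2 by simp
qed

lemma sum_vertex_list:
  assumes "hypergraph G"
  shows "(\<Sum>i<card (verts G). f (vertex_list G ! i)) = (\<Sum>v\<in>verts G. f v)"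
proof -
  have "bij_betw (\<lambda>i. vertex_list G ! i) {..<card (verts G)} (verts G)"
    using bij_betw_nth[OF vertex_list(1)[OF assms] refl refl] vertex_list[OF assms] by metis
  then show ?thesis by (rule sum.reindex_bij_betw)
qed

lemma adj_entry_nonneg:
  assumes "hypergraph G"
  shows "0 \<le> adj_entry G u v"
proof -
  have "0 \<le> 1 / (real (card e) - 1)" if "e \<in> edges G" for e
    using assms that unfolding hypergraph_def by fastforce
  then show ?thesis unfolding adj_entry_def by (auto intro!: sum_nonneg)
qed

lemma adj_entry_sym: "adj_entry G u v = adj_entry G v u"
  unfolding adj_entry_def by (simp add: conj_commute)

text \<open>This removes the enumeration of the vertices: from here on vectors are functions on the vertex set.\<close>

lemma eigenvalue_adjacency_matrix_iff:
  assumes G: "hypergraph G"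
  shows "eigenvalue (map_mat complex_of_real (adjacency_matrix G)) c \<longleftrightarrow>
    (\<exists>y. (\<exists>v\<in>verts G. y v \<noteq> 0) \<and>
      (\<forall>u\<in>verts G. (\<Sum>v\<in>verts G. of_real (adj_entry G u v) * y v) = c * y u))"
    (is "?L \<longleftrightarrow> ?R")
proof -
  let ?M = "map_mat complex_of_real (adjacency_matrix G)"
  let ?n = "card (verts G)"
  let ?l = "\<lambda>i. vertex_list G ! i"
  have dim: "dim_row ?M = ?n" "dim_col ?M = ?n" by (simp_all add: adjacency_matrix_def)
  have mv: "vec_index (mult_mat_vec ?M v) i = (\<Sum>j<?n. of_real (adj_entry G (?l i) (?l j)) * vec_index v j)"
    if "i < ?n" "v \<in> carrier_vec ?n" for i v
    using that
    by (auto simp: adjacency_matrix_def scalar_prod_def lessThan_atLeast0 intro!: sum.cong)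
  have lV: "?l i \<in> verts G" if "i < ?n" for i
    using that vertex_list[OF G] nth_mem by metis
  have idx: "\<exists>i<?n. ?l i = u" if "u \<in> verts G" for u
    using that vertex_list[OF G] by (metis in_set_conv_nth)
  show ?thesis
  proof
    assume ?L
    then obtain v where v: "v \<in> carrier_vec ?n" "v \<noteq> 0\<^sub>v ?n" "mult_mat_vec ?M v = c \<cdot>\<^sub>v v"
      unfolding eigenvalue_def eigenvector_def dim by blast
    define y where "y u = vec_index v (THE i. i < ?n \<and> ?l i = u)" for u
    have y: "y (?l i) = vec_index v i" if "i < ?n" for i
    proof -
      have "(THE j. j < ?n \<and> ?l j = ?l i) = i"
        using that vertex_list[OF G] by (intro the_equality) (auto simp: nth_eq_iff_index_eq)
      then show ?thesis by (simp add: y_def)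
    qed
    obtain i where i: "i < ?n" "vec_index v i \<noteq> 0"
      using v(1,2) by (auto simp: vec_eq_iff)
    have "\<exists>w\<in>verts G. y w \<noteq> 0" using i y lV by metis
    moreover have "(\<Sum>w\<in>verts G. of_real (adj_entry G u w) * y w) = c * y u" if u: "u \<in> verts G" for u
    proof -
      obtain i where i: "i < ?n" "?l i = u" using idx[OF u] by blast
      have "(\<Sum>w\<in>verts G. of_real (adj_entry G u w) * y w)
          = (\<Sum>j<?n. of_real (adj_entry G u (?l j)) * y (?l j))"
        by (rule sum_vertex_list[OF G, symmetric])
      also have "\<dots> = vec_index (mult_mat_vec ?M v) i"
        using i v(1) by (simp add: mv y)
      also have "\<dots> = c * y u" using v i y by auto
      finally show ?thesis .
    qed
    ultimately show ?R by blast
  next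
    assume ?R
    then obtain y where nz: "\<exists>v\<in>verts G. y v \<noteq> 0"
      and ev: "\<And>u. u \<in> verts G \<Longrightarrow> (\<Sum>v\<in>verts G. of_real (adj_entry G u v) * y v) = c * y u" by blast
    define v where "v = vec ?n (\<lambda>i. y (?l i))"
    have vc: "v \<in> carrier_vec ?n" by (simp add: v_def)
    obtain i where i: "i < ?n" "y (?l i) \<noteq> 0" using nz idx by metis
    have "v \<noteq> 0\<^sub>v ?n"
    proof
      assume "v = 0\<^sub>v ?n"
      then have "vec_index v i = 0" using i by simp
      then show False using i by (simp add: v_def)
    qed
    moreover have "mult_mat_vec ?M v = c \<cdot>\<^sub>v v"
    proof (rule eq_vecI)
      show "dim_vec (mult_mat_vec ?M v) = dim_vec (c \<cdot>\<^sub>v v)" using vc dim by simp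
      fix j assume "j < dim_vec (c \<cdot>\<^sub>v v)"
      then have j: "j < ?n" by (simp add: v_def)
      have "vec_index (mult_mat_vec ?M v) j = (\<Sum>i<?n. of_real (adj_entry G (?l j) (?l i)) * y (?l i))"
        using j by (subst mv[OF j vc]) (auto simp: v_def)
      also have "\<dots> = c * y (?l j)"
        using sum_vertex_list[OF G, of "\<lambda>w. of_real (adj_entry G (?l j) w) * y w"] ev[OF lV[OF j]] by simp
      finally show "vec_index (mult_mat_vec ?M v) j = vec_index (c \<cdot>\<^sub>v v) j" using j by (simp add: v_def)
    qed
    ultimately show ?L unfolding eigenvalue_def eigenvector_def dim using vc by blast
  qed
qed

text \<open>The maximum \<open>\<mu>\<close> of the Rayleigh quotient is an eigenvalue, so \<open>\<mu> \<le> \<rho>\<close>. Conversely, if \<open>c\<close> is an eigenvalue of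
modulus \<open>\<rho>\<close> with complex eigenvector \<open>y\<close>, then the triangle inequality bounds \<open>\<rho> |y|\<close> entrywise by the
adjacency matrix applied to \<open>|y|\<close>, and pairing with \<open>|y|\<close> gives \<open>\<rho> \<le> \<mu>\<close>.\<close>

lemma rho_eq_max_rayleigh:
  assumes G: "hypergraph G"
  obtains x where "\<And>v. 0 \<le> x v" "(\<Sum>v\<in>verts G. (x v)\<^sup>2) = 1"
    "\<And>u. u \<in> verts G \<Longrightarrow> (\<Sum>v\<in>verts G. adj_entry G u v * x v) = rho G * x u"
    "\<And>y. qform (verts G) (adj_entry G) y \<le> rho G * (\<Sum>v\<in>verts G. (y v)\<^sup>2)"
proof -
  let ?V = "verts G" and ?a = "adj_entry G"
  let ?M = "map_mat complex_of_real (adjacency_matrix G)"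
  have fin: "finite ?V" and ne: "?V \<noteq> {}" using G by (auto simp: hypergraph_def)
  obtain x \<mu> where x0: "\<And>v. 0 \<le> x v" and x1: "(\<Sum>v\<in>?V. (x v)\<^sup>2) = 1"
    and eq: "qform ?V ?a x = \<mu>"
    and max: "\<And>y. qform ?V ?a y \<le> \<mu> * (\<Sum>v\<in>?V. (y v)\<^sup>2)"
    by (rule qform_maximizer_exists[where a = ?a, OF fin ne adj_entry_nonneg[OF G]]) (rule that)
  have ev: "(\<Sum>v\<in>?V. ?a u v * x v) = \<mu> * x u" if "u \<in> ?V" for u
    using qform_maximizer_is_eigenvector[OF fin adj_entry_sym max _ that] eq x1 by simp
  have carr: "?M \<in> carrier_mat (card ?V) (card ?V)" by (auto simp: adjacency_matrix_def)
  have npos: "card ?V > 0" using fin ne by (simp add: card_gt_0_iff)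
  have "\<exists>v\<in>?V. x v \<noteq> 0"
  proof (rule ccontr)
    assume "\<not> ?thesis"
    then have "(\<Sum>v\<in>?V. (x v)\<^sup>2) = 0" by simp
    with x1 show False by simp
  qed
  moreover have "(\<Sum>v\<in>?V. of_real (?a u v) * complex_of_real (x v)) = of_real \<mu> * of_real (x u)"
    if "u \<in> ?V" for u
    unfolding of_real_mult[symmetric] of_real_sum[symmetric] ev[OF that] ..
  ultimately have "eigenvalue ?M (of_real \<mu>)"
    unfolding eigenvalue_adjacency_matrix_iff[OF G]
    by (intro exI[of _ "\<lambda>v. of_real (x v)"]) simp
  then have "norm (complex_of_real \<mu>) \<in> norm ` spectrum ?M"
    unfolding spectrum_def by blast
  then have "norm (complex_of_real \<mu>) \<le> rho G"
    unfolding rho_def by (rule spectral_radius_mem_max(2)[OF carr npos])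
  then have "\<bar>\<mu>\<bar> \<le> rho G" by simp
  moreover have "rho G \<le> \<mu>"
  proof -
    obtain c where c: "eigenvalue ?M c" "rho G = norm c"
      using spectral_radius_mem_max(1)[OF carr npos] by (auto simp: rho_def spectrum_def)
    obtain y where nz: "\<exists>v\<in>?V. y v \<noteq> 0"
      and y: "\<And>u. u \<in> ?V \<Longrightarrow> (\<Sum>v\<in>?V. of_real (?a u v) * y v) = c * y u"
      using c(1) unfolding eigenvalue_adjacency_matrix_iff[OF G] by blast
    define z where "z v = norm (y v)" for v
    have "norm c * z u \<le> (\<Sum>v\<in>?V. ?a u v * z v)" if u: "u \<in> ?V" for u
    proof -
      have "norm c * z u = norm (\<Sum>v\<in>?V. of_real (?a u v) * y v)"
        unfolding y[OF u] norm_mult z_def ..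
      also have "\<dots> \<le> (\<Sum>v\<in>?V. norm (of_real (?a u v) * y v))" by (rule norm_sum)
      also have "\<dots> = (\<Sum>v\<in>?V. ?a u v * z v)"
        by (simp add: norm_mult adj_entry_nonneg[OF G] z_def)
      finally show ?thesis .
    qed
    then have "(\<Sum>u\<in>?V. z u * (norm c * z u)) \<le> (\<Sum>u\<in>?V. z u * (\<Sum>v\<in>?V. ?a u v * z v))"
      by (intro sum_mono mult_left_mono) (simp_all add: z_def)
    moreover have "(\<Sum>u\<in>?V. z u * (norm c * z u)) = norm c * (\<Sum>v\<in>?V. (z v)\<^sup>2)"
      unfolding sum_distrib_left by (intro sum.cong refl) (simp add: power2_eq_square)
    moreover have "(\<Sum>u\<in>?V. z u * (\<Sum>v\<in>?V. ?a u v * z v)) = qform ?V ?a z"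
      unfolding qform_def sum_distrib_left by (intro sum.cong refl) simp
    moreover have "qform ?V ?a z \<le> \<mu> * (\<Sum>v\<in>?V. (z v)\<^sup>2)" by (rule max)
    ultimately have "norm c * (\<Sum>v\<in>?V. (z v)\<^sup>2) \<le> \<mu> * (\<Sum>v\<in>?V. (z v)\<^sup>2)" by linarith
    moreover have "(\<Sum>v\<in>?V. (z v)\<^sup>2) > 0"
    proof -
      obtain w where w: "w \<in> ?V" "y w \<noteq> 0" using nz by blast
      show ?thesis by (rule sum_pos2[OF fin w(1)]) (use w in \<open>simp_all add: z_def\<close>)
    qed
    ultimately show ?thesis using c(2) by simp
  qed
  ultimately have \<mu>: "\<mu> = rho G" by linarith
  show thesis
  proof (rule that[of x])
    show "0 \<le> x v" for v by (rule x0)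
    show "(\<Sum>v\<in>?V. (x v)\<^sup>2) = 1" by (rule x1)
    show "(\<Sum>v\<in>?V. ?a u v * x v) = rho G * x u" if "u \<in> ?V" for u
      using ev[OF that] unfolding \<mu> .
    show "qform ?V ?a y \<le> rho G * (\<Sum>v\<in>?V. (y v)\<^sup>2)" for y
      using max[of y] unfolding \<mu> .
  qed
qed

section \<open>Edge sums in uniform hypergraphs\<close>

definition star :: "'a hypergraph \<Rightarrow> 'a \<Rightarrow> 'a set set" where
  "star G v = {e \<in> edges G. v \<in> e}"

definition deg :: "'a hypergraph \<Rightarrow> 'a \<Rightarrow> nat" where
  "deg G v = card (star G v)"

definition k_hypergraph :: "nat \<Rightarrow> 'a hypergraph \<Rightarrow> bool" where
  "k_hypergraph k G \<longleftrightarrow> 3 \<le> k \<and> hypergraph G \<and> uniform k G"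

text \<open>The factor \<open>k - 1\<close> clears the denominators of the adjacency matrix of a \<open>k\<close>-uniform hypergraph.\<close>

definition scaled_rho :: "nat \<Rightarrow> 'a hypergraph \<Rightarrow> real" where
  "scaled_rho k G = (real k - 1) * rho G"

lemma k_hypergraphD:
  assumes "k_hypergraph k G"
  shows "3 \<le> k" "hypergraph G" "finite (verts G)" "verts G \<noteq> {}" "finite (edges G)"
    "\<And>e. e \<in> edges G \<Longrightarrow> e \<subseteq> verts G" "\<And>e. e \<in> edges G \<Longrightarrow> card e = k"
    "\<And>e. e \<in> edges G \<Longrightarrow> finite e" "\<And>v. finite (star G v)"
proof -
  show "3 \<le> k" "hypergraph G" "finite (verts G)" "verts G \<noteq> {}"
    "\<And>e. e \<in> edges G \<Longrightarrow> card e = k"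
    using assms by (auto simp: k_hypergraph_def hypergraph_def uniform_def)
  have sub: "e \<subseteq> verts G" if "e \<in> edges G" for e
    using assms that by (auto simp: k_hypergraph_def hypergraph_def)
  then show "\<And>e. e \<in> edges G \<Longrightarrow> e \<subseteq> verts G" .
  have fin: "finite (verts G)" using assms by (auto simp: k_hypergraph_def hypergraph_def)
  show "finite (edges G)"
    by (rule finite_subset[of _ "Pow (verts G)"]) (use sub fin in auto)
  then show "finite (star G v)" for v by (simp add: star_def)
  show "finite e" if "e \<in> edges G" for e
    using finite_subset[OF sub[OF that] fin] .
qed

lemma sum_star_swap:
  assumes "k_hypergraph k G"
  shows "(\<Sum>v\<in>verts G. \<Sum>e\<in>star G v. f v e) = (\<Sum>e\<in>edges G. \<Sum>v\<in>e. f v e)"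
proof -
  note D = k_hypergraphD[OF assms]
  have "(\<Sum>v\<in>verts G. \<Sum>e\<in>star G v. f v e) = (\<Sum>e\<in>edges G. \<Sum>v\<in>{v\<in>verts G. v \<in> e}. f v e)"
    unfolding star_def by (rule sum.swap_restrict[OF D(3,5)])
  also have "\<dots> = (\<Sum>e\<in>edges G. \<Sum>v\<in>e. f v e)"
    by (intro sum.cong refl) (use D(6) in auto)
  finally show ?thesis .
qed

lemma sum_deg:
  assumes "k_hypergraph k G"
  shows "(\<Sum>v\<in>verts G. deg G v) = k * card (edges G)"
  using sum_star_swap[OF assms, of "\<lambda>_ _. 1 :: nat"] k_hypergraphD(7)[OF assms]
  by (simp add: deg_def mult.commute)

text \<open>Every edge at \<open>u\<close> contributes its sum except for the entry at \<open>u\<close> itself.\<close>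

lemma adjacency_as_edge_sums:
  fixes x :: "'a \<Rightarrow> real"
  assumes "k_hypergraph k G" and u: "u \<in> verts G"
  shows "(real k - 1) * (\<Sum>v\<in>verts G. adj_entry G u v * x v)
    = (\<Sum>e\<in>star G u. sum x e) - deg G u * x u"
proof -
  note D = k_hypergraphD[OF assms(1)]
  have entry: "(real k - 1) * adj_entry G u v = (if v = u then 0 else card {e \<in> star G u. v \<in> e})" for v
  proof -
    have "(\<Sum>e\<in>{e \<in> edges G. u \<in> e \<and> v \<in> e}. 1 / (real (card e) - 1))
        = (\<Sum>e\<in>{e \<in> star G u. v \<in> e}. 1 / (real k - 1))"
      using D(7) by (intro sum.cong) (auto simp: star_def)
    then show ?thesis using D(1) by (simp add: adj_entry_def)
  qed
  have "(real k - 1) * (\<Sum>v\<in>verts G. adj_entry G u v * x v)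
      = (\<Sum>v\<in>verts G. (if v = u then 0 else real (card {e \<in> star G u. v \<in> e})) * x v)"
    unfolding sum_distrib_left mult.assoc[symmetric] entry by (intro sum.cong refl) simp
  also have "\<dots> = (\<Sum>v\<in>verts G - {u}. real (card {e \<in> star G u. v \<in> e}) * x v)"
    using D(3) u by (simp add: sum.remove[of _ u])
  also have "\<dots> = (\<Sum>v\<in>verts G. real (card {e \<in> star G u. v \<in> e}) * x v) - deg G u * x u"
  proof -
    have "{e \<in> star G u. u \<in> e} = star G u" by (auto simp: star_def)
    then show ?thesis using D(3) u by (simp add: sum.remove[of _ u] deg_def)
  qed
  also have "(\<Sum>v\<in>verts G. real (card {e \<in> star G u. v \<in> e}) * x v)
      = (\<Sum>v\<in>verts G. \<Sum>e\<in>{e \<in> star G u. v \<in> e}. x v)" by simp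
  also have "\<dots> = (\<Sum>e\<in>star G u. \<Sum>v\<in>{v\<in>verts G. v \<in> e}. x v)"
    by (rule sum.swap_restrict[OF D(3,9)])
  also have "\<dots> = (\<Sum>e\<in>star G u. sum x e)"
    by (intro sum.cong refl) (use D(6) in \<open>auto simp: star_def\<close>)
  finally show ?thesis .
qed

lemma qform_as_edge_sums:
  fixes x :: "'a \<Rightarrow> real"
  assumes "k_hypergraph k G"
  shows "(real k - 1) * qform (verts G) (adj_entry G) x
    = (\<Sum>e\<in>edges G. (sum x e)\<^sup>2) - (\<Sum>v\<in>verts G. deg G v * (x v)\<^sup>2)"
proof -
  have "qform (verts G) (adj_entry G) x = (\<Sum>u\<in>verts G. x u * (\<Sum>v\<in>verts G. adj_entry G u v * x v))"
    unfolding qform_def sum_distrib_left by (intro sum.cong refl) simp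
  then have "(real k - 1) * qform (verts G) (adj_entry G) x
      = (\<Sum>u\<in>verts G. x u * ((real k - 1) * (\<Sum>v\<in>verts G. adj_entry G u v * x v)))"
    by (simp only: sum_distrib_left[of "real k - 1"] mult.left_commute)
  also have "\<dots> = (\<Sum>u\<in>verts G. x u * ((\<Sum>e\<in>star G u. sum x e) - deg G u * x u))"
    by (intro sum.cong refl) (simp only: adjacency_as_edge_sums[OF assms])
  also have "\<dots> = (\<Sum>u\<in>verts G. \<Sum>e\<in>star G u. x u * sum x e) - (\<Sum>v\<in>verts G. deg G v * (x v)\<^sup>2)"
    by (simp add: right_diff_distrib sum_subtractf sum_distrib_left power2_eq_square mult_ac)
  also have "(\<Sum>u\<in>verts G. \<Sum>e\<in>star G u. x u * sum x e) = (\<Sum>e\<in>edges G. \<Sum>v\<in>e. x v * sum x e)"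
    by (rule sum_star_swap[OF assms])
  also have "\<dots> = (\<Sum>e\<in>edges G. (sum x e)\<^sup>2)"
    by (simp add: power2_eq_square sum_distrib_right)
  finally show ?thesis .
qed

text \<open>Multiplied by \<open>k - 1\<close>, the eigenvalue equation takes this form, with \<open>\<mu>\<close> being \<open>k - 1\<close> times the eigenvalue.
The vector may be zero.\<close>

definition eigenvector_for :: "'a hypergraph \<Rightarrow> real \<Rightarrow> ('a \<Rightarrow> real) \<Rightarrow> bool" where
  "eigenvector_for G \<mu> x \<longleftrightarrow>
     (\<forall>v\<in>verts G. (\<Sum>e\<in>star G v. sum x e) = (\<mu> + deg G v) * x v)"

lemma perron_vector_exists:
  assumes "k_hypergraph k G"
  obtains x where "\<And>v. 0 \<le> x v" "\<exists>v\<in>verts G. x v \<noteq> 0" "eigenvector_for G (scaled_rho k G) x"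
    "\<And>y. (\<Sum>e\<in>edges G. (sum y e)\<^sup>2) \<le> (\<Sum>v\<in>verts G. (scaled_rho k G + deg G v) * (y v)\<^sup>2)"
proof -
  note D = k_hypergraphD[OF assms]
  obtain x where x0: "\<And>v. 0 \<le> x v" and x1: "(\<Sum>v\<in>verts G. (x v)\<^sup>2) = 1"
    and ev: "\<And>u. u \<in> verts G \<Longrightarrow> (\<Sum>v\<in>verts G. adj_entry G u v * x v) = rho G * x u"
    and max: "\<And>y. qform (verts G) (adj_entry G) y \<le> rho G * (\<Sum>v\<in>verts G. (y v)\<^sup>2)"
    by (rule rho_eq_max_rayleigh[OF D(2)]) (rule that)
  show thesis
  proof (rule that[of x])
    show "0 \<le> x v" for v by (rule x0)
    show "\<exists>v\<in>verts G. x v \<noteq> 0"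
    proof (rule ccontr)
      assume "\<not> ?thesis"
      then have "(\<Sum>v\<in>verts G. (x v)\<^sup>2) = 0" by simp
      with x1 show False by simp
    qed
    show "eigenvector_for G (scaled_rho k G) x"
      unfolding eigenvector_for_def
    proof
      fix u assume u: "u \<in> verts G"
      show "(\<Sum>e\<in>star G u. sum x e) = (scaled_rho k G + deg G u) * x u"
        using adjacency_as_edge_sums[OF assms u, of x] unfolding ev[OF u]
        by (simp add: scaled_rho_def algebra_simps)
    qed
    fix y
    have "(real k - 1) * qform (verts G) (adj_entry G) y \<le> (real k - 1) * (rho G * (\<Sum>v\<in>verts G. (y v)\<^sup>2))"
      using D(1) by (intro mult_left_mono max) simp
    then show "(\<Sum>e\<in>edges G. (sum y e)\<^sup>2) \<le> (\<Sum>v\<in>verts G. (scaled_rho k G + deg G v) * (y v)\<^sup>2)"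
      unfolding qform_as_edge_sums[OF assms]
      by (simp add: scaled_rho_def distrib_right sum.distrib sum_distrib_left[symmetric] mult.assoc)
  qed
qed

lemma perron_vector:
  assumes "k_hypergraph k G"
  shows "\<exists>x. (\<forall>v. 0 \<le> x v) \<and> (\<exists>v\<in>verts G. x v \<noteq> 0) \<and> eigenvector_for G (scaled_rho k G) x"
  by (rule perron_vector_exists[OF assms]) blast

lemma rayleigh_bound:
  fixes y :: "'a \<Rightarrow> real"
  assumes "k_hypergraph k G"
  shows "(\<Sum>e\<in>edges G. (sum y e)\<^sup>2) \<le> (\<Sum>v\<in>verts G. (scaled_rho k G + deg G v) * (y v)\<^sup>2)"
  by (rule perron_vector_exists[OF assms])

lemma rayleigh_equality:
  fixes x :: "'a \<Rightarrow> real"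
  assumes G: "k_hypergraph k G"
    and eq: "(\<Sum>e\<in>edges G. (sum x e)\<^sup>2) = (\<Sum>v\<in>verts G. (scaled_rho k G + deg G v) * (x v)\<^sup>2)"
  shows "eigenvector_for G (scaled_rho k G) x"
  unfolding eigenvector_for_def
proof
  fix u assume u: "u \<in> verts G"
  note D = k_hypergraphD[OF G]
  have k: "real k - 1 > 0" using D(1) by simp
  have q: "(real k - 1) * qform (verts G) (adj_entry G) y
      = (\<Sum>e\<in>edges G. (sum y e)\<^sup>2) - (\<Sum>v\<in>verts G. (scaled_rho k G + deg G v) * (y v)\<^sup>2)
        + (real k - 1) * (rho G * (\<Sum>v\<in>verts G. (y v)\<^sup>2))" for y
    unfolding qform_as_edge_sums[OF G]
    by (simp add: scaled_rho_def distrib_right sum.distrib sum_distrib_left[symmetric] mult.assoc)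
  have le: "qform (verts G) (adj_entry G) y \<le> rho G * (\<Sum>v\<in>verts G. (y v)\<^sup>2)" for y
  proof -
    have "(real k - 1) * qform (verts G) (adj_entry G) y
        \<le> (real k - 1) * (rho G * (\<Sum>v\<in>verts G. (y v)\<^sup>2))"
      using q[of y] rayleigh_bound[OF G, of y] by linarith
    then show ?thesis unfolding mult_le_cancel_left_pos[OF k] .
  qed
  have "qform (verts G) (adj_entry G) x = rho G * (\<Sum>v\<in>verts G. (x v)\<^sup>2)"
    using q[of x] eq k by simp
  then have "(\<Sum>v\<in>verts G. adj_entry G u v * x v) = rho G * x u"
    by (rule qform_maximizer_is_eigenvector[where a = "adj_entry G", OF D(3) adj_entry_sym le _ u])
  then show "(\<Sum>e\<in>star G u. sum x e) = (scaled_rho k G + deg G u) * x u"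
    using adjacency_as_edge_sums[OF G u, of x] by (simp add: scaled_rho_def algebra_simps)
qed

text \<open>The right hand side is symmetric in \<open>x\<close> and \<open>y\<close>: this is the symmetry of the adjacency matrix.\<close>

lemma edge_sum_bilinear:
  fixes x y :: "'a \<Rightarrow> real"
  assumes "k_hypergraph k G"
  shows "(\<Sum>v\<in>verts G. x v * (\<Sum>e\<in>star G v. sum y e)) = (\<Sum>e\<in>edges G. sum x e * sum y e)"
proof -
  have "(\<Sum>v\<in>verts G. x v * (\<Sum>e\<in>star G v. sum y e)) = (\<Sum>v\<in>verts G. \<Sum>e\<in>star G v. x v * sum y e)"
    by (simp add: sum_distrib_left)
  also have "\<dots> = (\<Sum>e\<in>edges G. \<Sum>v\<in>e. x v * sum y e)" by (rule sum_star_swap[OF assms])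
  finally show ?thesis by (simp add: sum_distrib_right)
qed

text \<open>Pairing the subsolution inequality with the nonnegative vector \<open>x\<close> shows that the Rayleigh quotient of \<open>x\<close> is
at least \<open>\<mu>\<close>.\<close>

lemma scaled_rho_ge_subsolution:
  fixes x :: "'a \<Rightarrow> real" and \<mu> :: real
  assumes G: "k_hypergraph k G" and nonneg: "\<And>v. v \<in> verts G \<Longrightarrow> 0 \<le> x v"
    and nz: "\<exists>v\<in>verts G. x v \<noteq> 0"
    and sub: "\<And>v. v \<in> verts G \<Longrightarrow> (\<mu> + deg G v) * x v \<le> (\<Sum>e\<in>star G v. sum x e)"
  shows "\<mu> \<le> scaled_rho k G" "\<mu> = scaled_rho k G \<Longrightarrow> eigenvector_for G \<mu> x"
proof -
  note D = k_hypergraphD[OF G]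
  obtain w where w: "w \<in> verts G" "x w \<noteq> 0" using nz by blast
  have pos: "(\<Sum>v\<in>verts G. (x v)\<^sup>2) > 0" by (rule sum_pos2[OF D(3) w(1)]) (use w in simp_all)
  have "(\<Sum>v\<in>verts G. (\<mu> + deg G v) * (x v)\<^sup>2) \<le> (\<Sum>v\<in>verts G. x v * (\<Sum>e\<in>star G v. sum x e))"
  proof (rule sum_mono)
    fix v assume "v \<in> verts G"
    from mult_left_mono[OF sub[OF this] nonneg[OF this]]
    show "(\<mu> + deg G v) * (x v)\<^sup>2 \<le> x v * (\<Sum>e\<in>star G v. sum x e)"
      by (simp add: power2_eq_square mult_ac)
  qed
  also have "\<dots> = (\<Sum>e\<in>edges G. (sum x e)\<^sup>2)"
    unfolding edge_sum_bilinear[OF G] by (simp add: power2_eq_square)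
  finally have le: "(\<Sum>v\<in>verts G. (\<mu> + deg G v) * (x v)\<^sup>2) \<le> (\<Sum>e\<in>edges G. (sum x e)\<^sup>2)" .
  also have "\<dots> \<le> (\<Sum>v\<in>verts G. (scaled_rho k G + deg G v) * (x v)\<^sup>2)" by (rule rayleigh_bound[OF G])
  finally have "\<mu> * (\<Sum>v\<in>verts G. (x v)\<^sup>2) \<le> scaled_rho k G * (\<Sum>v\<in>verts G. (x v)\<^sup>2)"
    by (simp add: distrib_right sum.distrib sum_distrib_left)
  then show "\<mu> \<le> scaled_rho k G" using pos by simp
  show "eigenvector_for G \<mu> x" if "\<mu> = scaled_rho k G"
    using rayleigh_equality[OF G, of x] le rayleigh_bound[OF G, of x] that by simp
qed

text \<open>A positive eigenvector and the nonnegative Perron vector are not orthogonal, but eigenvectors of a symmetric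
matrix for different eigenvalues are.\<close>

lemma scaled_rho_eq_positive_eigenvector:
  fixes x :: "'a \<Rightarrow> real" and \<mu> :: real
  assumes G: "k_hypergraph k G" and pos: "\<And>v. v \<in> verts G \<Longrightarrow> 0 < x v"
    and ev: "eigenvector_for G \<mu> x"
  shows "scaled_rho k G = \<mu>"
proof -
  note D = k_hypergraphD[OF G]
  obtain y where y0: "\<And>v. 0 \<le> y v" and nz: "\<exists>v\<in>verts G. y v \<noteq> 0"
    and evy: "eigenvector_for G (scaled_rho k G) y"
    using perron_vector[OF G] by blast
  have 1: "(\<Sum>v\<in>verts G. y v * (\<Sum>e\<in>star G v. sum x e)) = (\<Sum>v\<in>verts G. x v * (\<Sum>e\<in>star G v. sum y e))"
    unfolding edge_sum_bilinear[OF G] by (simp add: mult.commute)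
  have 2: "(\<Sum>v\<in>verts G. y v * (\<Sum>e\<in>star G v. sum x e)) = (\<Sum>v\<in>verts G. (\<mu> + deg G v) * (x v * y v))"
    using ev unfolding eigenvector_for_def by (intro sum.cong refl) simp
  have 3: "(\<Sum>v\<in>verts G. x v * (\<Sum>e\<in>star G v. sum y e)) = (\<Sum>v\<in>verts G. (scaled_rho k G + deg G v) * (x v * y v))"
    using evy unfolding eigenvector_for_def by (intro sum.cong refl) simp
  have "\<mu> * (\<Sum>v\<in>verts G. x v * y v) = scaled_rho k G * (\<Sum>v\<in>verts G. x v * y v)"
    using 1 2 3 by (simp add: distrib_right sum.distrib sum_distrib_left)
  moreover have "(\<Sum>v\<in>verts G. x v * y v) > 0"
  proof -
    obtain w where w: "w \<in> verts G" "y w \<noteq> 0" using nz by blast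
    then have "y w > 0" using y0[of w] by simp
    then show ?thesis
      by (intro sum_pos2[OF D(3) w(1)]) (use w pos y0 in \<open>auto intro!: mult_nonneg_nonneg simp: less_imp_le\<close>)
  qed
  ultimately show ?thesis by simp
qed

section \<open>Connectedness and isomorphism\<close>

text \<open>Connectedness by cuts: no proper nonempty set of vertices is closed under edges. In this form it passes easily to hypergraphs with an edge added, removed or contracted, where paths would have to be rerouted.\<close>

definition cut_connected :: "'a hypergraph \<Rightarrow> bool" where
  "cut_connected G \<longleftrightarrow>
     (\<forall>U\<subseteq>verts G. U \<noteq> {} \<longrightarrow> (\<forall>e\<in>edges G. e \<inter> U \<noteq> {} \<longrightarrow> e \<subseteq> U) \<longrightarrow> U = verts G)"

lemma cut_connectedD:
  assumes "cut_connected G" "U \<subseteq> verts G" "U \<noteq> {}"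
    and "\<And>e. e \<in> edges G \<Longrightarrow> e \<inter> U \<noteq> {} \<Longrightarrow> e \<subseteq> U"
  shows "U = verts G"
  using assms unfolding cut_connected_def by blast

text \<open>A path that starts inside a set closed under edges never leaves it.\<close>

lemma connected_imp_cut_connected:
  assumes "connected_hypergraph G"
  shows "cut_connected G"
  unfolding cut_connected_def
proof (intro allI impI)
  fix U assume U: "U \<subseteq> verts G" "U \<noteq> {}" "\<forall>e\<in>edges G. e \<inter> U \<noteq> {} \<longrightarrow> e \<subseteq> U"
  show "U = verts G"
  proof (intro equalityI subsetI U(1)[THEN subsetD])
    fix v assume v: "v \<in> verts G"
    obtain u where u: "u \<in> U" using U(2) by blast
    then obtain vs es where p: "berge_path G vs es" "hd vs = u" "last vs = v"
      using assms v U(1) unfolding connected_hypergraph_def by blast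
    have "vs ! i \<in> U" if "i \<le> length es" for i
      using that
    proof (induction i)
      case 0
      then show ?case using p u by (cases vs) (auto simp: berge_path_def)
    next
      case (Suc i)
      then have i: "i < length es" and "vs ! i \<in> U" by simp_all
      moreover have "vs ! i \<in> es ! i" "vs ! Suc i \<in> es ! i" "es ! i \<in> edges G"
        using p(1) i nth_mem[OF i] unfolding berge_path_def by auto
      ultimately show ?case using U(3) by blast
    qed
    from this[of "length es"] show "v \<in> U"
      using p unfolding berge_path_def by (cases "vs = []") (auto simp: last_conv_nth)
  qed
qed

text \<open>If \<open>x\<close> vanishes at \<open>w\<close>, then the eigenvalue equation at \<open>w\<close> makes \<open>x\<close> vanish on all edges through \<open>w\<close>, so
the support of \<open>x\<close> is closed under edges.\<close>

lemma nonneg_eigenvector_positive: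
  fixes x :: "'a \<Rightarrow> real" and \<mu> :: real
  assumes G: "k_hypergraph k G" and con: "cut_connected G"
    and nonneg: "\<And>v. 0 \<le> x v" and nz: "\<exists>v\<in>verts G. x v \<noteq> 0"
    and ev: "eigenvector_for G \<mu> x" and v: "v \<in> verts G"
  shows "0 < x v"
proof -
  note D = k_hypergraphD[OF G]
  let ?U = "{v \<in> verts G. 0 < x v}"
  have "?U = verts G"
  proof (rule cut_connectedD[OF con])
    show "?U \<noteq> {}" using nz nonneg by (auto simp: order_less_le)
    fix e assume e: "e \<in> edges G" "e \<inter> ?U \<noteq> {}"
    then obtain u where u: "u \<in> e" "0 < x u" by blast
    have "sum x e > 0" by (rule sum_pos2[where f = x, OF D(8)[OF e(1)] u(1,2)]) (rule nonneg)
    show "e \<subseteq> ?U"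
    proof
      fix w assume w: "w \<in> e"
      then have wV: "w \<in> verts G" using D(6) e by blast
      have "sum x e \<le> (\<Sum>f\<in>star G w. sum x f)"
        by (rule member_le_sum[OF _ _ D(9)]) (use e w nonneg in \<open>auto simp: star_def intro: sum_nonneg\<close>)
      with \<open>sum x e > 0\<close> have "(\<mu> + deg G w) * x w \<noteq> 0"
        using ev wV unfolding eigenvector_for_def by auto
      then show "w \<in> ?U" using wV nonneg[of w] by (auto simp: order_less_le)
    qed
  qed simp
  then show ?thesis using v by blast
qed

definition iso_via :: "('a \<Rightarrow> 'b) \<Rightarrow> 'a hypergraph \<Rightarrow> 'b hypergraph \<Rightarrow> bool" where
  "iso_via f G H \<longleftrightarrow> bij_betw f (verts G) (verts H) \<and> bij_betw ((`) f) (edges G) (edges H)"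

lemma iso_via_sym:
  assumes "hypergraph G" "iso_via f G H"
  shows "iso_via (inv_into (verts G) f) H G"
proof -
  let ?g = "inv_into (verts G) f"
  have b: "bij_betw f (verts G) (verts H)" and e: "bij_betw ((`) f) (edges G) (edges H)"
    using assms(2) by (auto simp: iso_via_def)
  have inv: "?g ` (f ` c) = c" if "c \<in> edges G" for c
    using that assms(1) bij_betw_imp_inj_on[OF b]
    by (intro inv_into_image_cancel) (auto simp: hypergraph_def)
  have "bij_betw ((`) ?g) (edges H) (edges G)"
  proof (rule bij_betw_byWitness[where f' = "(`) f"])
    have H: "edges H = (`) f ` edges G" using e by (simp add: bij_betw_def)
    show "\<forall>c\<in>edges H. f ` ?g ` c = c" unfolding H using inv by simp
    show "\<forall>c\<in>edges G. ?g ` f ` c = c" using inv by blast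
    show "(`) ?g ` edges H \<subseteq> edges G" unfolding H using inv by auto
    show "(`) f ` edges G \<subseteq> edges H" unfolding H ..
  qed
  then show ?thesis using b by (simp add: iso_via_def bij_betw_inv_into)
qed

lemma hypergraph_iso_iff: "hypergraph_iso G H \<longleftrightarrow> (\<exists>f. iso_via f G H)"
  by (simp add: hypergraph_iso_def iso_via_def)

lemma hypergraph_iso_sym: "hypergraph G \<Longrightarrow> hypergraph_iso G H \<Longrightarrow> hypergraph_iso H G"
  unfolding hypergraph_iso_iff using iso_via_sym by blast

lemma iso_via_star:
  assumes "hypergraph G" "iso_via f G H" "v \<in> verts G"
  shows "star H (f v) = (`) f ` star G v" "inj_on ((`) f) (star G v)"
proof -
  have inj: "inj_on f (verts G)" and sub: "\<And>c. c \<in> edges G \<Longrightarrow> c \<subseteq> verts G"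
    and e: "(`) f ` edges G = edges H" "inj_on ((`) f) (edges G)"
    using assms by (auto simp: iso_via_def bij_betw_def hypergraph_def)
  have "f v \<in> f ` c \<longleftrightarrow> v \<in> c" if "c \<in> edges G" for c
    using inj_on_image_mem_iff[OF inj assms(3) sub[OF that]] .
  then have "{c \<in> (`) f ` edges G. f v \<in> c} = (`) f ` {c \<in> edges G. v \<in> c}" by fast
  then show "star H (f v) = (`) f ` star G v" unfolding star_def e(1) .
  show "inj_on ((`) f) (star G v)"
    by (rule inj_on_subset[OF e(2)]) (auto simp: star_def)
qed

text \<open>The Perron vector of \<open>H\<close>, pulled back along \<open>f\<close>, is a test vector on \<open>G\<close>.\<close>

lemma scaled_rho_le_of_iso:
  assumes G: "k_hypergraph k G" and H: "k_hypergraph k H" and iso: "iso_via f G H"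
  shows "scaled_rho k H \<le> scaled_rho k G"
proof -
  note D = k_hypergraphD[OF G]
  have b: "bij_betw f (verts G) (verts H)" using iso by (simp add: iso_via_def)
  obtain y where y0: "\<And>v. 0 \<le> y v" and nz: "\<exists>v\<in>verts H. y v \<noteq> 0"
    and ev: "eigenvector_for H (scaled_rho k H) y"
    using perron_vector[OF H] by blast
  show ?thesis
  proof (rule scaled_rho_ge_subsolution(1)[OF G, of "y \<circ> f"])
    have "verts H = f ` verts G" using b by (simp add: bij_betw_def)
    with nz show "\<exists>v\<in>verts G. (y \<circ> f) v \<noteq> 0" by simp
    fix v assume v: "v \<in> verts G"
    note st = iso_via_star[OF D(2) iso v]
    have fv: "f v \<in> verts H" using v bij_betwE[OF b] by blast
    have "sum (y \<circ> f) e = sum y (f ` e)" if "e \<in> star G v" for e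
    proof (rule sum.reindex[where g = y and h = f, symmetric])
      show "inj_on f e"
        by (rule inj_on_subset[OF bij_betw_imp_inj_on[OF b]]) (use that D(6) in \<open>auto simp: star_def\<close>)
    qed
    then have "(\<Sum>e\<in>star G v. sum (y \<circ> f) e) = (\<Sum>e\<in>star G v. sum y (f ` e))"
      by (rule sum.cong[OF refl])
    also have "\<dots> = (\<Sum>e\<in>star H (f v). sum y e)"
    proof -
      have "(\<Sum>e\<in>(`) f ` star G v. sum y e) = (\<Sum>e\<in>star G v. (sum y \<circ> (`) f) e)"
        by (rule sum.reindex[OF st(2)])
      then show ?thesis unfolding st(1) comp_def by (rule sym)
    qed
    also have "\<dots> = (scaled_rho k H + deg H (f v)) * y (f v)"
      using bspec[OF ev[unfolded eigenvector_for_def] fv] .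
    also have "deg H (f v) = deg G v"
      unfolding deg_def st(1) by (rule card_image[OF st(2)])
    finally show "(scaled_rho k H + deg G v) * (y \<circ> f) v \<le> (\<Sum>e\<in>star G v. sum (y \<circ> f) e)" by simp
  qed (use y0 in simp)
qed

lemma rho_eq_of_iso:
  assumes G: "k_hypergraph k G" and H: "k_hypergraph k H" and iso: "hypergraph_iso G H"
  shows "rho G = rho H"
proof -
  obtain f where f: "iso_via f G H" using iso by (auto simp: hypergraph_iso_iff)
  have "scaled_rho k G = scaled_rho k H"
    using scaled_rho_le_of_iso[OF G H f] scaled_rho_le_of_iso[OF H G iso_via_sym[OF k_hypergraphD(2)[OF G] f]] by simp
  then show ?thesis using k_hypergraphD(1)[OF G] by (simp add: scaled_rho_def)
qed

section \<open>The lower bound for unicyclic hypergraphs\<close>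

definition cut_unicyclic :: "nat \<Rightarrow> 'a hypergraph \<Rightarrow> bool" where
  "cut_unicyclic k G \<longleftrightarrow> k_hypergraph k G \<and> cut_connected G \<and> card (verts G) = (k - 1) * card (edges G)"

text \<open>The local description of hypercycles. The vertices of degree \<open>2\<close> are the joints of consecutive edges.\<close>

definition cycle_like :: "nat \<Rightarrow> 'a hypergraph \<Rightarrow> bool" where
  "cycle_like k G \<longleftrightarrow> k_hypergraph k G \<and> cut_connected G \<and>
     (\<forall>v\<in>verts G. deg G v = 1 \<or> deg G v = 2) \<and> (\<forall>e\<in>edges G. card {v \<in> e. deg G v = 2} = 2)"

text \<open>The value of \<^const>\<open>scaled_rho\<close> on hypercycles: the positive root of \<open>L^2 = (k - 1) (L + 2)\<close>.\<close>

definition cycle_value :: "nat \<Rightarrow> real" where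
  "cycle_value k = (real k - 1 + sqrt ((real k - 1)\<^sup>2 + 8 * (real k - 1))) / 2"

lemma cycle_value_equation:
  assumes "3 \<le> k"
  shows "0 < cycle_value k" "(cycle_value k)\<^sup>2 = (real k - 1) * (cycle_value k + 2)"
    "4 / (cycle_value k + 2) + (real k - 2) / (cycle_value k + 1) = 1"
proof -
  define r where "r = sqrt ((real k - 1)\<^sup>2 + 8 * (real k - 1))"
  have r: "r\<^sup>2 = (real k - 1)\<^sup>2 + 8 * (real k - 1)" "r \<ge> 0"
    using assms by (auto simp: r_def)
  have L: "cycle_value k = (real k - 1 + r) / 2" by (simp add: cycle_value_def r_def)
  show pos: "0 < cycle_value k" using assms r(2) by (simp add: L)
  show sq: "(cycle_value k)\<^sup>2 = (real k - 1) * (cycle_value k + 2)"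
    using r(1) by (simp add: L power2_eq_square field_simps)
  have "4 * (cycle_value k + 1) + (real k - 2) * (cycle_value k + 2) = (cycle_value k + 1) * (cycle_value k + 2)"
    using sq by (simp add: power2_eq_square algebra_simps)
  then show "4 / (cycle_value k + 2) + (real k - 2) / (cycle_value k + 1) = 1"
    using pos by (simp add: add_frac_eq mult.commute)
qed

lemma sum_over_edge_by_degree:
  fixes f :: "nat \<Rightarrow> real"
  assumes G: "k_hypergraph k G" and e: "e \<in> edges G"
    and deg: "\<And>v. v \<in> e \<Longrightarrow> deg G v = 1 \<or> deg G v = 2"
  shows "(\<Sum>v\<in>e. f (deg G v)) = card {v \<in> e. deg G v = 2} * f 2 + (real k - card {v \<in> e. deg G v = 2}) * f 1"
proof -
  note D = k_hypergraphD[OF G]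
  let ?A = "{v \<in> e. deg G v = 2}"
  have fin: "finite e" and c: "card e = k" using D(7,8) e by auto
  have "(\<Sum>v\<in>e. f (deg G v)) = (\<Sum>v\<in>?A. f (deg G v)) + (\<Sum>v\<in>e - ?A. f (deg G v))"
    by (subst add.commute, rule sum.subset_diff[OF _ fin]) auto
  also have "(\<Sum>v\<in>?A. f (deg G v)) = (\<Sum>v\<in>?A. f 2)" by (intro sum.cong) auto
  also have "(\<Sum>v\<in>e - ?A. f (deg G v)) = (\<Sum>v\<in>e - ?A. f 1)"
    by (intro sum.cong refl) (use deg in \<open>fastforce\<close>)
  also have "card (e - ?A) = k - card ?A" using fin c by (simp add: card_Diff_subset)
  then have "(\<Sum>v\<in>e - ?A. f 1) = (real k - card ?A) * f 1"
    using card_mono[OF fin, of ?A] c by (simp add: of_nat_diff)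
  finally show ?thesis by simp
qed

text \<open>The vector \<open>d\<^sub>v / (L + d\<^sub>v)\<close> has sum \<open>1\<close> over every edge and is therefore a positive eigenvector.\<close>

lemma scaled_rho_cycle_like:
  assumes "cycle_like k G"
  shows "scaled_rho k G = cycle_value k"
proof -
  have G: "k_hypergraph k G" and deg: "\<And>v. v \<in> verts G \<Longrightarrow> deg G v = 1 \<or> deg G v = 2"
    and two: "\<And>e. e \<in> edges G \<Longrightarrow> card {v \<in> e. deg G v = 2} = 2"
    using assms by (auto simp: cycle_like_def)
  note D = k_hypergraphD[OF G]
  let ?L = "cycle_value k"
  note L = cycle_value_equation[OF D(1)]
  define f :: "nat \<Rightarrow> real" where "f d = d / (?L + d)" for d
  have one: "(\<Sum>v\<in>e. f (deg G v)) = 1" if e: "e \<in> edges G" for e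
  proof -
    have "(\<Sum>v\<in>e. f (deg G v)) = 2 * f 2 + (real k - 2) * f 1"
      using sum_over_edge_by_degree[OF G e, of f] deg D(6)[OF e] two[OF e] by auto
    then show ?thesis using L(3) by (simp add: f_def)
  qed
  show ?thesis
  proof (rule scaled_rho_eq_positive_eigenvector[OF G])
    show "0 < f (deg G v)" if "v \<in> verts G" for v
      using deg[OF that] L(1) by (auto simp: f_def)
    show "eigenvector_for G ?L (\<lambda>v. f (deg G v))"
      unfolding eigenvector_for_def
    proof
      fix v
      have "(\<Sum>e\<in>star G v. \<Sum>v\<in>e. f (deg G v)) = (\<Sum>e\<in>star G v. 1)"
        by (intro sum.cong refl one) (simp add: star_def)
      then show "(\<Sum>e\<in>star G v. \<Sum>v\<in>e. f (deg G v)) = (?L + deg G v) * f (deg G v)"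
        using L(1) by (simp add: f_def deg_def)
    qed
  qed
qed

text \<open>The function \<open>d^2 / (L + d)\<close> exceeds its chord through \<open>d = 1\<close> and \<open>d = 2\<close> by a multiple of \<open>(d - 1) (d - 2)\<close>,
which is never negative on natural numbers.\<close>

lemma convex_chord:
  fixes L d :: real
  assumes "0 < L" "0 < L + d"
  shows "d\<^sup>2 / (L + d) = 1 / (L + 1) + (d - 1) * (4 / (L + 2) - 1 / (L + 1))
    + L\<^sup>2 * ((d - 1) * (d - 2)) / ((L + 1) * (L + 2) * (L + d))"
proof -
  have nz: "L + 1 \<noteq> 0" "L + 2 \<noteq> 0" "L + d \<noteq> 0" using assms by linarith+
  have "1 / (L + 1) + (d - 1) * (4 / (L + 2) - 1 / (L + 1))
      = ((L + 2) + (d - 1) * (4 * (L + 1) - (L + 2))) / ((L + 1) * (L + 2))"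
    using nz(1,2) by (simp add: divide_simps)
  also have "\<dots> + L\<^sup>2 * ((d - 1) * (d - 2)) / ((L + 1) * (L + 2) * (L + d))
      = (((L + 2) + (d - 1) * (4 * (L + 1) - (L + 2))) * (L + d) + L\<^sup>2 * ((d - 1) * (d - 2)))
        / ((L + 1) * (L + 2) * (L + d))"
    using nz by (simp add: add_divide_distrib)
  also have "((L + 2) + (d - 1) * (4 * (L + 1) - (L + 2))) * (L + d) + L\<^sup>2 * ((d - 1) * (d - 2))
      = (L + 1) * (L + 2) * d\<^sup>2"
    by (simp add: power2_eq_square algebra_simps)
  also have "\<dots> / ((L + 1) * (L + 2) * (L + d)) = d\<^sup>2 / (L + d)"
    using nz by simp
  finally show ?thesis by simp
qed

text \<open>The test vector \<open>x\<^sub>v = d\<^sub>v / (L + d\<^sub>v)\<close> is the one that is an eigenvector on a hypercycle. Its Rayleigh defect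
with respect to \<open>L\<close> is the sum \<open>Q\<close> of the squares \<open>(S\<^sub>e - 1)^2\<close> and of the excesses \<open>r\<^sub>v\<close> over the chord. If
\<open>Q = 0\<close>, the excesses restrict the degrees to \<open>1\<close> and \<open>2\<close>, and \<open>S\<^sub>e = 1\<close> fixes the number of vertices of
degree \<open>2\<close> in each edge.\<close>

lemma scaled_rho_lower_bound:
  assumes G: "k_hypergraph k G" and card: "card (verts G) = (k - 1) * card (edges G)"
  shows "cycle_value k \<le> scaled_rho k G"
    "cycle_value k = scaled_rho k G \<Longrightarrow> (\<forall>v\<in>verts G. deg G v = 1 \<or> deg G v = 2) \<and>
       (\<forall>e\<in>edges G. card {v \<in> e. deg G v = 2} = 2)"
proof -
  note D = k_hypergraphD[OF G]
  let ?L = "cycle_value k"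
  note L = cycle_value_equation[OF D(1)]
  define m where "m = card (edges G)"
  define x where "x v = real (deg G v) / (?L + deg G v)" for v
  define h where "h v = (real (deg G v))\<^sup>2 / (?L + deg G v)" for v
  define r where "r v = ?L\<^sup>2 * ((real (deg G v) - 1) * (real (deg G v) - 2)) / ((?L + 1) * (?L + 2) * (?L + deg G v))" for v
  have Ld: "?L + deg G v > 0" for v using L(1) by linarith
  have n: "real (card (verts G)) = (real k - 1) * m"
    using D(1) by (simp add: card m_def of_nat_diff)
  have sd: "(\<Sum>v\<in>verts G. real (deg G v)) = real k * m"
    using arg_cong[OF sum_deg[OF G], of real] by (simp add: m_def)
  \<comment> \<open>The chord contributes exactly \<open>m\<close>, by the degree sum and the equation that defines \<open>L\<close>.\<close>
  have sum_h: "(\<Sum>v\<in>verts G. h v) = m + (\<Sum>v\<in>verts G. r v)"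
  proof -
    have "h v = 1 / (?L + 1) + (real (deg G v) - 1) * (4 / (?L + 2) - 1 / (?L + 1)) + r v" for v
      unfolding h_def r_def by (rule convex_chord[OF L(1) Ld])
    then have "(\<Sum>v\<in>verts G. h v) = real (card (verts G)) * (1 / (?L + 1))
        + ((\<Sum>v\<in>verts G. real (deg G v)) - card (verts G)) * (4 / (?L + 2) - 1 / (?L + 1))
        + (\<Sum>v\<in>verts G. r v)"
      by (simp add: sum.distrib sum_subtractf flip: sum_distrib_right)
    also have "real (card (verts G)) * (1 / (?L + 1))
        + ((\<Sum>v\<in>verts G. real (deg G v)) - card (verts G)) * (4 / (?L + 2) - 1 / (?L + 1))
        = m * (4 / (?L + 2) + (real k - 2) / (?L + 1))"
      unfolding sd n by (simp add: algebra_simps diff_divide_distrib add_divide_distrib)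
    finally show ?thesis unfolding L(3) by simp
  qed
  have r0: "r v \<ge> 0" for v
  proof -
    have "(real (deg G v) - 1) * (real (deg G v) - 2) \<ge> 0"
    proof (cases "deg G v \<le> 1")
      case True
      then show ?thesis by (intro mult_nonpos_nonpos) auto
    next
      case False
      then show ?thesis by (intro mult_nonneg_nonneg) auto
    qed
    then have "?L\<^sup>2 * ((real (deg G v) - 1) * (real (deg G v) - 2)) \<ge> 0" by simp
    moreover have "(?L + 1) * (?L + 2) * (?L + deg G v) \<ge> 0" using L(1) Ld[of v] by simp
    ultimately show ?thesis unfolding r_def by (rule divide_nonneg_nonneg)
  qed
  have sumS: "(\<Sum>e\<in>edges G. sum x e) = (\<Sum>v\<in>verts G. h v)"
  proof -
    have "(\<Sum>e\<in>edges G. sum x e) = (\<Sum>v\<in>verts G. \<Sum>e\<in>star G v. x v)"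
      by (rule sum_star_swap[OF G, symmetric])
    also have "\<dots> = (\<Sum>v\<in>verts G. h v)"
      by (intro sum.cong refl) (simp add: x_def h_def deg_def power2_eq_square)
    finally show ?thesis .
  qed
  have sumX: "(\<Sum>v\<in>verts G. (?L + deg G v) * (x v)\<^sup>2) = (\<Sum>v\<in>verts G. h v)"
  proof (intro sum.cong refl)
    fix v
    show "(?L + deg G v) * (x v)\<^sup>2 = h v"
      using Ld[of v] by (simp add: x_def h_def power2_eq_square)
  qed
  define Q where "Q = (\<Sum>e\<in>edges G. (sum x e - 1)\<^sup>2) + (\<Sum>v\<in>verts G. r v)"
  have Qdef: "(\<Sum>e\<in>edges G. (sum x e)\<^sup>2) = (\<Sum>v\<in>verts G. h v) + Q"
  proof -
    have "(sum x e)\<^sup>2 = (sum x e - 1)\<^sup>2 + 2 * sum x e - 1" for e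
      by (simp add: power2_eq_square algebra_simps)
    then have "(\<Sum>e\<in>edges G. (sum x e)\<^sup>2) = (\<Sum>e\<in>edges G. (sum x e - 1)\<^sup>2) + 2 * (\<Sum>e\<in>edges G. sum x e) - m"
      by (simp add: sum.distrib sum_subtractf m_def flip: sum_distrib_left)
    then show ?thesis unfolding Q_def sumS using sum_h by linarith
  qed
  have "(\<Sum>e\<in>edges G. (sum x e)\<^sup>2) \<le> (\<Sum>v\<in>verts G. (scaled_rho k G + deg G v) * (x v)\<^sup>2)"
    by (rule rayleigh_bound[OF G])
  then have Qle: "Q \<le> (scaled_rho k G - ?L) * (\<Sum>v\<in>verts G. (x v)\<^sup>2)"
    using Qdef sumX by (simp add: distrib_right left_diff_distrib sum.distrib flip: sum_distrib_left)
  have Q0: "0 \<le> Q" unfolding Q_def by (intro add_nonneg_nonneg sum_nonneg r0) simp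
  \<comment> \<open>An isolated \<open>w\<close> would have entry \<open>0\<close>; the test vector must not vanish.\<close>
  obtain w where w: "w \<in> verts G" "deg G w \<noteq> 0"
  proof -
    have "m \<noteq> 0" using card D(3,4) by (auto simp: m_def)
    then obtain e where e: "e \<in> edges G" unfolding m_def by (metis card.empty ex_in_conv)
    then have "e \<noteq> {}" using D(1,7) by fastforce
    then obtain w where "w \<in> e" by blast
    then have "e \<in> star G w" "w \<in> verts G" using e D(6) by (auto simp: star_def)
    then show ?thesis using that[of w] D(9)[of w] by (auto simp: deg_def)
  qed
  have pos: "(\<Sum>v\<in>verts G. (x v)\<^sup>2) > 0"
    by (rule sum_pos2[OF D(3) w(1)]) (use w Ld[of w] in \<open>auto simp: x_def\<close>)
  have "0 \<le> (scaled_rho k G - ?L) * (\<Sum>v\<in>verts G. (x v)\<^sup>2)" using Qle Q0 by linarith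
  then show "?L \<le> scaled_rho k G" using pos by (simp add: zero_le_mult_iff)
  assume "?L = scaled_rho k G"
  then have "Q = 0" using Qle Q0 by simp
  moreover have "0 \<le> (\<Sum>e\<in>edges G. (sum x e - 1)\<^sup>2)" "0 \<le> (\<Sum>v\<in>verts G. r v)"
    by (auto intro: sum_nonneg r0)
  ultimately have z: "(\<Sum>e\<in>edges G. (sum x e - 1)\<^sup>2) = 0" "(\<Sum>v\<in>verts G. r v) = 0"
    unfolding Q_def by linarith+
  have degs: "deg G v = 1 \<or> deg G v = 2" if v: "v \<in> verts G" for v
  proof -
    have "r v = 0" using z(2) v D(3) by (simp add: sum_nonneg_eq_0_iff r0)
    then show ?thesis using L(1) Ld[of v] unfolding r_def by auto
  qed
  have "card {v \<in> e. deg G v = 2} = 2" if e: "e \<in> edges G" for e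
  proof -
    let ?t = "real (card {v \<in> e. deg G v = 2})"
    have "sum x e = 1" using z(1) e D(5) by (simp add: sum_nonneg_eq_0_iff)
    moreover have "sum x e = ?t * (2 / (?L + 2)) + (real k - ?t) * (1 / (?L + 1))"
      using sum_over_edge_by_degree[OF G e, of "\<lambda>d. d / (?L + d)"] degs D(6)[OF e]
      unfolding x_def by auto
    ultimately have "?t * (2 / (?L + 2)) + (real k - ?t) * (1 / (?L + 1))
        = 4 / (?L + 2) + (real k - 2) / (?L + 1)" using L(3) by simp
    then have "(?t - 2) * (2 / (?L + 2) - 1 / (?L + 1)) = 0"
      by (simp add: algebra_simps diff_divide_distrib add_divide_distrib)
    moreover have "2 / (?L + 2) - 1 / (?L + 1) \<noteq> 0"
      using L(1) by (simp add: divide_simps)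
    ultimately show ?thesis by simp
  qed
  then show "(\<forall>v\<in>verts G. deg G v = 1 \<or> deg G v = 2) \<and> (\<forall>e\<in>edges G. card {v \<in> e. deg G v = 2} = 2)"
    using degs by blast
qed

lemma cut_unicyclic_scaled_rho:
  assumes "cut_unicyclic k G"
  shows "cycle_value k \<le> scaled_rho k G" "cycle_value k = scaled_rho k G \<longleftrightarrow> cycle_like k G"
proof -
  have u: "k_hypergraph k G" "cut_connected G" "card (verts G) = (k - 1) * card (edges G)"
    using assms by (auto simp: cut_unicyclic_def)
  show "cycle_value k \<le> scaled_rho k G" by (rule scaled_rho_lower_bound(1)[OF u(1,3)])
  show "cycle_value k = scaled_rho k G \<longleftrightarrow> cycle_like k G"
  proof
    assume "cycle_value k = scaled_rho k G"
    from scaled_rho_lower_bound(2)[OF u(1,3) this] show "cycle_like k G"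
      unfolding cycle_like_def using u(1,2) by simp
  qed (simp add: scaled_rho_cycle_like)
qed

text \<open>Counting incidences of joints with edges shows that there are as many joints as edges.\<close>

lemma cycle_like_imp_cut_unicyclic:
  assumes "cycle_like k G"
  shows "cut_unicyclic k G"
proof -
  have G: "k_hypergraph k G" and deg: "\<And>v. v \<in> verts G \<Longrightarrow> deg G v = 1 \<or> deg G v = 2"
    and two: "\<And>e. e \<in> edges G \<Longrightarrow> card {v \<in> e. deg G v = 2} = 2"
    using assms by (auto simp: cycle_like_def)
  note D = k_hypergraphD[OF G]
  let ?c = "\<lambda>v. if deg G v = 2 then 1 else 0 :: nat"
  have "(\<Sum>v\<in>verts G. \<Sum>e\<in>star G v. ?c v) = (\<Sum>e\<in>edges G. \<Sum>v\<in>e. ?c v)"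
    by (rule sum_star_swap[OF G])
  also have "\<dots> = (\<Sum>e\<in>edges G. 2)"
  proof (intro sum.cong refl)
    fix e assume e: "e \<in> edges G"
    have "(\<Sum>v\<in>e. ?c v) = card {v \<in> e. deg G v = 2}"
      using D(8)[OF e] by (simp add: sum.If_cases Int_def conj_commute)
    then show "(\<Sum>v\<in>e. ?c v) = 2" using two[OF e] by simp
  qed
  also have "(\<Sum>v\<in>verts G. \<Sum>e\<in>star G v. ?c v) = (\<Sum>v\<in>verts G. 2 * (deg G v - 1))"
    by (intro sum.cong refl) (use deg in \<open>fastforce simp flip: deg_def\<close>)
  finally have "(\<Sum>v\<in>verts G. deg G v - 1) = card (edges G)"
    by (simp flip: sum_distrib_left)
  moreover have "(\<Sum>v\<in>verts G. deg G v - 1) + card (verts G) = (\<Sum>v\<in>verts G. deg G v)"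
  proof -
    have "(\<Sum>v\<in>verts G. deg G v) = (\<Sum>v\<in>verts G. (deg G v - 1) + 1)"
      by (intro sum.cong refl) (use deg in fastforce)
    then show ?thesis unfolding sum.distrib by simp
  qed
  ultimately have "card (edges G) + card (verts G) = k * card (edges G)" using sum_deg[OF G] by simp
  then have "card (verts G) = (k - 1) * card (edges G)" using D(1) by (simp add: diff_mult_distrib)
  then show ?thesis using assms by (simp add: cut_unicyclic_def cycle_like_def)
qed

text \<open>An isolated vertex would be all of \<open>G\<close>, which has an edge.\<close>

lemma deg_pos:
  assumes "cut_unicyclic k G" "v \<in> verts G"
  shows "1 \<le> deg G v"
proof (rule ccontr)
  assume "\<not> ?thesis"
  have G: "k_hypergraph k G" and con: "cut_connected G" and n: "card (verts G) = (k - 1) * card (edges G)"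
    using assms by (auto simp: cut_unicyclic_def)
  note D = k_hypergraphD[OF G]
  have "card (star G v) = 0" using \<open>\<not> 1 \<le> deg G v\<close> by (simp add: deg_def)
  then have "star G v = {}" using D(9)[of v] by simp
  then have "{v} = verts G"
    by (intro cut_connectedD[OF con]) (use assms(2) in \<open>auto simp: star_def\<close>)
  then have "(k - 1) * card (edges G) = 1" using n by (metis card.insert card.empty finite.emptyI empty_iff One_nat_def)
  then show False using D(1) by auto
qed

text \<open>One edge has \<open>k\<close> vertices, but a hypergraph with one edge would have only \<open>k - 1\<close>.\<close>

lemma cut_unicyclic_card_edges:
  assumes "cut_unicyclic k G"
  shows "2 \<le> card (edges G)"
proof -
  have G: "k_hypergraph k G" and n: "card (verts G) = (k - 1) * card (edges G)"
    using assms by (auto simp: cut_unicyclic_def)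
  note D = k_hypergraphD[OF G]
  have "card (verts G) \<noteq> 0" using D(3,4) by simp
  then have "card (edges G) \<noteq> 0" using n by auto
  then obtain e where e: "e \<in> edges G" by (metis card.empty ex_in_conv)
  have "k \<le> card (verts G)" using card_mono[OF D(3) D(6)[OF e]] D(7)[OF e] by simp
  then have "card (edges G) \<noteq> 1" using n D(1) by auto
  then show ?thesis using \<open>card (edges G) \<noteq> 0\<close> by linarith
qed

text \<open>With \<open>m\<close> edges, the numbers \<open>d\<^sub>v - 1\<close> add up to \<open>m\<close>, while each of the \<open>m\<close> edges contains at least two vertices of
degree at least \<open>2\<close>. Double counting turns this into a sum of nonnegative terms \<open>s\<^sub>v\<close> and \<open>t\<^sub>e\<close> with total
zero, where \<open>s\<^sub>v = d\<^sub>v - 2\<close> if \<open>d\<^sub>v \<ge> 2\<close> and \<open>t\<^sub>e\<close> is the number of such vertices in \<open>e\<close> beyond two.\<close>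

lemma cut_unicyclic_without_leaf_is_cycle:
  assumes uni: "cut_unicyclic k G" and noleaf: "\<And>e. e \<in> edges G \<Longrightarrow> 2 \<le> card {v \<in> e. 2 \<le> deg G v}"
  shows "cycle_like k G"
proof -
  have G: "k_hypergraph k G" and con: "cut_connected G" and n: "card (verts G) = (k - 1) * card (edges G)"
    using uni by (auto simp: cut_unicyclic_def)
  note D = k_hypergraphD[OF G]
  let ?c = "\<lambda>v. if 2 \<le> deg G v then 1 else 0 :: int"
  let ?m = "int (card (edges G))"
  define s where "s v = 2 * (int (deg G v) - 1) - int (deg G v) * ?c v" for v
  define t where "t e = int (card {v \<in> e. 2 \<le> deg G v}) - 2" for e
  have "(\<Sum>v\<in>verts G. \<Sum>e\<in>star G v. ?c v) = (\<Sum>e\<in>edges G. \<Sum>v\<in>e. ?c v)"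
    by (rule sum_star_swap[OF G])
  also have "\<dots> = (\<Sum>e\<in>edges G. t e + 2)"
  proof (intro sum.cong refl)
    fix e assume e: "e \<in> edges G"
    show "(\<Sum>v\<in>e. ?c v) = t e + 2"
      using D(8)[OF e] by (simp add: t_def sum.If_cases Int_def conj_commute)
  qed
  also have "(\<Sum>v\<in>verts G. \<Sum>e\<in>star G v. ?c v) = (\<Sum>v\<in>verts G. int (deg G v) * ?c v)"
    by (simp add: deg_def)
  finally have 1: "(\<Sum>v\<in>verts G. int (deg G v) * ?c v) = (\<Sum>e\<in>edges G. t e) + 2 * ?m"
    by (simp add: sum.distrib)
  have "int (\<Sum>v\<in>verts G. deg G v) - int (card (verts G)) = ?m"
    using D(1) by (simp add: sum_deg[OF G] n of_nat_diff algebra_simps)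
  then have "(\<Sum>v\<in>verts G. int (deg G v) - 1) = ?m"
    by (simp add: sum_subtractf)
  then have 2: "(\<Sum>v\<in>verts G. 2 * (int (deg G v) - 1)) = 2 * ?m"
    unfolding sum_distrib_left[symmetric] by simp
  have "(\<Sum>v\<in>verts G. s v) = (\<Sum>v\<in>verts G. 2 * (int (deg G v) - 1)) - (\<Sum>v\<in>verts G. int (deg G v) * ?c v)"
    unfolding s_def by (rule sum_subtractf)
  then have tot: "(\<Sum>v\<in>verts G. s v) + (\<Sum>e\<in>edges G. t e) = 0" using 1 2 by linarith
  have s0: "0 \<le> s v" if "v \<in> verts G" for v
    using deg_pos[OF uni that] by (auto simp: s_def)
  have t0: "0 \<le> t e" if "e \<in> edges G" for e
    using noleaf[OF that] by (simp add: t_def)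
  have "0 \<le> (\<Sum>v\<in>verts G. s v)" "0 \<le> (\<Sum>e\<in>edges G. t e)" by (auto intro: sum_nonneg s0 t0)
  then have z: "(\<Sum>v\<in>verts G. s v) = 0" "(\<Sum>e\<in>edges G. t e) = 0" using tot by linarith+
  have degs: "deg G v = 1 \<or> deg G v = 2" if v: "v \<in> verts G" for v
  proof -
    have "s v = 0" using z(1) v D(3) s0 by (simp add: sum_nonneg_eq_0_iff)
    then show ?thesis using deg_pos[OF uni v] by (auto simp: s_def split: if_splits)
  qed
  have "card {v \<in> e. deg G v = 2} = 2" if e: "e \<in> edges G" for e
  proof -
    have "t e = 0" using z(2) e D(5) t0 by (simp add: sum_nonneg_eq_0_iff)
    moreover have "{v \<in> e. 2 \<le> deg G v} = {v \<in> e. deg G v = 2}"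
      using degs D(6)[OF e] by fastforce
    ultimately show ?thesis by (simp add: t_def)
  qed
  then show ?thesis using G con degs by (simp add: cycle_like_def)
qed

section \<open>Recognising hypercycles\<close>

lemma star_eq_of_deg_2:
  assumes G: "k_hypergraph k G" and "deg G v = 2" "e \<in> edges G" "f \<in> edges G" "v \<in> e" "v \<in> f" "e \<noteq> f"
  shows "star G v = {e, f}"
proof (rule card_seteq[OF k_hypergraphD(9)[OF G], symmetric])
  show "{e, f} \<subseteq> star G v" using assms by (auto simp: star_def)
  show "card (star G v) \<le> card {e, f}" using assms by (simp add: deg_def)
qed

lemma cycle_like_edge_joints:
  assumes G: "cycle_like k G" and "e \<in> edges G" "v \<in> e" "w \<in> e" "v \<noteq> w" "deg G v = 2" "deg G w = 2"
  shows "{z \<in> e. deg G z = 2} = {v, w}"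
proof -
  have "k_hypergraph k G" using G by (simp add: cycle_like_def)
  then have "finite {z \<in> e. deg G z = 2}" using k_hypergraphD(8)[OF _ assms(2)] by auto
  then show ?thesis
  proof (rule card_seteq[symmetric])
    show "{v, w} \<subseteq> {z \<in> e. deg G z = 2}" using assms by auto
    show "card {z \<in> e. deg G z = 2} \<le> card {v, w}"
      using G assms by (simp add: cycle_like_def)
  qed
qed

lemma cycle_like_mate:
  assumes G: "cycle_like k G" and e: "e \<in> edges G" and v: "v \<in> e" "deg G v = 2"
  obtains w where "w \<in> e" "w \<noteq> v" "deg G w = 2"
proof -
  have "card {z \<in> e. deg G z = 2} = 2" using G e by (simp add: cycle_like_def)
  then obtain a b where ab: "{z \<in> e. deg G z = 2} = {a, b}" "a \<noteq> b" by (auto simp: card_2_iff)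
  then have "a \<in> e" "b \<in> e" "deg G a = 2" "deg G b = 2" by auto
  then show thesis using that[of a] that[of b] ab(2) by (cases "a = v") auto
qed

lemma cycle_like_next_edge:
  assumes G: "cycle_like k G" and e: "e \<in> edges G" and v: "v \<in> e" "deg G v = 2"
  obtains f where "f \<in> edges G" "f \<noteq> e" "v \<in> f"
proof -
  have "card (star G v) = 2" using v by (simp add: deg_def)
  then obtain a b where ab: "star G v = {a, b}" "a \<noteq> b" by (auto simp: card_2_iff)
  then have "a \<in> edges G" "v \<in> a" "b \<in> edges G" "v \<in> b" by (auto simp: star_def)
  then show thesis using that[of a] that[of b] ab(2) by (cases "a = e") auto
qed

text \<open>The trail enters the edge \<open>e i\<close> through the joint \<open>v i\<close> and leaves it through \<open>v (i + 1)\<close>. The joint through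
which it leaves the last edge is not part of the data.\<close>

definition trail :: "'a hypergraph \<Rightarrow> nat \<Rightarrow> (nat \<Rightarrow> 'a) \<Rightarrow> (nat \<Rightarrow> 'a set) \<Rightarrow> bool" where
  "trail G q v e \<longleftrightarrow> inj_on e {1..q} \<and>
     (\<forall>i\<in>{1..q}. e i \<in> edges G \<and> v i \<in> e i \<and> deg G (v i) = 2) \<and>
     (\<forall>i. 1 \<le> i \<and> i < q \<longrightarrow> v (Suc i) \<in> e i \<and> v (Suc i) \<noteq> v i)"

text \<open>The edges of a trail are distinct, so its length is bounded. Maximality says that no joint of the last edge
other than the one through which the trail entered leads to an unused edge.\<close>

lemma maximal_trail_exists:
  assumes G: "k_hypergraph k G" and e0: "e\<^sub>0 \<in> edges G" "v\<^sub>0 \<in> e\<^sub>0" "deg G v\<^sub>0 = 2"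
  obtains q v e where "1 \<le> q" "trail G q v e" "v 1 = v\<^sub>0" "e 1 = e\<^sub>0"
    "\<And>w f. f \<in> edges G \<Longrightarrow> f \<notin> e ` {1..q} \<Longrightarrow> w \<in> e q \<Longrightarrow> w \<in> f \<Longrightarrow> deg G w = 2 \<Longrightarrow> w = v q"
proof -
  define Q where "Q q \<longleftrightarrow> (\<exists>v e. trail G q v e \<and> v 1 = v\<^sub>0 \<and> e 1 = e\<^sub>0)" for q
  have Q1: "Q 1" unfolding Q_def trail_def
    by (rule exI[of _ "\<lambda>_. v\<^sub>0"], rule exI[of _ "\<lambda>_. e\<^sub>0"]) (use e0 in auto)
  have bound: "q \<le> card (edges G)" if Qq: "Q q" for q
  proof -
    obtain v e where "trail G q v e" using Qq unfolding Q_def by blast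
    then have "inj_on e {1..q}" "e ` {1..q} \<subseteq> edges G" by (auto simp: trail_def)
    from card_inj_on_le[OF this k_hypergraphD(5)[OF G]] show ?thesis by simp
  qed
  have "\<exists>q\<ge>1. Q q \<and> \<not> Q (Suc q)"
  proof (rule ccontr)
    assume "\<not> ?thesis"
    then have step: "Q q \<Longrightarrow> Q (Suc q)" if "1 \<le> q" for q using that by blast
    have "Q (Suc n)" for n by (induction n) (use Q1 step in auto)
    from bound[OF this[of "card (edges G)"]] show False by simp
  qed
  then obtain q where q: "1 \<le> q" "Q q" "\<not> Q (Suc q)" by blast
  then obtain v e where t: "trail G q v e" and 1: "v 1 = v\<^sub>0" "e 1 = e\<^sub>0" unfolding Q_def by blast
  show thesis
  proof (rule that[OF q(1) t 1])
    fix w f assume f: "f \<in> edges G" "f \<notin> e ` {1..q}" "w \<in> e q" "w \<in> f" "deg G w = 2"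
    show "w = v q"
    proof (rule ccontr)
      assume "w \<noteq> v q"
      have inj: "inj_on e {1..q}" and in_edge: "\<And>i. 1 \<le> i \<Longrightarrow> i \<le> q \<Longrightarrow> e i \<in> edges G \<and> v i \<in> e i \<and> deg G (v i) = 2"
        and link: "\<And>i. 1 \<le> i \<Longrightarrow> i < q \<Longrightarrow> v (Suc i) \<in> e i \<and> v (Suc i) \<noteq> v i"
        using t unfolding trail_def by auto
      have "trail G (Suc q) (v(Suc q := w)) (e(Suc q := f))"
        unfolding trail_def
      proof (intro conjI ballI allI impI)
        show "inj_on (e(Suc q := f)) {1..Suc q}"
        proof (rule linorder_inj_onI')
          fix i j assume ij: "i \<in> {1..Suc q}" "j \<in> {1..Suc q}" "i < j"
          then have i: "i \<in> {1..q}" by auto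
          show "(e(Suc q := f)) i \<noteq> (e(Suc q := f)) j"
          proof (cases "j = Suc q")
            case True
            then show ?thesis using i f(2) by auto
          next
            case False
            then have "j \<in> {1..q}" using ij by auto
            then show ?thesis using i ij(3) inj_onD[OF inj, of i j] False by auto
          qed
        qed
        fix i assume "i \<in> {1..Suc q}"
        then show "(e(Suc q := f)) i \<in> edges G" "(v(Suc q := w)) i \<in> (e(Suc q := f)) i"
          "deg G ((v(Suc q := w)) i) = 2"
          using in_edge[of i] f by auto
      next
        fix i assume "1 \<le> i \<and> i < Suc q"
        then show "(v(Suc q := w)) (Suc i) \<in> (e(Suc q := f)) i"
          "(v(Suc q := w)) (Suc i) \<noteq> (v(Suc q := w)) i"
          using link[of i] f(3) \<open>w \<noteq> v q\<close> by (cases "i = q", auto)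
      qed
      moreover have "(v(Suc q := w)) 1 = v\<^sub>0" "(e(Suc q := f)) 1 = e\<^sub>0" using 1 q(1) by auto
      ultimately have "Q (Suc q)" unfolding Q_def by blast
      then show False using q(3) by blast
    qed
  qed
qed

text \<open>Let \<open>w\<close> be the other joint of the last edge of a maximal trail. Its second edge is some \<open>e j\<close> on the trail. Both
edges at each of \<open>v 2, \<dots>, v q\<close> are already known to be consecutive edges of the trail, so \<open>w\<close> can only be
\<open>v 1\<close>: the trail closes up. The union of its edges is then closed under edges and hence is everything.\<close>

lemma cycle_like_enumeration:
  assumes G: "cycle_like k G" and e0: "e\<^sub>0 \<in> edges G" "v\<^sub>0 \<in> e\<^sub>0" "deg G v\<^sub>0 = 2"
  obtains m v e where "m = card (edges G)" "v 1 = v\<^sub>0" "e 1 = e\<^sub>0" "bij_betw e {1..m} (edges G)" "inj_on v {1..m}"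
    "\<And>i. 1 \<le> i \<Longrightarrow> i \<le> m \<Longrightarrow> {z \<in> e i. deg G z = 2} = {v i, v (if i = m then 1 else i + 1)}"
proof -
  have H: "k_hypergraph k G" and con: "cut_connected G" using G by (auto simp: cycle_like_def)
  note D = k_hypergraphD[OF H]
  obtain q v e where q: "1 \<le> q" and t: "trail G q v e" and 1: "v 1 = v\<^sub>0" "e 1 = e\<^sub>0"
    and max: "\<And>w f. f \<in> edges G \<Longrightarrow> f \<notin> e ` {1..q} \<Longrightarrow> w \<in> e q \<Longrightarrow> w \<in> f \<Longrightarrow> deg G w = 2 \<Longrightarrow> w = v q"
    by (rule maximal_trail_exists[OF H e0]) blast
  have inj: "i = j" if "e i = e j" "1 \<le> i" "i \<le> q" "1 \<le> j" "j \<le> q" for i j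
  proof -
    have "inj_on e {1..q}" using t by (simp add: trail_def)
    from inj_onD[OF this that(1)] show ?thesis using that by simp
  qed
  have E: "e i \<in> edges G" and vin: "v i \<in> e i" and v2: "deg G (v i) = 2" if "1 \<le> i" "i \<le> q" for i
    using t that unfolding trail_def by auto
  have link: "v (Suc i) \<in> e i" "v (Suc i) \<noteq> v i" if "1 \<le> i" "i < q" for i
    using t that unfolding trail_def by auto
  have st: "star G (v (Suc i)) = {e i, e (Suc i)}" if "1 \<le> i" "i < q" for i
    by (rule star_eq_of_deg_2[OF H]) (use that E vin v2 link inj[of i "Suc i"] in auto)
  have jt: "{z \<in> e i. deg G z = 2} = {v i, v (Suc i)}" if "1 \<le> i" "i < q" for i
    by (rule cycle_like_edge_joints[OF G]) (use that E vin v2 link[of i] in auto)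
  obtain w where w: "w \<in> e q" "w \<noteq> v q" "deg G w = 2"
    using cycle_like_mate[OF G E[OF q order_refl] vin[OF q order_refl] v2[OF q order_refl]] .
  obtain f where f: "f \<in> edges G" "f \<noteq> e q" "w \<in> f"
    using cycle_like_next_edge[OF G E[OF q order_refl] w(1,3)] .
  have "f \<in> e ` {1..q}" using max[OF f(1) _ w(1) f(3) w(3)] w(2) by blast
  then obtain j where j: "1 \<le> j" "j \<le> q" "f = e j" by auto
  have jq: "j < q" using j f(2) by (cases "j = q") auto
  \<comment> \<open>From here on the other edge at \<open>w\<close> is located on the trail: it can only be the first one.\<close>
  have stw: "star G w = {e q, e j}"
    by (rule star_eq_of_deg_2[OF H w(3)]) (use E[OF q] f j w in auto)
  have "w \<in> {v j, v (Suc j)}" using jt[OF j(1) jq] f(3) w(3) j(3) by blast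
  moreover have "w \<noteq> v (Suc j)"
  proof
    assume "w = v (Suc j)"
    then have "e q \<in> {e j, e (Suc j)}" using st[OF j(1) jq] stw by auto
    then have "q = Suc j" using inj[of q j] inj[of q "Suc j"] jq j(1) by auto
    then show False using w(2) \<open>w = v (Suc j)\<close> by simp
  qed
  ultimately have wj: "w = v j" by blast
  have j1: "j = 1"
  proof (rule ccontr)
    assume "j \<noteq> 1"
    with j(1) have "j = Suc (j - 1)" "1 \<le> j - 1" by simp_all
    then obtain i where i: "j = Suc i" "1 \<le> i" by blast
    then have "e q \<in> {e i, e j}" using st[of i] stw wj jq by auto
    then show False using inj[of q j] inj[of q i] i jq by auto
  qed
  have w1: "w = v 1" and q2: "1 < q" using wj j1 jq by auto
  have jtq: "{z \<in> e q. deg G z = 2} = {v q, v 1}"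
    by (rule cycle_like_edge_joints[OF G]) (use q E vin v2 w w1 in auto)
  let ?n = "\<lambda>i. if i = q then 1 else i + 1"
  have joints: "{z \<in> e i. deg G z = 2} = {v i, v (?n i)}" if "1 \<le> i" "i \<le> q" for i
    using jt[of i] jtq that by (cases "i = q") auto
  have stars: "star G (v i) \<subseteq> e ` {1..q}" if "1 \<le> i" "i \<le> q" for i
  proof (cases "i = 1")
    case True
    then show ?thesis using stw w1 j1 q2 by auto
  next
    case False
    with that(1) have "i = Suc (i - 1)" "1 \<le> i - 1" by simp_all
    then obtain l where "i = Suc l" "1 \<le> l" by blast
    then show ?thesis using st[of l] that(2) by auto
  qed
  let ?U = "\<Union>(e ` {1..q})"
  have closed: "h \<in> e ` {1..q}" if h: "h \<in> edges G" "h \<inter> ?U \<noteq> {}" for h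
  proof -
    obtain z i where z: "z \<in> h" "z \<in> e i" "1 \<le> i" "i \<le> q" using h(2) by auto
    then have zV: "z \<in> verts G" using D(6) h(1) by blast
    show ?thesis
    proof (cases "deg G z = 2")
      case True
      then have "z \<in> {v i, v (?n i)}" using joints[OF z(3,4)] z(2) by blast
      then have "star G z \<subseteq> e ` {1..q}" using stars[OF z(3,4)] stars[of "?n i"] z(3,4) q by (auto split: if_splits)
      then show ?thesis using z(1) h(1) by (auto simp: star_def)
    next
      case False
      then have "card (star G z) = 1" using G zV unfolding cycle_like_def deg_def by auto
      then obtain c where "star G z = {c}" by (auto simp: card_1_singleton_iff)
      moreover have "h \<in> star G z" "e i \<in> star G z" using z h(1) E by (auto simp: star_def)
      ultimately have "h = e i" by auto
      then show ?thesis using z by auto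
    qed
  qed
  have U: "?U = verts G"
  proof (rule cut_connectedD[OF con])
    show "?U \<subseteq> verts G" using E D(6) by fastforce
    show "?U \<noteq> {}" using vin[OF q order_refl] q by auto
    show "h \<subseteq> ?U" if "h \<in> edges G" "h \<inter> ?U \<noteq> {}" for h using closed[OF that] by blast
  qed
  have im: "e ` {1..q} = edges G"
  proof
    show "e ` {1..q} \<subseteq> edges G" using E by auto
    show "edges G \<subseteq> e ` {1..q}"
    proof
      fix h assume h: "h \<in> edges G"
      then have "h \<noteq> {}" using D(1,7) by fastforce
      then show "h \<in> e ` {1..q}" using closed[OF h] D(6)[OF h] U by blast
    qed
  qed
  have bij: "bij_betw e {1..q} (edges G)"
    using im t unfolding bij_betw_def trail_def by blast
  have card: "q = card (edges G)" using bij_betw_same_card[OF bij] by simp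
  have less: "v i \<noteq> v l" if il: "1 \<le> i" "i < l" "l \<le> q" for i l
  proof
    assume eq: "v i = v l"
    have "l = Suc (l - 1)" "1 \<le> l - 1" using il by simp_all
    then obtain p where p: "l = Suc p" "1 \<le> p" by blast
    have "e i \<in> star G (v l)" using E[of i] vin[of i] il eq by (auto simp: star_def)
    then have "e i = e p \<or> e i = e l" using st[of p] p il by auto
    then have "i = p" using inj[of i p] inj[of i l] il p by auto
    then show False using link(2)[of p] eq p il by auto
  qed
  have injv: "inj_on v {1..q}"
    by (rule linorder_inj_onI') (use less in auto)
  show thesis by (rule that[of q v e]) (fact card 1 bij injv joints)+
qed

text \<open>Hypercycles have no path vertices; the value there is arbitrary.\<close>

definition cycle_map :: "(nat \<Rightarrow> 'a) \<Rightarrow> (nat \<Rightarrow> nat \<Rightarrow> 'a) \<Rightarrow> hvert \<Rightarrow> 'a" where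
  "cycle_map v a z = (case z of CycV i \<Rightarrow> v i | CycA i j \<Rightarrow> a i j | _ \<Rightarrow> v 1)"

text \<open>Prescribing the image \<open>u\<close> of \<^term>\<open>CycA 1 1\<close> uses the symmetry of the hypercycle: the enumeration may start
with the edge of \<open>u\<close>, and within that edge the vertices of degree \<open>1\<close> can be permuted. It is needed to
recognise lollipops, whose pendant edge hangs at \<^term>\<open>CycA 1 1\<close>.\<close>

lemma cycle_like_is_hypercycle:
  assumes G: "cycle_like k G" and u: "u \<in> verts G" "deg G u = 1"
  obtains f where "iso_via f (hypercycle (card (edges G)) k) G" "f (CycA 1 1) = u"
proof -
  have H: "k_hypergraph k G" and con: "cut_connected G" using G by (auto simp: cycle_like_def)
  note D = k_hypergraphD[OF H]
  have "star G u \<noteq> {}" using u(2) by (auto simp: deg_def)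
  then obtain e0 where e0: "e0 \<in> edges G" "u \<in> e0" by (auto simp: star_def)
  have "card {z \<in> e0. deg G z = 2} = 2" using G e0 by (simp add: cycle_like_def)
  then have "{z \<in> e0. deg G z = 2} \<noteq> {}" by fastforce
  then obtain v0 where v0: "v0 \<in> e0" "deg G v0 = 2" by blast
  obtain m v e where m: "m = card (edges G)" and e1: "e 1 = e0"
    and bij: "bij_betw e {1..m} (edges G)" and injv: "inj_on v {1..m}"
    and joints: "\<And>i. 1 \<le> i \<Longrightarrow> i \<le> m \<Longrightarrow> {z \<in> e i. deg G z = 2} = {v i, v (if i = m then 1 else i + 1)}"
    by (rule cycle_like_enumeration[OF G e0(1) v0]) blast
  have E: "e i \<in> edges G" if "1 \<le> i" "i \<le> m" for i using bij_betwE[OF bij] that by auto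
  have v2: "deg G (v i) = 2" "v i \<in> e i" if "1 \<le> i" "i \<le> m" for i
    using joints[OF that] by auto
  have m1: "1 \<le> m" using e0(1) D(5) m card_gt_0_iff[of "edges G"] by (simp add: Suc_le_eq) blast
  define B where "B i = {z \<in> e i. deg G z \<noteq> 2}" for i
  have cardB: "finite (B i)" "card (B i) = k - 2" if i: "1 \<le> i" "i \<le> m" for i
  proof -
    have fin: "finite (e i)" and c: "card (e i) = k" using E[OF i] D(7,8) by auto
    then show "finite (B i)" by (simp add: B_def)
    have "B i = e i - {z \<in> e i. deg G z = 2}" by (auto simp: B_def)
    then have "card (B i) = card (e i) - card {z \<in> e i. deg G z = 2}"
      using fin by (simp add: card_Diff_subset)
    then show "card (B i) = k - 2" using c G E[OF i] by (simp add: cycle_like_def)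
  qed
  have ex: "\<exists>h. bij_betw h {1..k - 2} (B i) \<and> (i = 1 \<longrightarrow> h 1 = u)" if i: "1 \<le> i" "i \<le> m" for i
  proof -
    obtain h where h: "bij_betw h {1..k - 2} (B i)"
      using ex_bij_betw_nat_finite_1[OF cardB(1)[OF i]] cardB(2)[OF i] by auto
    show ?thesis
    proof (cases "i = 1")
      case False
      then show ?thesis using h by blast
    next
      case True
      then have uB: "u \<in> B i" using u(2) e0(2) e1 by (simp add: B_def)
      have one: "1 \<in> {1..k - 2}" using D(1) by simp
      \<comment> \<open>Swapping the first value with \<open>u\<close> lets the enumeration of \<open>B 1\<close> start with \<open>u\<close>.\<close>
      have "bij_betw (Transposition.transpose (h 1) u \<circ> h) {1..k - 2} (B i)"
      proof (rule bij_betw_trans[OF h])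
        have "Transposition.transpose (h 1) u permutes B i"
          using uB bij_betwE[OF h] one by (intro permutes_swap_id) auto
        then show "bij_betw (Transposition.transpose (h 1) u) (B i) (B i)" by (rule permutes_imp_bij)
      qed
      then show ?thesis by (intro exI[of _ "Transposition.transpose (h 1) u \<circ> h"]) auto
    qed
  qed
  then have "\<forall>i\<in>{1..m}. \<exists>h. bij_betw h {1..k - 2} (B i) \<and> (i = 1 \<longrightarrow> h 1 = u)" by simp
  from bchoice[OF this] obtain a
    where a0: "\<forall>i\<in>{1..m}. bij_betw (a i) {1..k - 2} (B i) \<and> (i = 1 \<longrightarrow> a i 1 = u)" by blast
  have a: "bij_betw (a i) {1..k - 2} (B i)" if "1 \<le> i" "i \<le> m" for i using a0 that by simp
  have a1: "a 1 1 = u" using bspec[OF a0, of 1] m1 by simp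
  define F where "F = cycle_map v a"
  have FV: "F (CycV i) = v i" and FA: "F (CycA i j) = a i j" for i j
    by (simp_all add: F_def cycle_map_def)
  have aB: "a i j \<in> e i" "deg G (a i j) = 1" if "1 \<le> i" "i \<le> m" "j \<in> {1..k - 2}" for i j
  proof -
    have "a i j \<in> B i" using bij_betwE[OF a[OF that(1,2)]] that(3) by blast
    then show "a i j \<in> e i" "deg G (a i j) = 1"
      using G E[OF that(1,2)] D(6) unfolding B_def cycle_like_def by blast+
  qed
  let ?C = "hypercycle m k"
  have Fe: "F ` cycle_edge m k i = e i" if i: "1 \<le> i" "i \<le> m" for i
  proof -
    have "F ` cycle_edge m k i = {v i, v (if i = m then 1 else i + 1)} \<union> a i ` {1..k - 2}"
      unfolding cycle_edge_def image_Un image_insert image_image FV FA by simp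
    also have "\<dots> = {z \<in> e i. deg G z = 2} \<union> B i"
      using joints[OF i] a[OF i] by (simp add: bij_betw_def)
    also have "\<dots> = e i" by (auto simp: B_def)
    finally show ?thesis .
  qed
  have inj: "inj_on F (verts ?C)"
  proof (rule inj_onI)
    fix x y assume xy: "x \<in> verts ?C" "y \<in> verts ?C" "F x = F y"
    have AA: "i = i' \<and> j = j'"
      if "1 \<le> i" "i \<le> m" "1 \<le> i'" "i' \<le> m" "j \<in> {1..k - 2}" "j' \<in> {1..k - 2}" "a i j = a i' j'" for i j i' j'
    proof -
      have "card (star G (a i j)) = 1" using aB[OF that(1,2,5)] by (simp add: deg_def)
      then obtain c where "star G (a i j) = {c}" by (auto simp: card_1_singleton_iff)
      moreover have "e i \<in> star G (a i j)" "e i' \<in> star G (a i j)"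
        using aB[OF that(1,2,5)] aB[OF that(3,4,6)] that E by (auto simp: star_def)
      ultimately have "e i = e i'" by auto
      then have "i = i'" using bij that unfolding bij_betw_def by (auto dest: inj_onD)
      then show ?thesis using a[OF that(1,2)] that unfolding bij_betw_def by (auto dest: inj_onD)
    qed
    have VA: "v i \<noteq> a i' j'" if "1 \<le> i" "i \<le> m" "1 \<le> i'" "i' \<le> m" "j' \<in> {1..k - 2}" for i i' j'
      using v2(1)[OF that(1,2)] aB(2)[OF that(3-5)] by auto
    have VV: "i = i'" if "v i = v i'" "1 \<le> i" "i \<le> m" "1 \<le> i'" "i' \<le> m" for i i'
      using injv that by (auto dest: inj_onD)
    show "x = y"
      using xy(1,2)
    proof (auto simp: hypercycle_def)
      fix i i' assume "x = CycV i" "y = CycV i'" "Suc 0 \<le> i" "i \<le> m" "Suc 0 \<le> i'" "i' \<le> m"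
      then show "i = i'" using VV[of i i'] xy(3) by (simp add: FV)
    next
      fix i i' j' assume "x = CycV i" "y = CycA i' j'" "Suc 0 \<le> i" "i \<le> m" "Suc 0 \<le> i'" "i' \<le> m"
        "Suc 0 \<le> j'" "j' \<le> k - 2"
      then show False using VA[of i i' j'] xy(3) by (simp add: FV FA)
    next
      fix i j i' assume "x = CycA i j" "y = CycV i'" "Suc 0 \<le> i" "i \<le> m" "Suc 0 \<le> i'" "i' \<le> m"
        "Suc 0 \<le> j" "j \<le> k - 2"
      then show False using VA[of i' i j] xy(3) by (simp add: FV FA)
    next
      fix i j i' j' assume "x = CycA i j" "y = CycA i' j'" "Suc 0 \<le> i" "i \<le> m" "Suc 0 \<le> i'" "i' \<le> m"
        "Suc 0 \<le> j" "j \<le> k - 2" "Suc 0 \<le> j'" "j' \<le> k - 2"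
      then show "i = i'" "j = j'" using AA[of i i' j j'] xy(3) by (simp_all add: FA)
    qed
  qed
  have surj: "F ` verts ?C = verts G"
  proof
    show "F ` verts ?C \<subseteq> verts G"
    proof
      fix z assume "z \<in> F ` verts ?C"
      then consider i where "1 \<le> i" "i \<le> m" "z = v i" | i j where "1 \<le> i" "i \<le> m" "j \<in> {1..k - 2}" "z = a i j"
        by (fastforce simp: hypercycle_def FV FA)
      then show "z \<in> verts G" using v2(2) aB(1) E D(6) by cases blast+
    qed
    show "verts G \<subseteq> F ` verts ?C"
    proof
      fix z assume z: "z \<in> verts G"
      then have "deg G z \<noteq> 0" using G unfolding cycle_like_def by fastforce
      then have "star G z \<noteq> {}" by (auto simp: deg_def)
      then obtain h where h: "h \<in> edges G" "z \<in> h" by (auto simp: star_def)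
      then have "h \<in> e ` {1..m}" using bij by (simp add: bij_betw_def)
      then obtain i where i: "1 \<le> i" "i \<le> m" "h = e i" by auto
      have "cycle_edge m k i \<subseteq> verts ?C" using i m1 by (auto simp: cycle_edge_def hypercycle_def)
      then show "z \<in> F ` verts ?C" using Fe[OF i(1,2)] h(2) i(3) by blast
    qed
  qed
  have "bij_betw ((`) F) (cycle_edge m k ` {1..m}) (edges G)"
  proof -
    have "(`) F ` cycle_edge m k ` {1..m} = e ` {1..m}"
      unfolding image_image by (intro image_cong refl) (use Fe in auto)
    moreover have "inj_on ((`) F) (cycle_edge m k ` {1..m})"
    proof (rule inj_onI)
      fix A B assume "A \<in> cycle_edge m k ` {1..m}" "B \<in> cycle_edge m k ` {1..m}" "F ` A = F ` B"
      then obtain i j where ij: "1 \<le> i" "i \<le> m" "A = cycle_edge m k i" "1 \<le> j" "j \<le> m" "B = cycle_edge m k j"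
        by auto
      then have "e i = e j" using Fe \<open>F ` A = F ` B\<close> by metis
      then have "i = j" using bij ij unfolding bij_betw_def by (auto dest: inj_onD)
      then show "A = B" using ij by simp
    qed
    ultimately show ?thesis using bij by (simp add: bij_betw_def)
  qed
  then have "iso_via F ?C G"
    using inj surj by (simp add: iso_via_def bij_betw_def hypercycle_def)
  moreover have "F (CycA 1 1) = u" using FA a1 by simp
  ultimately show thesis using that m by blast
qed

section \<open>The standard hypercycle\<close>

lemma CycV_in_cycle_edge [simp]:
  "CycV i \<in> cycle_edge g k l \<longleftrightarrow> i = l \<or> i = (if l = g then 1 else l + 1)"
  by (auto simp: cycle_edge_def)

lemma CycA_in_cycle_edge [simp]:
  "CycA i j \<in> cycle_edge g k l \<longleftrightarrow> i = l \<and> j \<in> {1..k - 2}"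
  by (auto simp: cycle_edge_def)

lemma star_hypercycle:
  assumes "2 \<le> g" and i: "i \<in> {1..g}"
  shows "star (hypercycle g k) (CycV i) = {cycle_edge g k i, cycle_edge g k (if i = 1 then g else i - 1)}"
    "j \<in> {1..k - 2} \<Longrightarrow> star (hypercycle g k) (CycA i j) = {cycle_edge g k i}"
proof -
  have "{l \<in> {1..g}. CycV i \<in> cycle_edge g k l} = {i, if i = 1 then g else i - 1}"
    using assms by auto
  moreover have "star (hypercycle g k) z = cycle_edge g k ` {l \<in> {1..g}. z \<in> cycle_edge g k l}" for z
    by (auto simp: star_def hypercycle_def)
  ultimately show "star (hypercycle g k) (CycV i) = {cycle_edge g k i, cycle_edge g k (if i = 1 then g else i - 1)}"
    by simp
  assume "j \<in> {1..k - 2}"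
  then show "star (hypercycle g k) (CycA i j) = {cycle_edge g k i}"
    using i by (auto simp: star_def hypercycle_def)
qed

lemma inj_cycle_edge:
  assumes "3 \<le> k"
  shows "inj_on (cycle_edge g k) A"
proof (rule inj_onI)
  fix i l assume "cycle_edge g k i = cycle_edge g k l"
  moreover have "CycA i 1 \<in> cycle_edge g k i" using assms by simp
  ultimately have "CycA i 1 \<in> cycle_edge g k l" by simp
  then show "i = l" by simp
qed

lemma deg_hypercycle:
  assumes "2 \<le> g" "3 \<le> k" and i: "i \<in> {1..g}"
  shows "deg (hypercycle g k) (CycV i) = 2"
    "j \<in> {1..k - 2} \<Longrightarrow> deg (hypercycle g k) (CycA i j) = 1"
proof -
  let ?p = "if i = 1 then g else i - 1"
  have "i \<noteq> ?p" using assms(1) i by auto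
  then have "cycle_edge g k i \<noteq> cycle_edge g k ?p"
    using inj_onD[OF inj_cycle_edge[OF assms(2)], of g i ?p UNIV] by auto
  then show "deg (hypercycle g k) (CycV i) = 2"
    by (simp only: deg_def star_hypercycle(1)[OF assms(1) i] card_2_iff) blast
  show "deg (hypercycle g k) (CycA i j) = 1" if "j \<in> {1..k - 2}"
    by (simp add: deg_def star_hypercycle(2)[OF assms(1) i that])
qed

lemma hypercycle_cycle_like:
  assumes g: "2 \<le> g" and k: "3 \<le> k"
  shows "cycle_like k (hypercycle g k)" "card (edges (hypercycle g k)) = g"
proof -
  let ?C = "hypercycle g k" and ?e = "cycle_edge g k"
  let ?n = "\<lambda>i. if i = g then 1 else i + 1"
  have E: "edges ?C = ?e ` {1..g}" by (simp add: hypercycle_def)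
  have V: "verts ?C = CycV ` {1..g} \<union> case_prod CycA ` ({1..g} \<times> {1..k - 2})"
    by (auto simp: hypercycle_def)
  have sub: "?e i \<subseteq> verts ?C" if "i \<in> {1..g}" for i
    using that g by (auto simp: V cycle_edge_def)
  have n: "?n i \<in> {1..g}" "?n i \<noteq> i" if "i \<in> {1..g}" for i using that g by auto
  have ce: "card (?e i) = k" if i: "i \<in> {1..g}" for i
  proof -
    have "card (?e i) = card {CycV i, CycV (?n i)} + card (CycA i ` {1..k - 2})"
      unfolding cycle_edge_def by (rule card_Un_disjoint) auto
    also have "card (CycA i ` {1..k - 2}) = k - 2" by (subst card_image) (auto simp: inj_on_def)
    also have "card {CycV i, CycV (?n i)} = 2" using n(2)[OF i] by auto
    finally show ?thesis using k by simp
  qed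
  have H: "k_hypergraph k ?C"
    unfolding k_hypergraph_def hypergraph_def uniform_def
  proof (intro conjI ballI)
    show "finite (verts ?C)" unfolding V by simp
    show "verts ?C \<noteq> {}" unfolding V using g by auto
    fix e assume "e \<in> edges ?C"
    then obtain i where i: "i \<in> {1..g}" "e = ?e i" unfolding E by blast
    show "e \<subseteq> verts ?C" "card e = k" "2 \<le> card e" using sub[OF i(1)] ce[OF i(1)] k i(2) by simp_all
  qed (rule k)
  have con: "cut_connected ?C"
    unfolding cut_connected_def
  proof (intro allI impI)
    fix U assume U: "U \<subseteq> verts ?C" "U \<noteq> {}" and cl0: "\<forall>e\<in>edges ?C. e \<inter> U \<noteq> {} \<longrightarrow> e \<subseteq> U"
    have cl: "?e i \<subseteq> U" if "z \<in> ?e i" "z \<in> U" "i \<in> {1..g}" for i z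
    proof -
      have "?e i \<in> edges ?C" using that(3) E by blast
      then show ?thesis using cl0 that(1,2) by blast
    qed
    have step: "CycV (?n i) \<in> U" if "CycV i \<in> U" "i \<in> {1..g}" for i
      using cl[of "CycV i" i] that by auto
    obtain z where z: "z \<in> U" using U(2) by blast
    then have "z \<in> verts ?C" using U(1) by blast
    then obtain i where i: "i \<in> {1..g}" "z \<in> ?e i" unfolding V by auto
    then have i0: "CycV i \<in> U" using cl[OF i(2) z i(1)] by auto
    have up: "CycV (l + d) \<in> U" if "CycV l \<in> U" "1 \<le> l" "l + d \<le> g" for l d
      using that
    proof (induction d)
      case (Suc d)
      then have "CycV (l + d) \<in> U" "l + d \<in> {1..g}" "l + d \<noteq> g" by auto
      then show ?case using step[of "l + d"] by simp
    qed simp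
    have "CycV g \<in> U" using up[OF i0, of "g - i"] i(1) by simp
    then have "CycV 1 \<in> U" using step[of g] g by auto
    then have all: "CycV l \<in> U" if "l \<in> {1..g}" for l
      using up[of 1 "l - 1"] that by simp
    have "?e l \<subseteq> U" if "l \<in> {1..g}" for l using cl[of "CycV l" l] all that by simp
    moreover have "verts ?C \<subseteq> (\<Union>l\<in>{1..g}. ?e l)" unfolding V by auto
    ultimately show "U = verts ?C" using U(1) by blast
  qed
  have d: "deg ?C v = 1 \<or> deg ?C v = 2" if "v \<in> verts ?C" for v
    using that deg_hypercycle[OF g k] unfolding V by auto
  have "{v \<in> ?e i. deg ?C v = 2} = {CycV i, CycV (?n i)}" if i: "i \<in> {1..g}" for i
    using deg_hypercycle(1)[OF g k i] deg_hypercycle(1)[OF g k n(1)[OF i]] deg_hypercycle(2)[OF g k i]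
    unfolding cycle_edge_def by auto
  then have "card {v \<in> ?e i. deg ?C v = 2} = 2" if i: "i \<in> {1..g}" for i
    using n(2)[OF i] i by auto
  then have "\<forall>e\<in>edges ?C. card {v \<in> e. deg ?C v = 2} = 2" unfolding E by blast
  then show "cycle_like k ?C" using H con d by (simp add: cycle_like_def)
  show "card (edges ?C) = g" unfolding E by (simp add: card_image[OF inj_cycle_edge[OF k]])
qed

section \<open>Pendant edges\<close>

definition add_pendant :: "'a hypergraph \<Rightarrow> 'a \<Rightarrow> 'a set \<Rightarrow> 'a hypergraph" where
  "add_pendant C u P = \<lparr> verts = verts C \<union> P, edges = insert (insert u P) (edges C) \<rparr>"

definition pendant :: "nat \<Rightarrow> 'a hypergraph \<Rightarrow> 'a \<Rightarrow> 'a set \<Rightarrow> bool" where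
  "pendant k C u P \<longleftrightarrow> k_hypergraph k C \<and> u \<in> verts C \<and> P \<inter> verts C = {} \<and> finite P \<and> card P = k - 1"

lemma add_pendant_simps [simp]:
  "verts (add_pendant C u P) = verts C \<union> P"
  "edges (add_pendant C u P) = insert (insert u P) (edges C)"
  by (simp_all add: add_pendant_def)

lemma pendantD:
  assumes "pendant k C u P"
  shows "k_hypergraph k C" "u \<in> verts C" "P \<inter> verts C = {}" "finite P" "card P = k - 1" "3 \<le> k"
    "P \<noteq> {}" "u \<notin> P" "insert u P \<notin> edges C"
    "\<And>e. e \<in> edges C \<Longrightarrow> e \<inter> P = {}"
proof -
  show 1: "k_hypergraph k C" "u \<in> verts C" "P \<inter> verts C = {}" "finite P" "card P = k - 1"
    using assms by (auto simp: pendant_def)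
  show k: "3 \<le> k" by (rule k_hypergraphD(1)[OF 1(1)])
  show ne: "P \<noteq> {}" using 1(5) k by auto
  show "u \<notin> P" using 1 by blast
  show dis: "e \<inter> P = {}" if "e \<in> edges C" for e using k_hypergraphD(6)[OF 1(1) that] 1(3) by blast
  show "insert u P \<notin> edges C" using dis[of "insert u P"] ne by blast
qed

lemma add_pendant_k_hypergraph:
  assumes "pendant k C u P"
  shows "k_hypergraph k (add_pendant C u P)"
proof -
  note p = pendantD[OF assms] and D = k_hypergraphD[OF pendantD(1)[OF assms]]
  have "card (insert u P) = k" using p(4,5,6,8) by simp
  then show ?thesis using D p(2,4,6) unfolding k_hypergraph_def hypergraph_def uniform_def by auto
qed

lemma star_add_pendant:
  assumes "pendant k C u P"
  shows "v \<in> verts C \<Longrightarrow> v \<noteq> u \<Longrightarrow> star (add_pendant C u P) v = star C v"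
    "star (add_pendant C u P) u = insert (insert u P) (star C u)"
    "v \<in> P \<Longrightarrow> star (add_pendant C u P) v = {insert u P}"
  using pendantD(3,10)[OF assms] by (auto simp: star_def)

lemma deg_add_pendant:
  assumes "pendant k C u P"
  shows "v \<in> verts C \<Longrightarrow> deg (add_pendant C u P) v = deg C v + (if v = u then 1 else 0)"
    "v \<in> P \<Longrightarrow> deg (add_pendant C u P) v = 1"
proof -
  note p = pendantD[OF assms]
  have "insert u P \<notin> star C u" using p(9) by (simp add: star_def)
  then show "deg (add_pendant C u P) v = deg C v + (if v = u then 1 else 0)" if "v \<in> verts C"
    using star_add_pendant(1)[OF assms that] star_add_pendant(2)[OF assms] k_hypergraphD(9)[OF p(1)]
    by (auto simp: deg_def)
  show "deg (add_pendant C u P) v = 1" if "v \<in> P"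
    using star_add_pendant(3)[OF assms that] by (simp add: deg_def)
qed

lemma add_pendant_connected:
  assumes p0: "pendant k C u P" and con: "cut_connected C"
  shows "cut_connected (add_pendant C u P)"
  unfolding cut_connected_def
proof (intro allI impI)
  note p = pendantD[OF p0] and D = k_hypergraphD[OF pendantD(1)[OF p0]]
  fix U assume U: "U \<subseteq> verts (add_pendant C u P)" "U \<noteq> {}"
    "\<forall>e\<in>edges (add_pendant C u P). e \<inter> U \<noteq> {} \<longrightarrow> e \<subseteq> U"
  have pU: "insert u P \<inter> U \<noteq> {} \<longrightarrow> insert u P \<subseteq> U" using U(3) by simp
  have "U \<inter> verts C = verts C"
  proof (rule cut_connectedD[OF con])
    show "U \<inter> verts C \<noteq> {}" using U(1,2) pU p(2) by auto
    show "e \<subseteq> U \<inter> verts C" if "e \<in> edges C" "e \<inter> (U \<inter> verts C) \<noteq> {}" for e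
      using U(3) that D(6)[OF that(1)] by fastforce
  qed simp
  then show "U = verts (add_pendant C u P)" using U(1) pU p(2) by auto
qed

lemma add_pendant_cut_unicyclic:
  assumes p0: "pendant k C u P" and C: "cut_unicyclic k C"
  shows "cut_unicyclic k (add_pendant C u P)"
proof -
  note p = pendantD[OF p0] and D = k_hypergraphD[OF pendantD(1)[OF p0]]
  have "card (verts C \<union> P) = card (verts C) + (k - 1)"
    using p(3,4,5) D(3) by (subst card_Un_disjoint) auto
  moreover have "card (insert (insert u P) (edges C)) = Suc (card (edges C))"
    using p(9) D(5) by simp
  ultimately show ?thesis
    using C add_pendant_k_hypergraph[OF p0] add_pendant_connected[OF p0] by (simp add: cut_unicyclic_def)
qed

text \<open>Only \<open>u\<close> can have degree \<open>2\<close> in the new edge.\<close>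

lemma add_pendant_not_cycle_like:
  assumes p0: "pendant k C u P"
  shows "\<not> cycle_like k (add_pendant C u P)"
proof
  assume "cycle_like k (add_pendant C u P)"
  then have "card {v \<in> insert u P. deg (add_pendant C u P) v = 2} = 2"
    by (simp add: cycle_like_def)
  moreover have "{v \<in> insert u P. deg (add_pendant C u P) v = 2} \<subseteq> {u}"
    using deg_add_pendant(2)[OF p0] by auto
  then have "card {v \<in> insert u P. deg (add_pendant C u P) v = 2} \<le> card {u}"
    by (intro card_mono) auto
  ultimately show False by simp
qed

lemma add_pendant_scaled_rho_gt:
  assumes "pendant k C u P" "cut_unicyclic k C"
  shows "cycle_value k < scaled_rho k (add_pendant C u P)"
  using cut_unicyclic_scaled_rho[OF add_pendant_cut_unicyclic[OF assms]] add_pendant_not_cycle_like[OF assms(1)] by linarith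

text \<open>The Perron vector of \<open>C\<close>, extended by zero, is a subsolution. It is no eigenvector, since those have no zeros on
a connected hypergraph.\<close>

lemma scaled_rho_lt_add_pendant:
  assumes p0: "pendant k C u P" and con: "cut_connected C"
  shows "scaled_rho k C < scaled_rho k (add_pendant C u P)"
proof -
  note p = pendantD[OF p0] and D = k_hypergraphD[OF pendantD(1)[OF p0]]
  let ?D = "add_pendant C u P"
  have H: "k_hypergraph k ?D" by (rule add_pendant_k_hypergraph[OF p0])
  obtain x where x0: "\<And>v. 0 \<le> x v" and nz: "\<exists>v\<in>verts C. x v \<noteq> 0"
    and ev: "eigenvector_for C (scaled_rho k C) x"
    using perron_vector[OF p(1)] by blast
  define y where "y v = (if v \<in> verts C then x v else 0)" for v
  have ye: "sum y e = sum x e" if "e \<in> edges C" for e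
    by (intro sum.cong refl) (use that D(6) in \<open>auto simp: y_def\<close>)
  have yp: "sum y (insert u P) = x u"
  proof -
    have "sum y P = 0" by (intro sum.neutral) (use p(3) in \<open>auto simp: y_def\<close>)
    then show ?thesis using p(2,4,8) by (simp add: y_def)
  qed
  have ystar: "(\<Sum>e\<in>star C v. sum y e) = (\<Sum>e\<in>star C v. sum x e)" for v
    by (intro sum.cong refl ye) (simp add: star_def)
  have sub: "(scaled_rho k C + deg ?D v) * y v \<le> (\<Sum>e\<in>star ?D v. sum y e)" if v: "v \<in> verts ?D" for v
  proof (cases "v \<in> verts C")
    case True
    have e: "(\<Sum>e\<in>star C v. sum y e) = (scaled_rho k C + deg C v) * x v"
      using ev True unfolding ystar eigenvector_for_def by blast
    show ?thesis
    proof (cases "v = u")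
      case False
      then show ?thesis using e True star_add_pendant(1)[OF p0 True False] deg_add_pendant(1)[OF p0 True]
        by (simp add: y_def)
    next
      case True
      have "insert u P \<notin> star C u" using p(9) by (simp add: star_def)
      then have "(\<Sum>e\<in>star ?D u. sum y e) = x u + (\<Sum>e\<in>star C u. sum y e)"
        unfolding star_add_pendant(2)[OF p0] using D(9) yp by simp
      then show ?thesis using e True p(2) deg_add_pendant(1)[OF p0 p(2)]
        by (simp add: y_def algebra_simps)
    qed
  next
    case False
    then show ?thesis using v star_add_pendant(3)[OF p0, of v] yp x0 by (simp add: y_def)
  qed
  have y0: "0 \<le> y v" for v using x0 by (simp add: y_def)
  have nzy: "\<exists>v\<in>verts ?D. y v \<noteq> 0" using nz by (auto simp: y_def)
  have bound: "scaled_rho k C \<le> scaled_rho k ?D"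
    by (rule scaled_rho_ge_subsolution(1)[OF H y0 nzy]) (rule sub)
  have "scaled_rho k C \<noteq> scaled_rho k ?D"
  proof
    assume eq: "scaled_rho k C = scaled_rho k ?D"
    have ev': "eigenvector_for ?D (scaled_rho k C) y"
      by (rule scaled_rho_ge_subsolution(2)[OF H y0 nzy _ eq]) (rule sub)
    obtain v where v: "v \<in> P" using p(7) by blast
    have "0 < y v"
      by (rule nonneg_eigenvector_positive[OF H add_pendant_connected[OF p0 con] y0 nzy ev']) (use v in simp)
    then show False using v p(3) by (auto simp: y_def split: if_splits)
  qed
  with bound show ?thesis by linarith
qed

lemma add_pendant_weighted_sums:
  fixes x :: "'a \<Rightarrow> real" and \<mu> :: real
  assumes p0: "pendant k C u P"
  shows "(\<Sum>e\<in>edges (add_pendant C u P). (sum x e)\<^sup>2) = (x u + sum x P)\<^sup>2 + (\<Sum>e\<in>edges C. (sum x e)\<^sup>2)"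
    "(\<Sum>v\<in>verts (add_pendant C u P). (\<mu> + deg (add_pendant C u P) v) * (x v)\<^sup>2)
      = (\<Sum>v\<in>verts C. deg C v * (x v)\<^sup>2) + (x u)\<^sup>2 + (\<Sum>v\<in>P. (x v)\<^sup>2)
        + \<mu> * (\<Sum>v\<in>verts C \<union> P. (x v)\<^sup>2)"
proof -
  note p = pendantD[OF p0] and D = k_hypergraphD[OF pendantD(1)[OF p0]]
  show "(\<Sum>e\<in>edges (add_pendant C u P). (sum x e)\<^sup>2) = (x u + sum x P)\<^sup>2 + (\<Sum>e\<in>edges C. (sum x e)\<^sup>2)"
    using p(4,8,9) D(5) by simp
  let ?d = "\<lambda>v. real (deg (add_pendant C u P) v)"
  have "(\<Sum>v\<in>verts C \<union> P. ?d v * (x v)\<^sup>2) = (\<Sum>v\<in>verts C. ?d v * (x v)\<^sup>2) + (\<Sum>v\<in>P. ?d v * (x v)\<^sup>2)"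
    using p(3,4) D(3) by (intro sum.union_disjoint) auto
  also have "(\<Sum>v\<in>P. ?d v * (x v)\<^sup>2) = (\<Sum>v\<in>P. (x v)\<^sup>2)"
    by (intro sum.cong refl) (simp add: deg_add_pendant(2)[OF p0])
  also have "(\<Sum>v\<in>verts C. ?d v * (x v)\<^sup>2)
      = (\<Sum>v\<in>verts C. deg C v * (x v)\<^sup>2 + (if v = u then (x v)\<^sup>2 else 0))"
    by (intro sum.cong refl) (simp add: deg_add_pendant(1)[OF p0] distrib_right)
  also have "\<dots> = (\<Sum>v\<in>verts C. deg C v * (x v)\<^sup>2) + (x u)\<^sup>2"
    using p(2) D(3) by (simp add: sum.distrib)
  finally have "(\<Sum>v\<in>verts C \<union> P. ?d v * (x v)\<^sup>2)
      = (\<Sum>v\<in>verts C. deg C v * (x v)\<^sup>2) + (x u)\<^sup>2 + (\<Sum>v\<in>P. (x v)\<^sup>2)" .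
  then show "(\<Sum>v\<in>verts (add_pendant C u P). (\<mu> + deg (add_pendant C u P) v) * (x v)\<^sup>2)
      = (\<Sum>v\<in>verts C. deg C v * (x v)\<^sup>2) + (x u)\<^sup>2 + (\<Sum>v\<in>P. (x v)\<^sup>2)
        + \<mu> * (\<Sum>v\<in>verts C \<union> P. (x v)\<^sup>2)"
    unfolding distrib_right sum.distrib sum_distrib_left by simp
qed

lemma positive_perron_vector:
  assumes "k_hypergraph k G" "cut_connected G"
  shows "\<exists>x. (\<forall>v\<in>verts G. 0 < x v) \<and> eigenvector_for G (scaled_rho k G) x"
proof -
  obtain x where x: "\<And>v. 0 \<le> x v" "\<exists>v\<in>verts G. x v \<noteq> 0" "eigenvector_for G (scaled_rho k G) x"
    using perron_vector[OF assms(1)] by blast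
  then show ?thesis using nonneg_eigenvector_positive[OF assms x] by blast
qed

text \<open>Moving the pendant edge from \<open>u\<close> to \<open>w\<close> increases the Rayleigh quotient of \<open>x\<close> by a positive multiple of
\<open>x\<^sub>w - x\<^sub>u\<close>. In case of equality \<open>x\<close> would still be an eigenvector, but the equation at \<open>u\<close> has lost the
positive contribution of \<open>P\<close>.\<close>

lemma scaled_rho_lt_move_pendant:
  fixes x :: "'a \<Rightarrow> real"
  assumes pu: "pendant k C u P" and pw: "pendant k C w P" and ne: "u \<noteq> w"
    and pos: "\<And>v. v \<in> verts (add_pendant C u P) \<Longrightarrow> 0 < x v"
    and ev: "eigenvector_for (add_pendant C u P) (scaled_rho k (add_pendant C u P)) x"
    and le: "x u \<le> x w"
  shows "scaled_rho k (add_pendant C u P) < scaled_rho k (add_pendant C w P)"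
proof -
  let ?D = "add_pendant C u P" and ?F = "add_pendant C w P"
  note p = pendantD[OF pu] and D = k_hypergraphD[OF pendantD(1)[OF pu]]
  have HD: "k_hypergraph k ?D" by (rule add_pendant_k_hypergraph[OF pu])
  have HF: "k_hypergraph k ?F" by (rule add_pendant_k_hypergraph[OF pw])
  define s where "s = sum x P"
  have s: "0 < s" unfolding s_def
    by (rule sum_pos[OF p(4,7)]) (use pos in simp)
  let ?n = "\<Sum>v\<in>verts C \<union> P. (x v)\<^sup>2"
  have n: "0 < ?n"
    by (rule sum_pos2[of _ u]) (use p(2,4) D(3) pos[of u] in auto)
  have "(\<Sum>v\<in>verts ?D. x v * (\<Sum>e\<in>star ?D v. sum x e)) = (\<Sum>v\<in>verts ?D. (scaled_rho k ?D + deg ?D v) * (x v)\<^sup>2)"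
    using ev unfolding eigenvector_for_def by (intro sum.cong refl) (simp add: power2_eq_square)
  then have "(\<Sum>e\<in>edges ?D. (sum x e)\<^sup>2) = (\<Sum>v\<in>verts ?D. (scaled_rho k ?D + deg ?D v) * (x v)\<^sup>2)"
    unfolding edge_sum_bilinear[OF HD] by (simp only: power2_eq_square)
  then have 1: "(x u + s)\<^sup>2 + (\<Sum>e\<in>edges C. (sum x e)\<^sup>2) = (\<Sum>v\<in>verts C. deg C v * (x v)\<^sup>2) + (x u)\<^sup>2
      + (\<Sum>v\<in>P. (x v)\<^sup>2) + scaled_rho k ?D * ?n"
    unfolding add_pendant_weighted_sums[OF pu] s_def .
  have sq: "(x u + s)\<^sup>2 = (x u)\<^sup>2 + s\<^sup>2 + 2 * (s * x u)" "(x w + s)\<^sup>2 = (x w)\<^sup>2 + s\<^sup>2 + 2 * (s * x w)"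
    by (simp_all add: power2_eq_square algebra_simps)
  have 2: "(\<Sum>e\<in>edges ?F. (sum x e)\<^sup>2) = (\<Sum>v\<in>verts ?F. (scaled_rho k ?F + deg ?F v) * (x v)\<^sup>2)
      + 2 * (s * (x w - x u)) - (scaled_rho k ?F - scaled_rho k ?D) * ?n"
    using 1 unfolding add_pendant_weighted_sums[OF pw] s_def[symmetric] sq
    by (simp add: algebra_simps)
  have ge: "0 \<le> s * (x w - x u)" using s le by simp
  have le2: "2 * (s * (x w - x u)) \<le> (scaled_rho k ?F - scaled_rho k ?D) * ?n"
    using 2 rayleigh_bound[OF HF, of x] by linarith
  then have "0 \<le> (scaled_rho k ?F - scaled_rho k ?D) * ?n" using ge by linarith
  then have "scaled_rho k ?D \<le> scaled_rho k ?F" using n by (simp add: zero_le_mult_iff)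
  moreover have "scaled_rho k ?D \<noteq> scaled_rho k ?F"
  proof
    assume eq: "scaled_rho k ?D = scaled_rho k ?F"
    then have "s * (x w - x u) = 0" using le2 ge by simp
    then have evF: "eigenvector_for ?F (scaled_rho k ?F) x"
      using 2 eq by (intro rayleigh_equality[OF HF]) simp
    have uV: "u \<in> verts ?F" "u \<in> verts ?D" using p(2) by simp_all
    have "(\<Sum>e\<in>star C u. sum x e) = (scaled_rho k ?F + deg C u) * x u"
      using bspec[OF evF[unfolded eigenvector_for_def] uV(1)]
      unfolding star_add_pendant(1)[OF pw p(2) ne] deg_add_pendant(1)[OF pw p(2)] using ne by simp
    moreover have "(\<Sum>e\<in>star ?D u. sum x e) = (scaled_rho k ?D + deg C u + 1) * x u"
      using bspec[OF ev[unfolded eigenvector_for_def] uV(2)]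
      unfolding deg_add_pendant(1)[OF pu p(2)] by simp
    moreover have "(\<Sum>e\<in>star ?D u. sum x e) = x u + s + (\<Sum>e\<in>star C u. sum x e)"
    proof -
      have "insert u P \<notin> star C u" using p(9) by (simp add: star_def)
      then show ?thesis unfolding star_add_pendant(2)[OF pu] s_def using D(9) p(4,8) by simp
    qed
    ultimately show False using s eq by (simp add: algebra_simps)
  qed
  ultimately show ?thesis by linarith
qed

text \<open>At \<open>\<Lambda> = L\<close> the two sides differ by \<open>2 L + 1\<close>, since \<open>L^2 = (k - 1) (L + 2)\<close>. This is the numerical input for
\<open>pendant_at_joint_scaled_rho_gt\<close>.\<close>

lemma above_cycle_value:
  assumes "3 \<le> k" "cycle_value k \<le> \<Lambda>"
  shows "\<Lambda> + 1 < (\<Lambda> + 2 - real k) * (\<Lambda> + 2)" "0 < \<Lambda>"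
proof -
  note L = cycle_value_equation[OF assms(1)]
  let ?L = "cycle_value k"
  show pos: "0 < \<Lambda>" using L(1) assms(2) by linarith
  have "?L * ?L \<ge> (real k - 1) * ?L" using L(2) assms(1) by (simp add: power2_eq_square algebra_simps)
  then have "?L \<ge> real k - 1" using L(1) by simp
  then have "0 \<le> (\<Lambda> - ?L) * (\<Lambda> + ?L - (real k - 1))"
    using assms(2) pos by (intro mult_nonneg_nonneg) linarith+
  also have "\<dots> = (\<Lambda> * \<Lambda> - (real k - 1) * (\<Lambda> + 2)) - (?L\<^sup>2 - (real k - 1) * (?L + 2))"
    by (simp add: power2_eq_square algebra_simps)
  finally have "(real k - 1) * (\<Lambda> + 2) \<le> \<Lambda> * \<Lambda>" using L(2) by simp
  moreover have "(\<Lambda> + 2 - real k) * (\<Lambda> + 2) = (\<Lambda> * \<Lambda> - (real k - 1) * (\<Lambda> + 2)) + 3 * \<Lambda> + 2"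
    by (simp add: algebra_simps)
  ultimately show "\<Lambda> + 1 < (\<Lambda> + 2 - real k) * (\<Lambda> + 2)" using pos by linarith
qed

text \<open>Let \<open>e\<close> and \<open>e'\<close> be the edges at the joint \<open>w\<close>, and let \<open>u\<close> be a vertex of degree \<open>1\<close> in \<open>e\<close>. Attach \<open>P\<close> at \<open>u\<close>
instead of \<open>w\<close>, obtaining the edge \<open>p\<close>. By \<open>scaled_rho_lt_move_pendant\<close> it is enough that the new Perron
vector satisfies \<open>x\<^sub>u \<le> x\<^sub>w\<close>. The equations at \<open>u\<close> and \<open>w\<close> give \<open>(\<Lambda> + 2) (x\<^sub>u - x\<^sub>w) = S\<^sub>p - S\<^sub>e'\<close>. On \<open>p\<close> all
other vertices have degree \<open>1\<close>, so \<open>(\<Lambda> + 1) x\<^sub>u = (\<Lambda> + 2 - k) S\<^sub>p\<close>. On \<open>e'\<close> every vertex \<open>y\<close> satisfies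
\<open>S\<^sub>e' \<le> (\<Lambda> + 1) x\<^sub>y\<close>, which gives \<open>(\<Lambda> + 1) x\<^sub>w \<le> (\<Lambda> + 2 - k) S\<^sub>e'\<close>. If \<open>x\<^sub>u > x\<^sub>w\<close>, these three relations
contradict \<open>\<Lambda> + 1 < (\<Lambda> + 2 - k) (\<Lambda> + 2)\<close>.\<close>

lemma pendant_at_joint_scaled_rho_gt:
  assumes C: "cycle_like k C" and pw: "pendant k C w P" and w2: "deg C w = 2"
  obtains u where "u \<in> verts C" "deg C u = 1" "scaled_rho k (add_pendant C u P) < scaled_rho k (add_pendant C w P)"
proof -
  note p = pendantD[OF pw] and D = k_hypergraphD[OF pendantD(1)[OF pw]]
  have con: "cut_connected C" using C by (simp add: cycle_like_def)
  have "card (star C w) = 2" using w2 by (simp add: deg_def)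
  then obtain e e' where st: "star C w = {e, e'}" "e \<noteq> e'" by (auto simp: card_2_iff)
  have e: "e \<in> edges C" "w \<in> e" "e' \<in> edges C" "w \<in> e'" using st(1) by (auto simp: star_def)
  have "\<not> e \<subseteq> {z \<in> e. deg C z = 2}"
  proof
    assume "e \<subseteq> {z \<in> e. deg C z = 2}"
    then have "{z \<in> e. deg C z = 2} = e" by blast
    moreover have "card {z \<in> e. deg C z = 2} = 2" using C e(1) by (simp add: cycle_like_def)
    ultimately show False using D(1,7) e(1) by auto
  qed
  then obtain u where u: "u \<in> e" "deg C u \<noteq> 2" by blast
  have uV: "u \<in> verts C" using D(6) e(1) u(1) by blast
  then have u1: "deg C u = 1" using C u(2) by (auto simp: cycle_like_def)
  have une: "u \<noteq> w" using w2 u1 by auto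
  have pu: "pendant k C u P" using pw uV by (simp add: pendant_def)
  let ?D = "add_pendant C u P" and ?p = "insert u P"
  define \<Lambda> where "\<Lambda> = scaled_rho k ?D"
  have H: "k_hypergraph k ?D" by (rule add_pendant_k_hypergraph[OF pu])
  have conD: "cut_connected ?D" by (rule add_pendant_connected[OF pu con])
  obtain x where pos: "\<And>v. v \<in> verts ?D \<Longrightarrow> 0 < x v" and ev: "eigenvector_for ?D \<Lambda> x"
    using positive_perron_vector[OF H conD] unfolding \<Lambda>_def by blast
  have eig: "(\<Sum>e\<in>star ?D v. sum x e) = (\<Lambda> + deg ?D v) * x v" if "v \<in> verts ?D" for v
    using ev that unfolding eigenvector_for_def by blast
  have \<Lambda>: "\<Lambda> + 1 < (\<Lambda> + 2 - real k) * (\<Lambda> + 2)" "0 < \<Lambda>"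
    using above_cycle_value[OF D(1), of \<Lambda>] add_pendant_scaled_rho_gt[OF pu cycle_like_imp_cut_unicyclic[OF C]]
    unfolding \<Lambda>_def by auto
  have "star C u = {e}"
  proof -
    obtain c where "star C u = {c}" using u1 by (auto simp: deg_def card_1_singleton_iff)
    moreover have "e \<in> star C u" using u(1) e(1) by (simp add: star_def)
    ultimately show ?thesis by simp
  qed
  then have "star ?D u = {?p, e}" using star_add_pendant(2)[OF pu] by simp
  moreover have "?p \<noteq> e" using pendantD(9)[OF pu] e(1) by blast
  ultimately have xu: "sum x ?p + sum x e = (\<Lambda> + 2) * x u"
    using eig[of u] uV deg_add_pendant(1)[OF pu uV] u1 by simp
  have xw: "sum x e + sum x e' = (\<Lambda> + 2) * x w"
    using eig[of w] p(2) une st deg_add_pendant(1)[OF pu p(2)] star_add_pendant(1)[OF pu p(2)] w2 by auto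
  have xP: "(\<Lambda> + 1) * x v = sum x ?p" if "v \<in> P" for v
    using eig[of v] that star_add_pendant(3)[OF pu that] deg_add_pendant(2)[OF pu that] by simp
  have k1: "real (k - 1) = real k - 1" using D(1) by (simp add: of_nat_diff)
  have Sp: "(\<Lambda> + 1) * x u = (\<Lambda> + 2 - real k) * sum x ?p"
  proof -
    have "(\<Lambda> + 1) * sum x P = (\<Sum>v\<in>P. (\<Lambda> + 1) * x v)" by (rule sum_distrib_left)
    also have "\<dots> = (real k - 1) * sum x ?p" using xP p(5) k1 by simp
    finally have "(\<Lambda> + 1) * (sum x ?p - x u) = (real k - 1) * sum x ?p"
      using pendantD(4,8)[OF pu] by simp
    then show ?thesis by (simp add: algebra_simps)
  qed
  have xe': "sum x e' \<le> (\<Lambda> + 1) * x y" if y: "y \<in> e'" for y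
  proof -
    have yV: "y \<in> verts ?D" using y D(6) e(3) by auto
    have "e' \<in> star ?D y" using y e(3) by (simp add: star_def)
    then have "(\<Sum>f\<in>star ?D y. sum x f) = sum x e' + (\<Sum>f\<in>star ?D y - {e'}. sum x f)"
      by (rule sum.remove[OF k_hypergraphD(9)[OF H]])
    moreover have "(\<Sum>f\<in>star ?D y - {e'}. x y) \<le> (\<Sum>f\<in>star ?D y - {e'}. sum x f)"
    proof (rule sum_mono)
      fix f assume "f \<in> star ?D y - {e'}"
      then have f: "f \<in> edges ?D" "y \<in> f" by (auto simp: star_def)
      show "x y \<le> sum x f"
      proof (rule member_le_sum[OF f(2) _ k_hypergraphD(8)[OF H f(1)]])
        fix z assume "z \<in> f - {y}"
        then have "z \<in> verts ?D" using k_hypergraphD(6)[OF H f(1)] by blast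
        then show "0 \<le> x z" using pos[of z] by linarith
      qed
    qed
    moreover have "(\<Sum>f\<in>star ?D y - {e'}. x y) = (real (deg ?D y) - 1) * x y"
      using \<open>e' \<in> star ?D y\<close> k_hypergraphD(9)[OF H, of y] card_gt_0_iff[of "star ?D y"]
      by (auto simp: deg_def of_nat_diff Suc_le_eq)
    ultimately show ?thesis using eig[OF yV] by (simp add: algebra_simps)
  qed
  have Se': "(\<Lambda> + 1) * x w \<le> (\<Lambda> + 2 - real k) * sum x e'"
  proof -
    have fin: "finite e'" using D(8) e(3) by blast
    have "(real k - 1) * sum x e' = (\<Sum>y\<in>e' - {w}. sum x e')"
      using fin e(3,4) D(7) k1 by simp
    also have "\<dots> \<le> (\<Sum>y\<in>e' - {w}. (\<Lambda> + 1) * x y)" by (intro sum_mono xe') auto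
    also have "\<dots> = (\<Lambda> + 1) * (sum x e' - x w)"
      using fin e(4) by (simp add: sum_diff1 flip: sum_distrib_left)
    finally show ?thesis by (simp add: algebra_simps)
  qed
  have "x u \<le> x w"
  proof (rule ccontr)
    assume "\<not> x u \<le> x w"
    then have d: "0 < x u - x w" by simp
    have "(\<Lambda> + 2) * (x u - x w) = sum x ?p - sum x e'"
      using xu xw by (simp add: right_diff_distrib)
    then have "(\<Lambda> + 2 - real k) * (\<Lambda> + 2) * (x u - x w) = (\<Lambda> + 2 - real k) * (sum x ?p - sum x e')"
      by (simp only: mult.assoc)
    also have "\<dots> \<le> (\<Lambda> + 1) * (x u - x w)" using Sp Se' by (simp add: algebra_simps)
    finally show False using \<Lambda>(1) d by simp
  qed
  then have "scaled_rho k ?D < scaled_rho k (add_pendant C w P)"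
    by (intro scaled_rho_lt_move_pendant[OF pu pw une pos]) (use ev in \<open>auto simp: \<Lambda>_def\<close>)
  then show thesis using that uV u1 by blast
qed

lemma add_pendant_iso:
  assumes f: "iso_via f C C'" and C: "pendant k C u P" and C': "pendant k C' (f u) Q"
  shows "hypergraph_iso (add_pendant C u P) (add_pendant C' (f u) Q)"
proof -
  note p = pendantD[OF C] and q = pendantD[OF C'] and D = k_hypergraphD[OF pendantD(1)[OF C]]
  obtain h where h: "bij_betw h P Q" using finite_same_card_bij[OF p(4) q(4)] p(5) q(5) by auto
  define F where "F v = (if v \<in> P then h v else f v)" for v
  have b: "bij_betw f (verts C) (verts C')" and be: "bij_betw ((`) f) (edges C) (edges C')"
    using f by (auto simp: iso_via_def)
  have Fe: "F ` e = f ` e" if "e \<in> edges C" for e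
    by (intro image_cong refl) (use p(10)[OF that] in \<open>auto simp: F_def\<close>)
  have FP: "F ` insert u P = insert (f u) Q"
    using h p(8) by (auto simp: F_def bij_betw_def)
  have 1: "bij_betw F (verts C) (verts C')"
    using b by (subst bij_betw_cong[of _ _ f]) (use p(3) in \<open>auto simp: F_def\<close>)
  have 2: "bij_betw F P Q" using h by (subst bij_betw_cong[of _ _ h]) (auto simp: F_def)
  have bV: "bij_betw F (verts C \<union> P) (verts C' \<union> Q)"
    by (rule bij_betw_combine[OF 1 2]) (use q(3) in auto)
  have "bij_betw ((`) F) (edges C) (edges C')"
    using be by (subst bij_betw_cong[of _ _ "(`) f"]) (use Fe in auto)
  moreover have "bij_betw ((`) F) {insert u P} {insert (f u) Q}" using FP by (simp add: bij_betw_def)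
  ultimately have "bij_betw ((`) F) (edges C \<union> {insert u P}) (edges C' \<union> {insert (f u) Q})"
    by (rule bij_betw_combine) (use q(9) in auto)
  then have "iso_via F (add_pendant C u P) (add_pendant C' (f u) Q)"
    using bV by (simp add: iso_via_def)
  then show ?thesis using hypergraph_iso_iff by blast
qed

lemma lollipop2_as_add_pendant:
  "lollipop2 g k 1 = add_pendant (hypercycle g k) (CycA 1 1) (insert (PathV 2) (PathA 1 ` {1..k - 2}))"
  if "3 \<le> k" "2 \<le> g"
proof -
  have v: "CycA 1 1 \<in> verts (hypercycle g k)" using that by (auto simp: hypercycle_def)
  have "verts (lollipop2 g k 1) = verts (hypercycle g k) \<union> insert (PathV 2) (PathA 1 ` {1..k - 2})"
    using v by (auto simp: lollipop2_def pendant_vertex_def numeral_2_eq_2 atLeastAtMostSuc_conv)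
  moreover have "edges (lollipop2 g k 1)
      = insert (insert (CycA 1 1) (insert (PathV 2) (PathA 1 ` {1..k - 2}))) (edges (hypercycle g k))"
    by (auto simp: lollipop2_def pendant_edge_def pendant_vertex_def numeral_2_eq_2)
  ultimately show ?thesis by (simp add: add_pendant_def lollipop2_def)
qed

lemma lollipop2_pendant:
  assumes "3 \<le> k" "2 \<le> g"
  shows "pendant k (hypercycle g k) (CycA 1 1) (insert (PathV 2) (PathA 1 ` {1..k - 2}))"
proof -
  have "card (PathA 1 ` {1..k - 2}) = k - 2" by (subst card_image) (auto simp: inj_on_def)
  moreover have "PathV 2 \<notin> PathA 1 ` {1..k - 2}" by auto
  ultimately have "card (insert (PathV 2) (PathA 1 ` {1..k - 2})) = k - 1" using assms(1) by simp
  moreover have "insert (PathV 2) (PathA 1 ` {1..k - 2}) \<inter> verts (hypercycle g k) = {}"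
    by (auto simp: hypercycle_def)
  moreover have "CycA 1 1 \<in> verts (hypercycle g k)" using assms by (auto simp: hypercycle_def)
  ultimately show ?thesis
    using hypercycle_cycle_like(1)[OF assms(2,1)] by (simp add: pendant_def cycle_like_def)
qed

lemma lollipop2_k_hypergraph:
  assumes "3 \<le> k" "2 \<le> g"
  shows "k_hypergraph k (lollipop2 g k 1)"
  unfolding lollipop2_as_add_pendant[OF assms] by (rule add_pendant_k_hypergraph[OF lollipop2_pendant[OF assms]])

lemma cycle_with_pendant_is_lollipop2:
  assumes C: "cycle_like k C" and p: "pendant k C u P" and u: "deg C u = 1"
  shows "hypergraph_iso (add_pendant C u P) (lollipop2 (card (edges C)) k 1)"
proof -
  let ?g = "card (edges C)"
  have k: "3 \<le> k" by (rule pendantD(6)[OF p])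
  have g: "2 \<le> ?g" by (rule cut_unicyclic_card_edges[OF cycle_like_imp_cut_unicyclic[OF C]])
  obtain f where f: "iso_via f (hypercycle ?g k) C" "f (CycA 1 1) = u"
    by (rule cycle_like_is_hypercycle[OF C pendantD(2)[OF p] u])
  have "hypergraph_iso (lollipop2 ?g k 1) (add_pendant C (f (CycA 1 1)) P)"
    unfolding lollipop2_as_add_pendant[OF k g]
    by (rule add_pendant_iso[OF f(1) lollipop2_pendant[OF k g]]) (simp only: f(2) p)
  then show ?thesis
    using hypergraph_iso_sym[OF k_hypergraphD(2)[OF lollipop2_k_hypergraph[OF k g]]] f(2) by simp
qed

text \<open>The edge \<open>r\<close> is shrunk to its vertex \<open>a\<close>, and edges that contain the other joint \<open>b\<close> are redirected to \<open>a\<close>.\<close>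

section \<open>Contracting an edge of the cycle\<close>

definition contract :: "'a hypergraph \<Rightarrow> 'a set \<Rightarrow> 'a \<Rightarrow> 'a \<Rightarrow> 'a hypergraph" where
  "contract G r a b = \<lparr> verts = verts G - (r - {a}),
     edges = (\<lambda>f. if b \<in> f then insert a (f - {b}) else f) ` (edges G - {r}) \<rparr>"

text \<open>The edge \<open>r\<close> lies between two different edges \<open>e\<^sub>a\<close> and \<open>e\<^sub>b\<close>, attached at \<open>a\<close> and \<open>b\<close>, and has no other
neighbours. The last condition says that the redirected edge is new, so that no edges get identified.\<close>

locale contractible =
  fixes k :: nat and G :: "'a hypergraph" and r a b e\<^sub>a e\<^sub>b
  assumes G: "k_hypergraph k G"
    and edges: "r \<in> edges G" "e\<^sub>a \<in> edges G" "e\<^sub>b \<in> edges G" "e\<^sub>a \<noteq> r" "e\<^sub>b \<noteq> r" "e\<^sub>a \<noteq> e\<^sub>b"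
    and ab: "a \<in> r" "b \<in> r" "a \<noteq> b"
    and star_a: "star G a = {r, e\<^sub>a}" and star_b: "star G b = {r, e\<^sub>b}"
    and star_inner: "\<And>z. z \<in> r \<Longrightarrow> z \<noteq> a \<Longrightarrow> z \<noteq> b \<Longrightarrow> star G z = {r}"
    and fresh: "insert a (e\<^sub>b - {b}) \<notin> edges G"
begin

definition slide :: "'a set \<Rightarrow> 'a set" where
  "slide f = (if b \<in> f then insert a (f - {b}) else f)"

lemma verts_contract: "verts (contract G r a b) = verts G - (r - {a})"
  by (simp add: contract_def)

lemma edges_contract: "edges (contract G r a b) = slide ` (edges G - {r})"
  by (simp add: contract_def slide_def[abs_def])

lemma at_a: "f \<in> edges G \<Longrightarrow> a \<in> f \<longleftrightarrow> f = r \<or> f = e\<^sub>a"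
  and at_b: "f \<in> edges G \<Longrightarrow> b \<in> f \<longleftrightarrow> f = r \<or> f = e\<^sub>b"
  and at_inner: "f \<in> edges G \<Longrightarrow> z \<in> r \<Longrightarrow> z \<noteq> a \<Longrightarrow> z \<noteq> b \<Longrightarrow> z \<in> f \<longleftrightarrow> f = r"
  using star_a star_b star_inner[of z] by (auto simp: star_def)

lemma slide_eb: "slide e\<^sub>b = insert a (e\<^sub>b - {b})"
  using at_b[OF edges(3)] by (simp add: slide_def)

lemma slide_id: "f \<in> edges G \<Longrightarrow> f \<noteq> r \<Longrightarrow> f \<noteq> e\<^sub>b \<Longrightarrow> slide f = f"
  using at_b by (simp add: slide_def)

lemma inj_slide: "inj_on slide (edges G - {r})"
proof (rule inj_onI)
  fix f h assume fh: "f \<in> edges G - {r}" "h \<in> edges G - {r}" "slide f = slide h"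
  have new: "slide e\<^sub>b \<notin> edges G" unfolding slide_eb by (rule fresh)
  have id: "slide l = l" if "l \<in> edges G - {r}" "l \<noteq> e\<^sub>b" for l
    using that by (intro slide_id) simp_all
  show "f = h"
  proof (cases "f = e\<^sub>b")
    case f: True
    have "h = e\<^sub>b"
    proof (rule ccontr)
      assume "h \<noteq> e\<^sub>b"
      from id[OF fh(2) this] have "slide e\<^sub>b = h" using fh(3) unfolding f by (rule trans[rotated])
      then show False using new fh(2) by blast
    qed
    then show ?thesis using f by simp
  next
    case f: False
    have sf: "slide f = f" by (rule id[OF fh(1) f])
    have "h \<noteq> e\<^sub>b"
    proof
      assume h: "h = e\<^sub>b"
      have "slide e\<^sub>b = f" using fh(3) unfolding sf h by (rule sym)
      then show False using new fh(1) by blast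
    qed
    from id[OF fh(2) this] show ?thesis using fh(3) unfolding sf by (rule trans[rotated])
  qed
qed

lemma a_notin_eb: "a \<notin> e\<^sub>b"
  using at_a[OF edges(3)] edges by auto

lemma mem_slide:
  assumes "z \<in> verts (contract G r a b)" "z \<noteq> a"
  shows "z \<in> slide f \<longleftrightarrow> z \<in> f"
proof -
  have "z \<noteq> b" using assms ab(2,3) by (auto simp: verts_contract)
  then show ?thesis using assms(2) by (simp add: slide_def)
qed

lemma star_contract:
  assumes "z \<in> verts (contract G r a b)" "z \<noteq> a"
  shows "star (contract G r a b) z = slide ` star G z" "star G z \<subseteq> edges G - {r}"
proof -
  have "z \<notin> r" using assms by (auto simp: verts_contract)
  then show "star G z \<subseteq> edges G - {r}" by (auto simp: star_def)
  show "star (contract G r a b) z = slide ` star G z"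
    using mem_slide[OF assms] \<open>z \<notin> r\<close> unfolding star_def edges_contract by blast
qed

lemma star_contract_a: "star (contract G r a b) a = {e\<^sub>a, slide e\<^sub>b}"
proof -
  have "a \<in> slide f \<longleftrightarrow> f = e\<^sub>a \<or> f = e\<^sub>b" if "f \<in> edges G - {r}" for f
    using that at_a[of f] at_b[of f] edges by (auto simp: slide_def)
  then have "star (contract G r a b) a = slide ` {e\<^sub>a, e\<^sub>b}"
    unfolding star_def edges_contract using edges by auto
  then show ?thesis using slide_id[OF edges(2,4,6)] by simp
qed

lemma deg_contract:
  assumes "z \<in> verts (contract G r a b)"
  shows "deg (contract G r a b) z = deg G z"
proof (cases "z = a")
  case True
  have "slide e\<^sub>b \<noteq> e\<^sub>a" using fresh slide_eb edges(2) by metis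
  then show ?thesis using True star_contract_a star_a edges(4) by (simp add: deg_def)
next
  case False
  note st = star_contract[OF assms False]
  show ?thesis unfolding deg_def st(1) by (rule card_image[OF inj_on_subset[OF inj_slide st(2)]])
qed

lemma slide_subset:
  assumes "f \<in> edges G" "f \<noteq> r"
  shows "slide f \<subseteq> verts (contract G r a b)"
proof
  fix z assume z: "z \<in> slide f"
  have fV: "f \<subseteq> verts G" "r \<subseteq> verts G" using k_hypergraphD(6)[OF G] assms(1) edges(1) by auto
  show "z \<in> verts (contract G r a b)"
  proof (cases "z = a")
    case True
    then show ?thesis using ab(1) fV by (auto simp: verts_contract)
  next
    case False
    then have "z \<in> f" "z \<noteq> b" using z by (auto simp: slide_def split: if_splits)
    then have "z \<notin> r" using at_inner[OF assms(1), of z] assms(2) False by auto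
    then show ?thesis using \<open>z \<in> f\<close> fV by (auto simp: verts_contract)
  qed
qed

lemma card_slide:
  assumes "f \<in> edges G" "f \<noteq> r"
  shows "card (slide f) = k"
proof (cases "f = e\<^sub>b")
  case False
  then show ?thesis using slide_id assms k_hypergraphD(7)[OF G] by simp
next
  case True
  have "b \<in> e\<^sub>b" using at_b[OF edges(3)] by simp
  then have "card (insert a (e\<^sub>b - {b})) = card e\<^sub>b"
    using a_notin_eb k_hypergraphD(8)[OF G edges(3)] by (simp add: card.insert_remove card_Diff_singleton)
       (metis Suc_pred card_gt_0_iff emptyE)
  then show ?thesis using True slide_eb k_hypergraphD(7)[OF G edges(3)] by simp
qed

lemma k_hypergraph_contract: "k_hypergraph k (contract G r a b)"
  unfolding k_hypergraph_def hypergraph_def uniform_def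
proof (intro conjI ballI)
  note D = k_hypergraphD[OF G]
  show "3 \<le> k" by (rule D(1))
  show "finite (verts (contract G r a b))" using D(3) by (simp add: verts_contract)
  have "a \<in> verts G" using D(6)[OF edges(1)] ab(1) by blast
  then show "verts (contract G r a b) \<noteq> {}" by (auto simp: verts_contract)
  fix e assume "e \<in> edges (contract G r a b)"
  then obtain f where f: "f \<in> edges G" "f \<noteq> r" "e = slide f" by (auto simp: edges_contract)
  show "e \<subseteq> verts (contract G r a b)" "card e = k" "2 \<le> card e"
    using slide_subset[OF f(1,2)] card_slide[OF f(1,2)] f(3) D(1) by auto
qed

lemma card_edges_contract: "card (edges (contract G r a b)) = card (edges G) - 1"
  unfolding edges_contract card_image[OF inj_slide] using edges(1) by simp

text \<open>A closed set \<open>W\<close> of the contraction lifts to a closed set of \<open>G\<close> by adding \<open>r\<close> if \<open>a \<in> W\<close>.\<close>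

lemma cut_connected_contract:
  assumes con: "cut_connected G"
  shows "cut_connected (contract G r a b)"
  unfolding cut_connected_def
proof (intro allI impI)
  let ?V = "verts (contract G r a b)"
  fix W assume W: "W \<subseteq> ?V" "W \<noteq> {}" and cl0: "\<forall>e\<in>edges (contract G r a b). e \<inter> W \<noteq> {} \<longrightarrow> e \<subseteq> W"
  have cl: "slide f \<subseteq> W" if "f \<in> edges G" "f \<noteq> r" "z \<in> slide f" "z \<in> W" for f z
  proof -
    have "slide f \<in> edges (contract G r a b)" using that(1,2) by (simp add: edges_contract)
    then show ?thesis using cl0 that(3,4) by blast
  qed
  have rV: "r \<subseteq> verts G" by (rule k_hypergraphD(6)[OF G edges(1)])
  define U where "U = W \<union> (if a \<in> W then r else {})"
  have rW: "r \<inter> W \<subseteq> {a}" using W(1) by (auto simp: verts_contract)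
  have "U = verts G"
  proof (rule cut_connectedD[OF con])
    show "U \<subseteq> verts G" using W(1) rV by (auto simp: U_def verts_contract)
    show "U \<noteq> {}" using W(2) by (auto simp: U_def)
    fix f assume f: "f \<in> edges G" "f \<inter> U \<noteq> {}"
    show "f \<subseteq> U"
    proof (cases "f = r")
      case True
      then have "a \<in> W" using f(2) rW by (auto simp: U_def split: if_splits)
      then show ?thesis using True by (simp add: U_def)
    next
      case False
      obtain z where z: "z \<in> f" "z \<in> U" using f(2) by blast
      have "slide f \<subseteq> W"
      proof (cases "z \<in> W")
        case True
        then have "z \<noteq> b" using rW ab by auto
        then have "z \<in> slide f" using z(1) by (simp add: slide_def)
        then show ?thesis using cl[OF f(1) False] True by blast
      next
        case nW: False
        then have aW: "a \<in> W" and zr: "z \<in> r" using z(2) by (auto simp: U_def split: if_splits)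
        then have "z = b" using at_inner[OF f(1) zr] z(1) False nW by auto
        then have "a \<in> slide f" using z(1) by (simp add: slide_def)
        then show ?thesis using cl[OF f(1) False] aW by blast
      qed
      moreover have "f \<subseteq> slide f \<union> (if a \<in> slide f then {b} else {})" by (auto simp: slide_def)
      ultimately show ?thesis using ab(2) by (auto simp: U_def split: if_splits)
    qed
  qed
  then show "W = ?V" using W(1) by (auto simp: U_def verts_contract split: if_splits)
qed

text \<open>Keep all entries of the Perron vector except the one at \<open>a\<close>, which is set to the value \<open>c\<close> that the eigenvalue
equation at \<open>a\<close> demands for the edges \<open>e\<^sub>a\<close> and \<open>e\<^sub>b\<close> with their old sums. As \<open>r\<close> has the smaller sum, \<open>c\<close> is at
least as large as the old entries at \<open>a\<close> and \<open>b\<close>. So no edge sum decreases and the new vector is a subsolution.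
In case of equality it would solve the equation at \<open>a\<close> exactly, which forces \<open>c\<close> to equal both old
entries and the three edge sums to agree.\<close>

lemma scaled_rho_lt_contract:
  fixes x :: "'a \<Rightarrow> real"
  assumes pos: "\<And>v. v \<in> verts G \<Longrightarrow> 0 < x v" and ev: "eigenvector_for G \<Lambda> x" and \<Lambda>: "0 < \<Lambda>"
    and le: "sum x r \<le> sum x e\<^sub>a" "sum x r \<le> sum x e\<^sub>b"
    and ne: "\<not> (sum x e\<^sub>a = sum x r \<and> sum x e\<^sub>b = sum x r)"
  shows "\<Lambda> < scaled_rho k (contract G r a b)"
proof -
  note D = k_hypergraphD[OF G]
  let ?H = "contract G r a b"
  have aV: "a \<in> verts G" and bV: "b \<in> verts G" using D(6)[OF edges(1)] ab by auto
  have eig: "(\<Sum>e\<in>star G v. sum x e) = (\<Lambda> + deg G v) * x v" if "v \<in> verts G" for v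
    using ev that unfolding eigenvector_for_def by blast
  have xa: "(\<Lambda> + 2) * x a = sum x r + sum x e\<^sub>a"
    using eig[OF aV] star_a edges(4) by (simp add: deg_def)
  have xb: "(\<Lambda> + 2) * x b = sum x r + sum x e\<^sub>b"
    using eig[OF bV] star_b edges(5) by (simp add: deg_def)
  define c where "c = (sum x e\<^sub>a + sum x e\<^sub>b) / (\<Lambda> + 2)"
  have c: "(\<Lambda> + 2) * c = sum x e\<^sub>a + sum x e\<^sub>b" using \<Lambda> by (simp add: c_def)
  have pos2: "0 < \<Lambda> + 2" using \<Lambda> by simp
  have "(\<Lambda> + 2) * x a \<le> (\<Lambda> + 2) * c" "(\<Lambda> + 2) * x b \<le> (\<Lambda> + 2) * c"
    unfolding c xa xb using le by simp_all
  then have ca: "x a \<le> c" and cb: "x b \<le> c" using mult_le_cancel_left_pos[OF pos2] by blast+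
  define y where "y = x(a := c)"
  have sum_ea: "sum y e\<^sub>a = sum x e\<^sub>a + (c - x a)"
  proof -
    have "a \<in> e\<^sub>a" "finite e\<^sub>a" using at_a[OF edges(2)] D(8)[OF edges(2)] by auto
    moreover have "sum y (e\<^sub>a - {a}) = sum x (e\<^sub>a - {a})" by (intro sum.cong) (auto simp: y_def)
    ultimately show ?thesis by (simp add: sum.remove[of _ a] y_def)
  qed
  have sum_eb: "sum y (slide e\<^sub>b) = sum x e\<^sub>b + (c - x b)"
  proof -
    have "b \<in> e\<^sub>b" "finite e\<^sub>b" using at_b[OF edges(3)] D(8)[OF edges(3)] by auto
    moreover have "sum y (e\<^sub>b - {b}) = sum x (e\<^sub>b - {b})"
      by (intro sum.cong) (use a_notin_eb in \<open>auto simp: y_def\<close>)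
    ultimately show ?thesis unfolding slide_eb using a_notin_eb by (simp add: sum.remove[of _ b] y_def)
  qed
  have ge: "sum x f \<le> sum y (slide f)" if f: "f \<in> edges G" "f \<noteq> r" for f
  proof -
    consider "f = e\<^sub>a" | "f = e\<^sub>b" | "f \<noteq> e\<^sub>a" "f \<noteq> e\<^sub>b" by blast
    then show ?thesis
    proof cases
      case 1
      then show ?thesis using sum_ea ca slide_id[OF edges(2,4,6)] by simp
    next
      case 2
      then show ?thesis using sum_eb cb by simp
    next
      case 3
      then have "a \<notin> f" using at_a[OF f(1)] f(2) by simp
      then have "sum y f = sum x f" by (intro sum.cong) (auto simp: y_def)
      then show ?thesis using slide_id[OF f 3(2)] by simp
    qed
  qed
  have y_pos: "0 < y v" if "v \<in> verts ?H" for v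
    using that pos[of v] pos[OF aV] ca by (auto simp: y_def verts_contract)
  have star_a_sum: "(\<Sum>e\<in>star ?H a. sum y e) = sum y e\<^sub>a + sum y (slide e\<^sub>b)"
  proof -
    have "slide e\<^sub>b \<noteq> e\<^sub>a" using fresh slide_eb edges(2) by metis
    then show ?thesis unfolding star_contract_a by simp
  qed
  have aH: "a \<in> verts ?H" using aV by (simp add: verts_contract)
  have deg_a: "deg ?H a = 2" using deg_contract[OF aH] star_a edges(4) by (simp add: deg_def)
  have sub: "(\<Lambda> + deg ?H v) * y v \<le> (\<Sum>e\<in>star ?H v. sum y e)" if v: "v \<in> verts ?H" for v
  proof (cases "v = a")
    case True
    then show ?thesis using star_a_sum sum_ea sum_eb ca cb c deg_a by (simp add: y_def)
  next
    case False
    note st = star_contract[OF v False]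
    have vG: "v \<in> verts G" using v by (simp add: verts_contract)
    have "(\<Lambda> + deg ?H v) * y v = (\<Sum>f\<in>star G v. sum x f)"
      using eig[OF vG] deg_contract[OF v] False by (simp add: y_def)
    also have "\<dots> \<le> (\<Sum>f\<in>star G v. sum y (slide f))"
      by (intro sum_mono ge) (use st(2) in auto)
    also have "\<dots> = (\<Sum>e\<in>star ?H v. sum y e)"
      unfolding st(1) by (subst sum.reindex[OF inj_on_subset[OF inj_slide st(2)]]) (simp add: comp_def)
    finally show ?thesis .
  qed
  have y0: "0 \<le> y v" if "v \<in> verts ?H" for v using y_pos[OF that] by simp
  have nz: "\<exists>v\<in>verts ?H. y v \<noteq> 0" using aH y_pos[OF aH] by (intro bexI[of _ a]) auto
  have "\<Lambda> \<le> scaled_rho k ?H"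
    by (rule scaled_rho_ge_subsolution(1)[OF k_hypergraph_contract]) (fact y0 nz sub)+
  moreover have "\<Lambda> \<noteq> scaled_rho k ?H"
  proof
    assume eq: "\<Lambda> = scaled_rho k ?H"
    have "eigenvector_for ?H \<Lambda> y"
      by (rule scaled_rho_ge_subsolution(2)[OF k_hypergraph_contract]) (fact y0 nz sub eq)+
    then have "(\<Sum>e\<in>star ?H a. sum y e) = (\<Lambda> + deg ?H a) * y a"
      using aH unfolding eigenvector_for_def by blast
    then have "(c - x a) + (c - x b) = 0"
      unfolding star_a_sum sum_ea sum_eb deg_a using c by (simp add: y_def)
    then have "x a = c" "x b = c" using ca cb by linarith+
    then show False using xa xb c ne by auto
  qed
  ultimately show ?thesis by linarith
qed

end

text \<open>If the sum over \<open>f\<close> were at least that of its neighbours, then \<open>x\<^sub>v \<le> d\<^sub>v / (\<Lambda> + d\<^sub>v) S\<^sub>f\<close> for all \<open>v\<close> in \<open>f\<close>. Adding up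
gives \<open>1 \<le> 4 / (\<Lambda> + 2) + (k - 2) / (\<Lambda> + 1)\<close>, which fails for \<open>\<Lambda> > L\<close>.\<close>

lemma no_local_maximum_edge:
  fixes x :: "'a \<Rightarrow> real"
  assumes G: "k_hypergraph k G" and pos: "\<And>v. v \<in> verts G \<Longrightarrow> 0 < x v" and ev: "eigenvector_for G \<Lambda> x"
    and \<Lambda>: "cycle_value k < \<Lambda>" and f: "f \<in> edges G"
    and deg: "\<And>v. v \<in> f \<Longrightarrow> deg G v = 1 \<or> deg G v = 2" and two: "card {v \<in> f. deg G v = 2} = 2"
  shows "\<exists>h\<in>edges G. h \<inter> f \<noteq> {} \<and> sum x f < sum x h"
proof (rule ccontr)
  note D = k_hypergraphD[OF G]
  note L = cycle_value_equation[OF D(1)]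
  assume "\<not> ?thesis"
  then have le: "sum x h \<le> sum x f" if "h \<in> edges G" "h \<inter> f \<noteq> {}" for h using that by fastforce
  have L0: "0 < \<Lambda>" using L(1) \<Lambda> by linarith
  have fV: "f \<subseteq> verts G" by (rule D(6)[OF f])
  have xv: "x v \<le> deg G v / (\<Lambda> + deg G v) * sum x f" if v: "v \<in> f" for v
  proof -
    have "(\<Lambda> + deg G v) * x v = (\<Sum>h\<in>star G v. sum x h)"
      using ev v fV unfolding eigenvector_for_def by auto
    also have "\<dots> \<le> (\<Sum>h\<in>star G v. sum x f)"
      by (intro sum_mono le) (use v in \<open>auto simp: star_def\<close>)
    also have "\<dots> = deg G v * sum x f" by (simp add: deg_def)
    finally have "x v * (\<Lambda> + deg G v) \<le> deg G v * sum x f" by (simp add: mult.commute)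
    moreover have "0 < \<Lambda> + deg G v" using L0 by linarith
    ultimately show ?thesis by (simp add: pos_le_divide_eq)
  qed
  have "f \<noteq> {}" using D(1) D(7)[OF f] by auto
  then have S: "0 < sum x f" using D(8)[OF f] pos fV by (intro sum_pos) auto
  have "sum x f \<le> (\<Sum>v\<in>f. deg G v / (\<Lambda> + deg G v) * sum x f)" by (intro sum_mono xv)
  also have "\<dots> = (\<Sum>v\<in>f. deg G v / (\<Lambda> + deg G v)) * sum x f" by (rule sum_distrib_right[symmetric])
  also have "(\<Sum>v\<in>f. deg G v / (\<Lambda> + deg G v)) = 4 / (\<Lambda> + 2) + (real k - 2) / (\<Lambda> + 1)"
    using sum_over_edge_by_degree[OF G f, of "\<lambda>d. d / (\<Lambda> + d)"] deg two by simp
  finally have "1 \<le> 4 / (\<Lambda> + 2) + (real k - 2) / (\<Lambda> + 1)" using S by simp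
  moreover have "4 / (\<Lambda> + 2) < 4 / (cycle_value k + 2)"
    using L(1) \<Lambda> by (intro divide_strict_left_mono) auto
  moreover have "(real k - 2) / (\<Lambda> + 1) \<le> (real k - 2) / (cycle_value k + 1)"
    using L(1) \<Lambda> D(1) by (intro divide_left_mono) auto
  ultimately show False using L(3) by linarith
qed

text \<open>If both neighbours of \<open>r\<close> were the same edge, then these two edges would form a component, that is, the whole
hypercycle. The redirected edge is new because \<open>e\<^sub>b\<close> has a vertex of degree \<open>1\<close>, which lies in no other edge.\<close>

lemma cycle_like_contractible:
  assumes C: "cycle_like k C" and r: "r \<in> edges C" and M: "3 \<le> card (edges C)"
  obtains a b e\<^sub>a e\<^sub>b where "contractible k C r a b e\<^sub>a e\<^sub>b"
proof -
  have H: "k_hypergraph k C" and con: "cut_connected C"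
    and deg: "\<And>v. v \<in> verts C \<Longrightarrow> deg C v = 1 \<or> deg C v = 2"
    and two: "\<And>e. e \<in> edges C \<Longrightarrow> card {v \<in> e. deg C v = 2} = 2"
    using C by (auto simp: cycle_like_def)
  note D = k_hypergraphD[OF H]
  obtain a b where ab: "{v \<in> r. deg C v = 2} = {a, b}" "a \<noteq> b"
    using two[OF r] by (auto simp: card_2_iff)
  then have a: "a \<in> r" "deg C a = 2" and b: "b \<in> r" "deg C b = 2" by blast+
  obtain e\<^sub>a where ea: "e\<^sub>a \<in> edges C" "e\<^sub>a \<noteq> r" "a \<in> e\<^sub>a" by (rule cycle_like_next_edge[OF C r a])
  obtain e\<^sub>b where eb: "e\<^sub>b \<in> edges C" "e\<^sub>b \<noteq> r" "b \<in> e\<^sub>b" by (rule cycle_like_next_edge[OF C r b])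
  have sa: "star C a = {r, e\<^sub>a}" by (rule star_eq_of_deg_2[OF H a(2)]) (use r ea a in auto)
  have sb: "star C b = {r, e\<^sub>b}" by (rule star_eq_of_deg_2[OF H b(2)]) (use r eb b in auto)
  have single: "star C z = {f}" if "f \<in> edges C" "z \<in> f" "deg C z \<noteq> 2" for f z
  proof -
    have "deg C z = 1" using deg[of z] that D(6) by blast
    then obtain c where "star C z = {c}" by (auto simp: deg_def card_1_singleton_iff)
    moreover have "f \<in> star C z" using that by (simp add: star_def)
    ultimately show ?thesis by simp
  qed
  have distinct: "e\<^sub>a \<noteq> e\<^sub>b"
  proof
    assume eq: "e\<^sub>a = e\<^sub>b"
    have jf: "{z \<in> e\<^sub>a. deg C z = 2} = {a, b}"
      by (rule cycle_like_edge_joints[OF C ea(1)]) (use ea eb eq a b ab in auto)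
    have closed: "h = r \<or> h = e\<^sub>a" if "h \<in> edges C" "z \<in> h" "z \<in> r \<union> e\<^sub>a" for h z
    proof (cases "deg C z = 2")
      case True
      then have "z = a \<or> z = b" using that(3) ab(1) jf by blast
      moreover have "h \<in> star C z" using that by (simp add: star_def)
      ultimately show ?thesis using sa sb eq by auto
    next
      case False
      have "h \<in> star C z" using that by (simp add: star_def)
      then show ?thesis using single[OF r _ False] single[OF ea(1) _ False] that(3) by auto
    qed
    have "r \<union> e\<^sub>a = verts C"
      by (rule cut_connectedD[OF con]) (use D(6) r ea(1) a closed in blast)+
    have "edges C \<subseteq> {r, e\<^sub>a}"
    proof
      fix h assume h: "h \<in> edges C"
      then have "h \<noteq> {}" using D(1) D(7)[OF h] by auto
      then obtain z where "z \<in> h" by blast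
      then show "h \<in> {r, e\<^sub>a}" using closed[OF h] D(6)[OF h] \<open>r \<union> e\<^sub>a = verts C\<close> by blast
    qed
    then have "card (edges C) \<le> card {r, e\<^sub>a}" by (intro card_mono) auto
    then show False using M card_insert_le_m1[of 2 "{e\<^sub>a}" r] by simp
  qed
  have fresh: "insert a (e\<^sub>b - {b}) \<notin> edges C"
  proof
    assume E: "insert a (e\<^sub>b - {b}) \<in> edges C"
    have "{z \<in> e\<^sub>b. deg C z = 2} \<noteq> e\<^sub>b" using two[OF eb(1)] D(1) D(7)[OF eb(1)] by auto
    then obtain z where z: "z \<in> e\<^sub>b" "deg C z \<noteq> 2" by blast
    then have "z \<in> insert a (e\<^sub>b - {b})" using b(2) by auto
    then have "insert a (e\<^sub>b - {b}) = e\<^sub>b" using single[OF eb(1) z] single[OF E _ z(2)] by auto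
    then have "b \<in> insert a (e\<^sub>b - {b})" using eb(3) by simp
    then show False using ab(2) by simp
  qed
  have "contractible k C r a b e\<^sub>a e\<^sub>b"
  proof
    show "star C z = {r}" if "z \<in> r" "z \<noteq> a" "z \<noteq> b" for z
    proof (rule single[OF r that(1)])
      show "deg C z \<noteq> 2" using that ab(1) by blast
    qed
  qed (fact H r ea eb distinct a b ab sa sb fresh)+
  then show thesis by (rule that)
qed

lemma cycle_like_contract:
  assumes C: "cycle_like k C" and con: "contractible k C r a b e\<^sub>a e\<^sub>b"
  shows "cycle_like k (contract C r a b)"
proof -
  interpret contractible k C r a b e\<^sub>a e\<^sub>b by (rule con)
  have deg: "\<And>v. v \<in> verts C \<Longrightarrow> deg C v = 1 \<or> deg C v = 2"
    and two: "\<And>e. e \<in> edges C \<Longrightarrow> card {v \<in> e. deg C v = 2} = 2"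
    and ec: "cut_connected C"
    using C by (auto simp: cycle_like_def)
  let ?H = "contract C r a b"
  have "card {v \<in> e. deg ?H v = 2} = 2" if e: "e \<in> edges ?H" for e
  proof -
    obtain f where f: "f \<in> edges C" "f \<noteq> r" "e = slide f" using e by (auto simp: edges_contract)
    have 1: "{v \<in> e. deg ?H v = 2} = {v \<in> slide f. deg C v = 2}"
      using slide_subset[OF f(1,2)] deg_contract f(3) by auto
    show ?thesis
    proof (cases "f = e\<^sub>b")
      case False
      then show ?thesis using 1 slide_id[OF f(1,2) False] two[OF f(1)] by simp
    next
      case True
      let ?A = "{v \<in> e\<^sub>b. deg C v = 2}"
      have d: "deg C a = 2" "deg C b = 2"
        using star_a star_b edges(4,5) by (auto simp: deg_def)
      have A: "b \<in> ?A" "a \<notin> ?A" "finite ?A"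
        using d at_b[OF edges(3)] a_notin_eb k_hypergraphD(8)[OF G edges(3)] by auto
      have "{v \<in> slide f. deg C v = 2} = insert a (?A - {b})"
        unfolding True slide_eb using d by auto
      moreover have "card (insert a (?A - {b})) = Suc (card (?A - {b}))"
        by (rule card_insert_disjoint) (use A in blast)+
      moreover have "card (?A - {b}) = 1"
        using card_Diff_singleton[OF A(1)] two[OF edges(3)] by simp
      ultimately show ?thesis using 1 by simp
    qed
  qed
  moreover have "deg ?H v = 1 \<or> deg ?H v = 2" if "v \<in> verts ?H" for v
    using deg_contract[OF that] deg[of v] that by (auto simp: verts_contract)
  ultimately show ?thesis using k_hypergraph_contract cut_connected_contract[OF ec] by (simp add: cycle_like_def)
qed

text \<open>Among the cycle edges other than the edge \<open>e\<close> at which the pendant edge hangs, let \<open>r\<close> have the smallest sum of the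
Perron vector. Its sum does not exceed that of \<open>e\<close> either: otherwise the largest sum among these edges would be a
local maximum, contrary to \<open>no_local_maximum_edge\<close>. So \<open>r\<close> can be contracted as in \<open>scaled_rho_lt_contract\<close>, and
by \<open>no_local_maximum_edge\<close> one of its neighbours has a strictly larger sum. The contraction is a lollipop whose
cycle is shorter by one edge.\<close>

lemma lollipop2_scaled_rho_decreasing:
  assumes k: "3 \<le> k" and M: "3 \<le> M"
  shows "scaled_rho k (lollipop2 M k 1) < scaled_rho k (lollipop2 (M - 1) k 1)"
proof -
  define C where "C = hypercycle M k"
  define u where "u = CycA 1 1"
  define P where "P = insert (PathV 2) (PathA 1 ` {1..k - 2})"
  have M2: "2 \<le> M" "1 \<in> {1..M}" using M by auto
  have k2: "1 \<in> {1..k - 2}" using k by simp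
  have C: "cycle_like k C" and cardC: "card (edges C) = M"
    unfolding C_def using hypercycle_cycle_like[OF M2(1) k] by auto
  have pu: "pendant k C u P" unfolding C_def u_def P_def by (rule lollipop2_pendant[OF k M2(1)])
  have u1: "deg C u = 1" unfolding C_def u_def by (rule deg_hypercycle(2)[OF M2(1) k M2(2) k2])
  have H: "k_hypergraph k C" and conC: "cut_connected C"
    and degC: "\<And>v. v \<in> verts C \<Longrightarrow> deg C v = 1 \<or> deg C v = 2"
    and two: "\<And>e. e \<in> edges C \<Longrightarrow> card {v \<in> e. deg C v = 2} = 2"
    using C by (auto simp: cycle_like_def)
  note D = k_hypergraphD[OF H] and p = pendantD[OF pu]
  let ?D = "add_pendant C u P"
  have HD: "k_hypergraph k ?D" by (rule add_pendant_k_hypergraph[OF pu])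
  have conD: "cut_connected ?D" by (rule add_pendant_connected[OF pu conC])
  define \<Lambda> where "\<Lambda> = scaled_rho k ?D"
  obtain x where pos: "\<And>v. v \<in> verts ?D \<Longrightarrow> 0 < x v" and ev: "eigenvector_for ?D \<Lambda> x"
    using positive_perron_vector[OF HD conD] unfolding \<Lambda>_def by blast
  have \<Lambda>: "cycle_value k < \<Lambda>"
    unfolding \<Lambda>_def by (rule add_pendant_scaled_rho_gt[OF pu cycle_like_imp_cut_unicyclic[OF C]])
  obtain e where e: "star C u = {e}" using u1 by (auto simp: deg_def card_1_singleton_iff)
  have eE: "e \<in> edges C" "u \<in> e" using e by (auto simp: star_def)
  have un: "u \<notin> f" if "f \<in> edges C" "f \<noteq> e" for f
  proof
    assume "u \<in> f"
    then have "f \<in> star C u" using that(1) by (simp add: star_def)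
    then show False using e that(2) by simp
  qed
  have grow: "\<exists>h\<in>edges C. h \<inter> f \<noteq> {} \<and> sum x f < sum x h" if f: "f \<in> edges C" "f \<noteq> e" for f
  proof -
    have d: "deg ?D v = deg C v" if "v \<in> f" for v
    proof -
      have "v \<in> verts C" "v \<noteq> u" using that un[OF f] D(6)[OF f(1)] by auto
      then show ?thesis using deg_add_pendant(1)[OF pu, of v] by simp
    qed
    have "{v \<in> f. deg ?D v = 2} = {v \<in> f. deg C v = 2}" using d by auto
    then have "\<exists>h\<in>edges ?D. h \<inter> f \<noteq> {} \<and> sum x f < sum x h"
      by (intro no_local_maximum_edge[OF HD pos ev \<Lambda>]) (use f d degC D(6)[OF f(1)] two in auto)
    moreover have "insert u P \<inter> f = {}" using un[OF f] p(10)[OF f(1)] by auto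
    ultimately show ?thesis by auto
  qed
  let ?F = "edges C - {e}"
  have F: "finite ?F" "?F \<noteq> {}"
  proof -
    show "finite ?F" using D(5) by simp
    have "card ?F = M - 1" using eE(1) cardC by simp
    then show "?F \<noteq> {}" using M by (metis card.empty diff_is_0_eq not_numeral_le_zero numeral_le_one_iff semiring_norm(70) order_trans)
  qed
  have "\<exists>r\<in>?F. \<forall>f\<in>edges C. sum x r \<le> sum x f"
  proof -
    obtain r where r: "r \<in> ?F" "\<And>f. f \<in> ?F \<Longrightarrow> sum x r \<le> sum x f"
      using arg_min_if_finite[OF F, of "sum x"] by (metis linorder_not_less)
    \<comment> \<open>If the sum over \<open>e\<close> were the smallest, this \<open>f\<close> would be a local maximum.\<close>
    obtain f where f: "f \<in> ?F" "\<And>h. h \<in> ?F \<Longrightarrow> sum x h \<le> sum x f"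
      using arg_min_if_finite[OF F, of "\<lambda>f. - sum x f"] by (metis linorder_not_less neg_less_iff_less)
    obtain h where h: "h \<in> edges C" "sum x f < sum x h" using grow[of f] f(1) by blast
    then have "h = e" using f(2)[of h] by fastforce
    then have "sum x r \<le> sum x e" using h(2) r(2)[OF f(1)] by simp
    then have "\<forall>f\<in>edges C. sum x r \<le> sum x f" using r(2) by blast
    then show ?thesis using r(1) by blast
  qed
  then obtain r where r: "r \<in> edges C" "r \<noteq> e" and min: "\<And>f. f \<in> edges C \<Longrightarrow> sum x r \<le> sum x f" by blast
  obtain a b e\<^sub>a e\<^sub>b where conCr: "contractible k C r a b e\<^sub>a e\<^sub>b"
    using cycle_like_contractible[OF C r(1)] M cardC by blast
  interpret c: contractible k C r a b e\<^sub>a e\<^sub>b by (rule conCr)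
  have ur: "u \<notin> r" by (rule un[OF r])
  have Dstar: "star ?D z = star C z" if "z \<in> r" for z
  proof -
    have "z \<in> verts C" "z \<noteq> u" using that ur D(6)[OF r(1)] by auto
    then show ?thesis by (rule star_add_pendant(1)[OF pu])
  qed
  have bV: "b \<in> verts C" using D(6)[OF r(1)] c.ab by auto
  have aV: "a \<in> verts C" using D(6)[OF r(1)] c.ab by auto
  have "insert a (e\<^sub>b - {b}) \<subseteq> verts C" using aV D(6)[OF c.edges(3)] by auto
  then have np: "insert a (e\<^sub>b - {b}) \<noteq> insert u P" using p(3,7) by blast
  have conD': "contractible k ?D r a b e\<^sub>a e\<^sub>b"
  proof
    show "k_hypergraph k ?D" by (rule HD)
    show "r \<in> edges ?D" "e\<^sub>a \<in> edges ?D" "e\<^sub>b \<in> edges ?D" using c.edges by simp_all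
    show "e\<^sub>a \<noteq> r" "e\<^sub>b \<noteq> r" "e\<^sub>a \<noteq> e\<^sub>b" "a \<in> r" "b \<in> r" "a \<noteq> b" by (fact c.edges c.ab)+
    show "star ?D a = {r, e\<^sub>a}" "star ?D b = {r, e\<^sub>b}"
      using Dstar[OF c.ab(1)] Dstar[OF c.ab(2)] c.star_a c.star_b by simp_all
    show "star ?D z = {r}" if "z \<in> r" "z \<noteq> a" "z \<noteq> b" for z
      using Dstar[OF that(1)] c.star_inner[OF that] by simp
    show "insert a (e\<^sub>b - {b}) \<notin> edges ?D" using c.fresh np by simp
  qed
  interpret d: contractible k ?D r a b e\<^sub>a e\<^sub>b by (rule conD')
  let ?C' = "contract C r a b"
  have eq: "contract ?D r a b = add_pendant ?C' u P"
  proof -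
    have "r \<subseteq> verts C" by (rule D(6)[OF r(1)])
    then have v: "verts C \<union> P - (r - {a}) = verts C - (r - {a}) \<union> P" using p(3) by auto
    have "r \<noteq> insert u P" using ur by auto
    moreover have "b \<notin> insert u P" using bV p(3) ur c.ab(2) by auto
    ultimately show ?thesis
      unfolding contract_def add_pendant_def using v by (simp add: insert_Diff_if)
  qed
  have C': "cycle_like k ?C'" by (rule cycle_like_contract[OF C conCr])
  have uV': "u \<in> verts ?C'" using p(2) ur by (simp add: c.verts_contract)
  have pu': "pendant k ?C' u P"
    using C' uV' p(3,4,5) by (auto simp: pendant_def cycle_like_def c.verts_contract)
  have "deg ?C' u = 1" using c.deg_contract[OF uV'] u1 by simp
  then have iso: "hypergraph_iso (add_pendant ?C' u P) (lollipop2 (M - 1) k 1)"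
    using cycle_with_pendant_is_lollipop2[OF C' pu'] c.card_edges_contract cardC by simp
  have "\<Lambda> < scaled_rho k (contract ?D r a b)"
  proof (rule d.scaled_rho_lt_contract[OF pos ev])
    show "0 < \<Lambda>" using \<Lambda> cycle_value_equation(1)[OF k] by linarith
    show "sum x r \<le> sum x e\<^sub>a" "sum x r \<le> sum x e\<^sub>b" using min c.edges by blast+
    show "\<not> (sum x e\<^sub>a = sum x r \<and> sum x e\<^sub>b = sum x r)"
    proof
      assume same: "sum x e\<^sub>a = sum x r \<and> sum x e\<^sub>b = sum x r"
      obtain h where h: "h \<in> edges C" "h \<inter> r \<noteq> {}" "sum x r < sum x h" using grow[OF r] by blast
      then obtain z where "z \<in> h" "z \<in> r" by blast
      then have "h = r \<or> h = e\<^sub>a \<or> h = e\<^sub>b"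
        using c.at_a[OF h(1)] c.at_b[OF h(1)] c.at_inner[OF h(1), of z] by auto
      then show False using h(3) same by auto
    qed
  qed
  moreover have "rho (add_pendant ?C' u P) = rho (lollipop2 (M - 1) k 1)"
    by (rule rho_eq_of_iso[OF add_pendant_k_hypergraph[OF pu'] lollipop2_k_hypergraph[OF k] iso]) (use M in simp)
  ultimately have "\<Lambda> < scaled_rho k (lollipop2 (M - 1) k 1)" unfolding eq scaled_rho_def by simp
  moreover have "?D = lollipop2 M k 1"
    unfolding lollipop2_as_add_pendant[OF k M2(1)] C_def u_def P_def ..
  ultimately show ?thesis unfolding \<Lambda>_def by simp
qed

text \<open>By \<open>cut_unicyclic_without_leaf_is_cycle\<close> some edge \<open>e\<close> has at most one vertex of degree at least \<open>2\<close>. It has exactly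
one, since otherwise \<open>e\<close> would be the whole hypergraph, which has at least two edges.\<close>

section \<open>Induction over leaf edges\<close>

lemma cut_unicyclic_leaf_decomposition:
  assumes uni: "cut_unicyclic k G" and nc: "\<not> cycle_like k G"
  obtains C u P where "G = add_pendant C u P" "pendant k C u P" "cut_unicyclic k C"
proof -
  have H: "k_hypergraph k G" and con: "cut_connected G" and n: "card (verts G) = (k - 1) * card (edges G)"
    using uni by (auto simp: cut_unicyclic_def)
  note D = k_hypergraphD[OF H]
  obtain e where e: "e \<in> edges G" "card {v \<in> e. 2 \<le> deg G v} < 2"
    using cut_unicyclic_without_leaf_is_cycle[OF uni] nc by (meson not_le)
  have single: "f = e" if "v \<in> e" "\<not> 2 \<le> deg G v" "f \<in> edges G" "v \<in> f" for v f
  proof -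
    have "v \<in> verts G" using that(1) D(6)[OF e(1)] by blast
    then have "deg G v = 1" using deg_pos[OF uni] that(2) by force
    then obtain c where "star G v = {c}" by (auto simp: deg_def card_1_singleton_iff)
    moreover have "e \<in> star G v" "f \<in> star G v" using that e(1) by (auto simp: star_def)
    ultimately show ?thesis by auto
  qed
  have fin: "finite {v \<in> e. 2 \<le> deg G v}" using D(8)[OF e(1)] by simp
  have "{v \<in> e. 2 \<le> deg G v} \<noteq> {}"
  proof
    assume none: "{v \<in> e. 2 \<le> deg G v} = {}"
    have "e = verts G"
    proof (rule cut_connectedD[OF con])
      show "e \<subseteq> verts G" by (rule D(6)[OF e(1)])
      show "e \<noteq> {}" using D(1) D(7)[OF e(1)] by auto
      show "f \<subseteq> e" if "f \<in> edges G" "f \<inter> e \<noteq> {}" for f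
        using that single none by blast
    qed
    then have "k = (k - 1) * card (edges G)" using n D(7)[OF e(1)] by simp
    moreover have "(k - 1) * 2 \<le> (k - 1) * card (edges G)"
      using cut_unicyclic_card_edges[OF uni] by (rule mult_le_mono2)
    ultimately show False using D(1) by linarith
  qed
  then have "card {v \<in> e. 2 \<le> deg G v} \<noteq> 0" using fin by simp
  then have "card {v \<in> e. 2 \<le> deg G v} = 1" using e(2) by linarith
  then obtain u where u: "{v \<in> e. 2 \<le> deg G v} = {u}" by (auto simp: card_1_singleton_iff)
  then have ue: "u \<in> e" by blast
  define P where "P = e - {u}"
  define C where "C = \<lparr>verts = verts G - P, edges = edges G - {e}\<rparr>"
  have CV: "verts C = verts G - P" and CE: "edges C = edges G - {e}" by (simp_all add: C_def)
  have eP: "insert u P = e" using ue by (auto simp: P_def)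
  have PV: "P \<subseteq> verts G" using D(6)[OF e(1)] by (auto simp: P_def)
  have uV: "u \<in> verts C" using D(6)[OF e(1)] ue by (auto simp: CV P_def)
  have away: "f \<inter> P = {}" if "f \<in> edges G" "f \<noteq> e" for f
  proof -
    have "\<not> 2 \<le> deg G v" if "v \<in> P" for v using u that by (auto simp: P_def)
    then show ?thesis using single[of _ f] that by (auto simp: P_def)
  qed
  have G: "G = add_pendant C u P"
    unfolding add_pendant_def CV CE eP using PV e(1)
    by (intro hypergraph.equality) (auto simp: insert_absorb)
  have finP: "finite P" and cardP: "card P = k - 1"
    using D(7,8)[OF e(1)] ue by (auto simp: P_def)
  have HC: "k_hypergraph k C"
    unfolding k_hypergraph_def hypergraph_def uniform_def
  proof (intro conjI ballI)
    show "3 \<le> k" by (rule D(1))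
    show "finite (verts C)" using D(3) by (simp add: CV)
    show "verts C \<noteq> {}" using uV by blast
    fix f assume "f \<in> edges C"
    then have f: "f \<in> edges G" "f \<noteq> e" by (auto simp: CE)
    show "f \<subseteq> verts C" using D(6)[OF f(1)] away[OF f] by (auto simp: CV)
    show "card f = k" "2 \<le> card f" using D(1) D(7)[OF f(1)] by auto
  qed
  have pen: "pendant k C u P" using HC uV finP cardP by (auto simp: pendant_def CV)
  have conC: "cut_connected C"
    unfolding cut_connected_def
  proof (intro allI impI)
    fix U assume U: "U \<subseteq> verts C" "U \<noteq> {}" and cl: "\<forall>f\<in>edges C. f \<inter> U \<noteq> {} \<longrightarrow> f \<subseteq> U"
    have cl': "f \<subseteq> U" if "f \<in> edges G" "f \<noteq> e" "f \<inter> U \<noteq> {}" for f using cl that by (auto simp: CE)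
    show "U = verts C"
    proof (cases "u \<in> U")
      case True
      have "U \<union> P = verts G"
      proof (rule cut_connectedD[OF con])
        show "U \<union> P \<subseteq> verts G" using U(1) PV by (auto simp: CV)
        show "f \<subseteq> U \<union> P" if f: "f \<in> edges G" "f \<inter> (U \<union> P) \<noteq> {}" for f
        proof (cases "f = e")
          case True
          then show ?thesis using eP \<open>u \<in> U\<close> by auto
        next
          case False
          then have "f \<inter> U \<noteq> {}" using f(2) away[OF f(1)] by blast
          then show ?thesis using cl'[OF f(1) False] by blast
        qed
      qed (use True in blast)
      then show ?thesis using U(1) by (auto simp: CV)
    next
      case False
      have "U = verts G"
      proof (rule cut_connectedD[OF con])
        show "U \<subseteq> verts G" using U(1) by (auto simp: CV)
        have "e \<inter> U = {}" using False U(1) eP by (auto simp: CV)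
        then show "f \<subseteq> U" if "f \<in> edges G" "f \<inter> U \<noteq> {}" for f using cl' that by blast
      qed (rule U(2))
      then show ?thesis using False uV by (auto simp: CV)
    qed
  qed
  have "card (verts C) = card (verts G) - card P"
    unfolding CV using finP PV by (rule card_Diff_subset)
  moreover have "card (edges C) = card (edges G) - 1" unfolding CE using e(1) by simp
  ultimately have "card (verts C) = (k - 1) * card (edges C)"
    using n cardP by (simp add: diff_mult_distrib2)
  then have "cut_unicyclic k C" using HC conC by (simp add: cut_unicyclic_def)
  then show thesis using that G pen by blast
qed

text \<open>In the last case the induction hypothesis makes the cycle of the smaller lollipop at least \<open>2\<close> long, which is what
allows its comparison with the lollipop whose cycle has one edge more.\<close>

lemma lollipop2_scaled_rho_minimal:
  fixes G :: "'a hypergraph"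
  assumes "cut_unicyclic k G" "\<not> cycle_like k G"
  shows "2 \<le> card (edges G) - 1 \<and>
    (scaled_rho k (lollipop2 (card (edges G) - 1) k 1) < scaled_rho k G \<or>
     hypergraph_iso G (lollipop2 (card (edges G) - 1) k 1))"
  using assms
proof (induction "card (edges G)" arbitrary: G rule: less_induct)
  case less
  obtain C u P where G: "G = add_pendant C u P" and pen: "pendant k C u P" and C: "cut_unicyclic k C"
    by (rule cut_unicyclic_leaf_decomposition[OF less.prems])
  note p = pendantD[OF pen]
  define g where "g = card (edges C)"
  have cardG: "card (edges G) = Suc g"
    using p(9) k_hypergraphD(5)[OF p(1)] by (simp add: G g_def)
  have g2: "2 \<le> g" unfolding g_def by (rule cut_unicyclic_card_edges[OF C])
  have k: "3 \<le> k" by (rule p(6))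
  have LH: "k_hypergraph k (lollipop2 g k 1)" by (rule lollipop2_k_hypergraph[OF k g2])
  show ?case
  proof (cases "cycle_like k C")
    case True
    have "deg C u = 1 \<or> deg C u = 2" using True p(2) by (auto simp: cycle_like_def)
    then show ?thesis
    proof
      assume "deg C u = 1"
      then have "hypergraph_iso G (lollipop2 g k 1)"
        unfolding G g_def by (rule cycle_with_pendant_is_lollipop2[OF True pen])
      then show ?thesis using cardG g2 by simp
    next
      assume "deg C u = 2"
      then obtain w where w: "w \<in> verts C" "deg C w = 1" "scaled_rho k (add_pendant C w P) < scaled_rho k G"
        unfolding G by (rule pendant_at_joint_scaled_rho_gt[OF True pen])
      have pw: "pendant k C w P" using pen w(1) by (simp add: pendant_def)
      have "rho (add_pendant C w P) = rho (lollipop2 g k 1)"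
        unfolding g_def
        by (rule rho_eq_of_iso[OF add_pendant_k_hypergraph[OF pw] LH[unfolded g_def]
              cycle_with_pendant_is_lollipop2[OF True pw w(2)]])
      then show ?thesis using w(3) cardG g2 by (simp add: scaled_rho_def)
    qed
  next
    case False
    have IH: "2 \<le> g - 1" "scaled_rho k (lollipop2 (g - 1) k 1) < scaled_rho k C \<or> hypergraph_iso C (lollipop2 (g - 1) k 1)"
      using less.hyps[OF _ C False] cardG by (auto simp: g_def)
    have "scaled_rho k (lollipop2 (g - 1) k 1) \<le> scaled_rho k C"
      using IH(2)
    proof
      assume "hypergraph_iso C (lollipop2 (g - 1) k 1)"
      from rho_eq_of_iso[OF p(1) lollipop2_k_hypergraph[OF k IH(1)] this] show ?thesis by (simp add: scaled_rho_def)
    qed simp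
    moreover have "scaled_rho k (lollipop2 g k 1) < scaled_rho k (lollipop2 (g - 1) k 1)"
      using IH(1) by (intro lollipop2_scaled_rho_decreasing[OF k]) simp
    moreover have "scaled_rho k C < scaled_rho k G"
      unfolding G using C by (intro scaled_rho_lt_add_pendant[OF pen]) (simp add: cut_unicyclic_def)
    ultimately show ?thesis using cardG g2 by simp
  qed
qed

lemma unicyclic_imp_cut_unicyclic: "3 \<le> k \<Longrightarrow> unicyclic k G \<Longrightarrow> cut_unicyclic k G"
  by (simp add: unicyclic_def cut_unicyclic_def k_hypergraph_def connected_imp_cut_connected)

lemma cycle_like_iff_iso_hypercycle:
  assumes uni: "cut_unicyclic k G"
  shows "cycle_like k G \<longleftrightarrow> hypergraph_iso G (hypercycle (card (edges G)) k)"
proof -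
  have H: "k_hypergraph k G" using uni by (simp add: cut_unicyclic_def)
  note D = k_hypergraphD[OF H]
  have m: "2 \<le> card (edges G)" by (rule cut_unicyclic_card_edges[OF uni])
  have C: "cycle_like k (hypercycle (card (edges G)) k)" by (rule hypercycle_cycle_like(1)[OF m D(1)])
  then have HC: "k_hypergraph k (hypercycle (card (edges G)) k)" by (simp add: cycle_like_def)
  show ?thesis
  proof
    assume G: "cycle_like k G"
    have "edges G \<noteq> {}" using m by auto
    then obtain e where e: "e \<in> edges G" by blast
    have "{z \<in> e. deg G z = 2} \<noteq> e" using G e D(1) D(7)[OF e] by (auto simp: cycle_like_def)
    then obtain u where u: "u \<in> e" "deg G u \<noteq> 2" by blast
    have uV: "u \<in> verts G" using u(1) D(6)[OF e] by blast
    then have "deg G u = 1" using G u(2) by (auto simp: cycle_like_def)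
    then obtain f where "iso_via f (hypercycle (card (edges G)) k) G"
      using cycle_like_is_hypercycle[OF G uV] by blast
    then have "hypergraph_iso (hypercycle (card (edges G)) k) G" using hypergraph_iso_iff by blast
    then show "hypergraph_iso G (hypercycle (card (edges G)) k)"
      by (rule hypergraph_iso_sym[OF k_hypergraphD(2)[OF HC]])
  next
    assume "hypergraph_iso G (hypercycle (card (edges G)) k)"
    from rho_eq_of_iso[OF H HC this] have "scaled_rho k G = cycle_value k"
      using scaled_rho_cycle_like[OF C] by (simp add: scaled_rho_def)
    then show "cycle_like k G" using cut_unicyclic_scaled_rho(2)[OF uni] by simp
  qed
qed

theorem theorem1p2:
  fixes G :: "'a hypergraph" and k n g :: nat
  assumes "3 \<le> k"
    and "unicyclic k G"
    and "n = card (verts G)"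
    and "g = (n - k + 1) div (k - 1)"
  shows
    "((real k - 1 + sqrt ((real k - 1)^2 + 8 * (real k - 1))) / (2 * (real k - 1)) \<le> rho G \<and>
      ((real k - 1 + sqrt ((real k - 1)^2 + 8 * (real k - 1))) / (2 * (real k - 1)) = rho G
         \<longleftrightarrow> hypergraph_iso G (hypercycle_of_order n k)))
     \<and>
     (\<not> hypergraph_iso G (hypercycle_of_order n k) \<longrightarrow>
        rho (lollipop2 g k 1) \<le> rho G \<and>
        (rho (lollipop2 g k 1) = rho G \<longleftrightarrow> hypergraph_iso G (lollipop2 g k 1)))"
proof -
  have uni: "cut_unicyclic k G" by (rule unicyclic_imp_cut_unicyclic[OF assms(1,2)])
  then have H: "k_hypergraph k G" by (simp add: cut_unicyclic_def)
  define m where "m = card (edges G)"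
  have m: "2 \<le> m" unfolding m_def by (rule cut_unicyclic_card_edges[OF uni])
  have n: "n = (k - 1) * m" using uni by (simp add: assms(3) m_def cut_unicyclic_def)
  have "hypercycle_of_order n k = hypercycle m k"
    using assms(1) by (simp add: hypercycle_of_order_def n)
  then have cyc: "hypergraph_iso G (hypercycle_of_order n k) \<longleftrightarrow> cycle_like k G"
    using cycle_like_iff_iso_hypercycle[OF uni] by (simp add: m_def)
  have g: "g = m - 1"
  proof -
    obtain j where j: "m = Suc (Suc j)" using m by (metis Suc_le_D numeral_2_eq_2 Suc_le_mono)
    obtain l where l: "k = Suc (Suc l)" using assms(1) by (metis Suc_le_D numeral_3_eq_3 Suc_le_mono)
    have "n - k + 1 = (k - 1) * (m - 1)" unfolding n j l by simp
    then show ?thesis using assms(1,4) by simp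
  qed
  have k1: "0 < real k - 1" using assms(1) by simp
  have L: "(real k - 1 + sqrt ((real k - 1)^2 + 8 * (real k - 1))) / (2 * (real k - 1))
      = cycle_value k / (real k - 1)" (is "?L = _")
    by (simp add: cycle_value_def)
  have rho: "rho G = scaled_rho k G / (real k - 1)" using k1 by (simp add: scaled_rho_def)
  have 1: "?L \<le> rho G" unfolding L rho using cut_unicyclic_scaled_rho(1)[OF uni] k1 by (simp add: divide_right_mono)
  have 2: "?L = rho G \<longleftrightarrow> cycle_like k G" unfolding L rho using cut_unicyclic_scaled_rho(2)[OF uni] k1 by simp
  have 3: "rho (lollipop2 g k 1) \<le> rho G \<and> (rho (lollipop2 g k 1) = rho G \<longleftrightarrow> hypergraph_iso G (lollipop2 g k 1))"
    if "\<not> cycle_like k G"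
  proof -
    have min: "2 \<le> g" "scaled_rho k (lollipop2 g k 1) < scaled_rho k G \<or> hypergraph_iso G (lollipop2 g k 1)"
      using lollipop2_scaled_rho_minimal[OF uni that] by (auto simp: g m_def)
    have iso: "hypergraph_iso G (lollipop2 g k 1) \<Longrightarrow> rho G = rho (lollipop2 g k 1)"
      by (rule rho_eq_of_iso[OF H lollipop2_k_hypergraph[OF assms(1) min(1)]])
    have "rho (lollipop2 g k 1) < rho G \<or> hypergraph_iso G (lollipop2 g k 1)"
      using min(2) k1 by (simp add: scaled_rho_def)
    then show ?thesis using iso by auto
  qed
  show ?thesis unfolding cyc using 1 2 3 by blast
qed

end
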